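(* Let $k\ge4$, let $g(x_1,\dots,x_k)=\sum_{1\le a<b<c<d\le k}x_ax_bx_cx_d$ be the elementary symmetric polynomial of degree $4$, and let \[ g_1(x_1,\dots,x_k)=x_1x_k\sum_{2\le i<j\le k-1}x_ix_j \] be its incremental component (for mean $\mu=0$). Under the Gaussian AR(1) model with parameter $\rho$, writing $m_f(\rho)=\mathbb E_\rho[f(X_1,\dots,X_k)]$, one has $m_g'(0)=m_{g_1}'(0)=0$ and, as $\rho\to0$, \[ m_g(\rho)=\binom{k-2}{2}\rho^2+O(\rho^3),\qquad m_{g_1}(\rho)=\rho^2+O(\rho^3). \] Consequently, for fixed $c\neq0$, under the second-order local scaling $\rho_n=c\,n^{-1/4}$, as $n\to\infty$, \[ \frac{(n-k+1)^{-1/2}\sum_{i=1}^{n-k+1}g(Y_i)}{\sigma(g)}\Rightarrow N\!\left(\frac{\binom{k-2}{2}c^2}{\sigma(g)},\,1\right) \] and \[ \frac{(n-k+1)^{-1/2}\sum_{i=1}^{n-k+1}g_1(Y_i)}{\sigma(g_1)}\Rightarrow N\!\left(\frac{c^2}{\sigma(g_1)},\,1\right). \]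
   Context: The Gaussian AR(1) model with parameter $\rho$, $|\rho|<1$, is $X_t=\rho X_{t-1}+\varepsilon_t$ with $\varepsilon_t\sim N(0,1-\rho^2)$ independent and independent of the past, initialized in the stationary distribution, so $X_t\sim N(0,1)$ and $\operatorname{Cov}(X_s,X_t)=\rho^{|s-t|}$; $\mathbb E_\rho$ is expectation under this model. For each $n$ (large enough that $|\rho_n|<1$), $X_1,\dots,X_n$ is drawn from the model with parameter $\rho_n$, and $Y_i=(X_i,\dots,X_{i+k-1})$. The constant $\sigma(f)>0$ is defined under the i.i.d. $N(0,1)$ null by $\sigma^2(f)=\operatorname{Var}(f(Y_1))+2\sum_{r=1}^{k-1}\operatorname{Cov}(f(Y_1),f(Y_{1+r}))$ for $X_1,X_2,\dots$ i.i.d. $N(0,1)$. The incremental component of a mean-zero function $f\in L^2(\mathbb R^k,\nu^{\otimes k})$, $\nu=N(0,1)$, is its orthogonal projection onto the mean-zero functions with $\int f\,\nu(dx_1)=0$ and $\int f\,\nu(dx_k)=0$. *)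

theory Defs
  imports "HOL-Probability.Probability" "HOL-Library.Landau_Symbols"
begin

text \<open>
  Time runs over \<open>{1..}\<close>; the values \<open>X 0\<close>, \<open>\<epsilon> 0\<close> and \<open>\<epsilon> 1\<close> are irrelevant.
  Points of \<open>\<real>\<^sup>k\<close> are functions \<open>nat \<Rightarrow> real\<close> that are extensional on \<open>{1..k}\<close>.
  Since \<open>indep_var\<close> needs both variables to have values of one type, independence of \<open>\<epsilon> t\<close> from the past
  \<open>(X s)\<^bsub>s<t\<^esub>\<close> is stated with \<open>\<epsilon> t\<close> as a one-component vector.
\<close>

definition gaussian_ar1 :: "'a measure \<Rightarrow> real \<Rightarrow> (nat \<Rightarrow> 'a \<Rightarrow> real) \<Rightarrow> bool" where
  "gaussian_ar1 M \<rho> X \<longleftrightarrow>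
     prob_space M \<and>
     distributed M lborel (X 1) std_normal_density \<and>
     (\<exists>\<epsilon> :: nat \<Rightarrow> 'a \<Rightarrow> real.
        (\<forall>t\<ge>2. distributed M lborel (\<epsilon> t) (normal_density 0 (sqrt (1 - \<rho>\<^sup>2)))) \<and>
        prob_space.indep_vars M (\<lambda>_. borel) \<epsilon> {2..} \<and>
        (\<forall>t\<ge>2. prob_space.indep_var M
                   (\<Pi>\<^sub>M s\<in>{1..<t}. borel) (\<lambda>\<omega>. \<lambda>s\<in>{1..<t}. X s \<omega>)
                   (\<Pi>\<^sub>M s\<in>{t}. borel) (\<lambda>\<omega>. \<lambda>s\<in>{t}. \<epsilon> s \<omega>)) \<and>
        (\<forall>t\<ge>2. \<forall>\<omega>\<in>space M. X t \<omega> = \<rho> * X (t - 1) \<omega> + \<epsilon> t \<omega>))"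

lemma gaussian_ar1_exists:
  assumes "\<bar>\<rho>\<bar> < 1"
  shows "\<exists>(M :: (nat \<Rightarrow> real) measure) X. gaussian_ar1 M \<rho> X"
proof -
  define s where "s = sqrt (1 - \<rho>\<^sup>2)"
  have s: "s > 0" using assms by (simp add: s_def abs_square_less_1)
  define N where "N t = density lborel (normal_density 0 (if t = (1::nat) then 1 else s))" for t
  define M where "M = (\<Pi>\<^sub>M t\<in>UNIV. N t)"
  have pN: "prob_space (N t)" for t
    unfolding N_def using s by (intro prob_space_normal_density) auto
  interpret P: product_prob_space N UNIV
    by (simp add: product_prob_space_def product_prob_space_axioms_def product_sigma_finite_def pN
         prob_space_imp_sigma_finite)
  have pM: "prob_space M" unfolding M_def by (intro prob_space_PiM pN)
  interpret prob_space M by (fact pM)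
  have sN: "sets (N t) = sets borel" for t by (simp add: N_def)
  have meas[measurable]: "(\<lambda>\<omega>. \<omega> t) \<in> borel_measurable M" for t
    unfolding M_def using measurable_component_singleton[of t UNIV N] by (simp add: measurable_cong_sets[OF refl sN])
  have dN: "distr M borel (\<lambda>\<omega>. \<omega> t) = N t" for t
  proof -
    have "distr M borel (\<lambda>\<omega>. \<omega> t) = distr (PiM UNIV N) (N t) (\<lambda>\<omega>. \<omega> t)"
      unfolding M_def by (intro distr_cong) (auto simp: sN)
    also have "\<dots> = N t" by (intro distr_PiM_component pN) auto
    finally show ?thesis .
  qed
  have dist: "distributed M lborel (\<lambda>\<omega>. \<omega> t) (normal_density 0 (if t = 1 then 1 else s))" for t
    unfolding distributed_def
    using dN[of t] unfolding N_def by (auto simp: distr_cong[OF refl sets_lborel refl])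
  have ind: "indep_vars (\<lambda>_. borel) (\<lambda>t \<omega>. \<omega> t) UNIV"
  proof (subst indep_vars_iff_distr_eq_PiM)
    have "distr M (\<Pi>\<^sub>M i\<in>UNIV. borel) (\<lambda>x. \<lambda>i\<in>UNIV. x i) = distr M M (\<lambda>x. x)"
    proof (rule distr_cong)
      show "sets (\<Pi>\<^sub>M i\<in>UNIV. borel) = sets M"
        unfolding M_def by (rule sets_PiM_cong) (auto simp: sN)
    qed auto
    also have "\<dots> = M" by simp
    finally show "distr M (\<Pi>\<^sub>M i\<in>UNIV. borel) (\<lambda>x. \<lambda>i\<in>UNIV. x i)
       = (\<Pi>\<^sub>M i\<in>UNIV. distr M borel (\<lambda>\<omega>. \<omega> i))"
      unfolding dN by (simp only: M_def[symmetric])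
  qed auto
  define X where "X = rec_nat (\<lambda>\<omega>. 0) (\<lambda>t x (\<omega>::nat\<Rightarrow>real). (if t = 0 then 0 else \<rho> * x \<omega>) + \<omega> (Suc t))"
  have X0: "X 0 \<omega> = 0" and XS: "X (Suc t) \<omega> = (if t = 0 then 0 else \<rho> * X t \<omega>) + \<omega> (Suc t)" for t \<omega>
    by (simp_all add: X_def)
  have X1: "X (Suc 0) = (\<lambda>\<omega>. \<omega> (Suc 0))" by (simp add: XS fun_eq_iff)
  have Xm: "(\<lambda>x. X r x) \<in> borel_measurable (\<Pi>\<^sub>M i\<in>{1..<t}. borel)" if "r < t" for r t
    using that
  proof (induction r)
    case 0 then show ?case by (simp add: X0)
  next
    case (Suc r)
    have "(\<lambda>x. x (Suc r)) \<in> borel_measurable (\<Pi>\<^sub>M i\<in>{1..<t}. borel)"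
      using Suc.prems by (intro measurable_component_singleton) auto
    then show ?case using Suc by (simp add: XS)
  qed
  have Xr: "X r (restrict \<omega> {1..<t}) = X r \<omega>" if "r < t" for r t \<omega>
    using that by (induction r) (auto simp: X0 XS)
  have past: "indep_var (\<Pi>\<^sub>M s\<in>{1..<t}. borel) (\<lambda>\<omega>. \<lambda>s\<in>{1..<t}. X s \<omega>)
                   (\<Pi>\<^sub>M s\<in>{t}. borel) (\<lambda>\<omega>. \<lambda>s\<in>{t}. \<omega> s)" for t
  proof -
    have 1: "indep_var (\<Pi>\<^sub>M s\<in>{1..<t}. borel) (\<lambda>\<omega>. \<lambda>s\<in>{1..<t}. \<omega> s)
                   (\<Pi>\<^sub>M s\<in>{t}. borel) (\<lambda>\<omega>. \<lambda>s\<in>{t}. \<omega> s)"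
      by (rule indep_var_restrict[OF ind]) auto
    have 2: "(\<lambda>x. \<lambda>s\<in>{1..<t}. X s x) \<in> measurable (\<Pi>\<^sub>M s\<in>{1..<t}. borel) (\<Pi>\<^sub>M s\<in>{1..<t}. borel)"
      by (rule measurable_restrict) (use Xm in auto)
    have 3: "(\<lambda>\<omega>. \<lambda>s\<in>{1..<t}. X s \<omega>) = (\<lambda>x. \<lambda>s\<in>{1..<t}. X s x) \<circ> (\<lambda>\<omega>. \<lambda>s\<in>{1..<t}. \<omega> s)"
      by (auto simp: fun_eq_iff Xr[simplified])
    show ?thesis
      using indep_var_compose[OF 1 2 measurable_ident_sets[OF refl]] unfolding 3[symmetric]
      by (simp add: comp_def)
  qed
  have "gaussian_ar1 M \<rho> X"
    unfolding gaussian_ar1_def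
  proof (intro conjI exI[of _ "\<lambda>t \<omega>. \<omega> t"] allI impI ballI)
    show "prob_space M" by (fact pM)
    show "distributed M lborel (X 1) std_normal_density"
      using dist[of 1] by (simp add: X1)
    show "distributed M lborel (\<lambda>\<omega>. \<omega> t) (normal_density 0 (sqrt (1 - \<rho>\<^sup>2)))" if "2 \<le> t" for t
      using dist[of t] that by (simp add: s_def)
    show "indep_vars (\<lambda>_. borel) (\<lambda>t \<omega>. \<omega> t) {2..}"
      using ind by (rule indep_vars_subset) auto
    show "X t \<omega> = \<rho> * X (t - 1) \<omega> + \<omega> t" if "2 \<le> t" for t \<omega>
      using that XS[of "t - 1" \<omega>] by (simp add: numeral_2_eq_2)
  qed (rule past)
  then show ?thesis by blast
qed

text \<open>\<open>block k X i\<close> is \<open>Y\<^sub>i = (X\<^sub>i, \<dots>, X\<^bsub>i+k-1\<^esub>)\<close>, with components numbered from \<open>1\<close>.\<close>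

definition block :: "nat \<Rightarrow> (nat \<Rightarrow> 'a \<Rightarrow> real) \<Rightarrow> nat \<Rightarrow> 'a \<Rightarrow> nat \<Rightarrow> real" where
  "block k X i \<omega> = (\<lambda>j\<in>{1..k}. X (i + j - 1) \<omega>)"

definition block_mean ::
  "'a measure \<Rightarrow> (nat \<Rightarrow> 'a \<Rightarrow> real) \<Rightarrow> nat \<Rightarrow> ((nat \<Rightarrow> real) \<Rightarrow> real) \<Rightarrow> real" where
  "block_mean M X k f = (\<integral>\<omega>. f (block k X 1 \<omega>) \<partial>M)"

definition std_normal :: "real measure" where
  "std_normal = density lborel std_normal_density"

definition std_normal_power :: "nat \<Rightarrow> (nat \<Rightarrow> real) measure" where
  "std_normal_power k = (\<Pi>\<^sub>M i\<in>{1..k}. std_normal)"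

definition null_law :: "(nat \<Rightarrow> real) measure" where
  "null_law = (\<Pi>\<^sub>M t\<in>{1..}. std_normal)"

definition covariance :: "'a measure \<Rightarrow> ('a \<Rightarrow> real) \<Rightarrow> ('a \<Rightarrow> real) \<Rightarrow> real" where
  "covariance M U V = (\<integral>\<omega>. (U \<omega> - (\<integral>\<omega>'. U \<omega>' \<partial>M)) * (V \<omega> - (\<integral>\<omega>'. V \<omega>' \<partial>M)) \<partial>M)"

definition null_sd :: "nat \<Rightarrow> ((nat \<Rightarrow> real) \<Rightarrow> real) \<Rightarrow> real" where
  "null_sd k f =
     (let Y = block k (\<lambda>t \<omega>. \<omega> t) in
      sqrt (prob_space.variance null_law (\<lambda>\<omega>. f (Y 1 \<omega>))
            + 2 * (\<Sum>r=1..k-1. covariance null_law (\<lambda>\<omega>. f (Y 1 \<omega>)) (\<lambda>\<omega>. f (Y (1 + r) \<omega>)))))"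

definition mean_zero_L2 :: "nat \<Rightarrow> ((nat \<Rightarrow> real) \<Rightarrow> real) set" where
  "mean_zero_L2 k =
     {f \<in> borel_measurable (std_normal_power k).
        integrable (std_normal_power k) (\<lambda>x. (f x)\<^sup>2) \<and>
        (\<integral>x. f x \<partial>std_normal_power k) = 0}"

definition increment_space :: "nat \<Rightarrow> ((nat \<Rightarrow> real) \<Rightarrow> real) set" where
  "increment_space k =
     {f \<in> mean_zero_L2 k.
        (AE x in std_normal_power k. (\<integral>y. f (x(1 := y)) \<partial>std_normal) = 0) \<and>
        (AE x in std_normal_power k. (\<integral>y. f (x(k := y)) \<partial>std_normal) = 0)}"

text \<open>
  \<open>h\<close> is (a version of) the orthogonal projection of \<open>f\<close> onto \<open>increment_space k\<close>;
  functions in \<open>L\<^sup>2\<close> are not identified here, so it is determined only almost everywhere.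
\<close>

definition incremental_component ::
  "nat \<Rightarrow> ((nat \<Rightarrow> real) \<Rightarrow> real) \<Rightarrow> ((nat \<Rightarrow> real) \<Rightarrow> real) \<Rightarrow> bool" where
  "incremental_component k f h \<longleftrightarrow>
     f \<in> mean_zero_L2 k \<and> h \<in> increment_space k \<and>
     (\<forall>u\<in>increment_space k. (\<integral>x. (f x - h x) * u x \<partial>std_normal_power k) = 0)"

definition elem_sym4 :: "nat \<Rightarrow> (nat \<Rightarrow> real) \<Rightarrow> real" where
  "elem_sym4 k x =
     (\<Sum>(a, b, c, d) \<in> {(a, b, c, d). 1 \<le> a \<and> a < b \<and> b < c \<and> c < d \<and> d \<le> k}.
        x a * x b * x c * x d)"

definition elem_sym4_incr :: "nat \<Rightarrow> (nat \<Rightarrow> real) \<Rightarrow> real" where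
  "elem_sym4_incr k x =
     x 1 * x k * (\<Sum>(i, j) \<in> {(i, j). 2 \<le> i \<and> i < j \<and> j \<le> k - 1}. x i * x j)"

definition normalized_sum ::
  "nat \<Rightarrow> ((nat \<Rightarrow> real) \<Rightarrow> real) \<Rightarrow> (nat \<Rightarrow> 'a \<Rightarrow> real) \<Rightarrow> nat \<Rightarrow> 'a \<Rightarrow> real" where
  "normalized_sum k f X n \<omega> =
     real (n - k + 1) powr (-1/2) * (\<Sum>i=1..n-k+1. f (block k X i \<omega>)) / null_sd k f"

end

theory Submission
  imports Defs "HOL-Real_Asymp.Real_Asymp"
begin

text \<open>
  The law of an AR(1) path is determined by its parameter, so everything can be computed on one space,
  that of the i.i.d. null: there the path is built from the coordinates, and unfolding the recursion three times gives
  \<open>X\<^sub>t = \<surd>(1 - \<rho>\<^sup>2) (z\<^sub>t + \<rho> z\<^bsub>t-1\<^esub> + \<rho>\<^sup>2 z\<^bsub>t-2\<^esub>) + \<rho>\<^sup>3 X\<^bsub>t-3\<^esub>\<close> (up to a shift of the time index).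
  Expanding a product of four such sums sorts it by powers of \<open>\<rho>\<close>. The terms of order \<open>\<rho>\<close> have mean zero;
  those of order \<open>\<rho>\<^sup>2\<close> have mean zero except \<open>z\<^sub>a z\<^bsub>b-1\<^esub> z\<^sub>c z\<^bsub>d-1\<^esub>\<close> for \<open>b = a + 1\<close>, \<open>d = c + 1\<close>,
  so the second-order coefficient counts pairs of adjacent pairs.
  For \<open>\<rho> = c n\<^bsup>-1/4\<^esup>\<close> the normalized sums of the terms of order at least \<open>\<rho>\<^sup>3\<close> vanish in \<open>L\<^sup>2\<close> by the triangle inequality,
  those of order \<open>\<rho>\<close> and \<open>\<rho>\<^sup>2\<close> have vanishing variance because they are of finite range, and what remains is the
  null statistic shifted by a constant. Its normal limit follows from the i.i.d. central limit theorem
  for long blocks separated by gaps of length \<open>k\<close>.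
\<close>

section \<open>Independent standard normal coordinates\<close>

text \<open>The scaling gives \<open>N * \<rho> ^ 4 \<longlonglongrightarrow> c ^ 4\<close> for
  \<open>N\<close> summands, which fixes where the expansion stops. A sum of \<open>N\<close> terms
  with bounded second moments, divided by \<open>sqrt N\<close>, has L2 norm of order at most
  \<open>sqrt N\<close>, and \<open>sqrt N * \<rho> ^ 3\<close> tends to 0; so nothing need be known
  about the dependence within the remainder, which involves the whole past. At order 1 this crude
  bound diverges like \<open>sqrt N * \<rho>\<close>. There finite range is used: centred sums have
  variance of order \<open>N\<close>, so the factor \<rho> is enough. At order 2 the fluctuations
  vanish likewise, but \<open>sqrt N * \<rho> ^ 2\<close> times the mean converges and is the shift.
  The remainder is an earlier value of the stationary path, hence standard normal for every \<rho>,
  and one moment bound serves all lags. A common space allows comparison in L2: characteristic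
  functions differ by at most \<open>\<bar>t\<bar>\<close> times the L2 distance. The same estimate
  discards the gaps between the long blocks. The division by the standard deviation is legitimate
  because, under the null, monomials with increasing indices never have negative covariance.\<close>

abbreviation iid_normal :: "nat set \<Rightarrow> (nat \<Rightarrow> real) measure" where
  "iid_normal I \<equiv> \<Pi>\<^sub>M t\<in>I. std_normal"

lemma sets_std_normal [simp, measurable_cong]: "sets std_normal = sets borel"
  by (simp add: std_normal_def)

lemma space_std_normal [simp]: "space std_normal = UNIV"
  by (simp add: std_normal_def)

lemma prob_space_std_normal: "prob_space std_normal"
  unfolding std_normal_def by (rule prob_space_normal_density) simp

lemma prob_space_iid_normal: "prob_space (iid_normal I)"
  by (intro prob_space_PiM prob_space_std_normal)

lemma measurable_coord [measurable]: "(\<lambda>\<omega>. \<omega> t) \<in> borel_measurable (iid_normal I)"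
proof (cases "t \<in> I")
  case True
  then have "(\<lambda>\<omega>. \<omega> t) \<in> measurable (iid_normal I) std_normal" by simp
  then show ?thesis by (simp cong: measurable_cong_sets)
next
  case False
  then have "(\<lambda>\<omega>. \<omega> t) \<in> borel_measurable (iid_normal I) \<longleftrightarrow>
      (\<lambda>\<omega>. undefined :: real) \<in> borel_measurable (iid_normal I)"
    by (intro measurable_cong) (auto simp: space_PiM PiE_def extensional_def)
  then show ?thesis by simp
qed

lemma distr_coord:
  assumes "t \<in> I"
  shows "distr (iid_normal I) borel (\<lambda>\<omega>. \<omega> t) = std_normal"
proof -
  have "distr (iid_normal I) borel (\<lambda>\<omega>. \<omega> t) = distr (iid_normal I) std_normal (\<lambda>\<omega>. \<omega> t)"
    by (intro distr_cong) simp_all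
  also have "\<dots> = std_normal" using assms by (intro distr_PiM_component prob_space_std_normal)
  finally show ?thesis .
qed

lemma distributed_coord:
  assumes "t \<in> I"
  shows "distributed (iid_normal I) lborel (\<lambda>\<omega>. \<omega> t) std_normal_density"
  unfolding distributed_def using distr_coord[OF assms]
  by (auto simp: std_normal_def distr_cong[OF refl sets_lborel refl])

lemma distr_iid_normal_reindex:
  assumes "inj_on f I" "f ` I \<subseteq> K"
  shows "distr (iid_normal K) (iid_normal I) (\<lambda>\<omega>. \<lambda>t\<in>I. \<omega> (f t)) = iid_normal I"
  using assms by (intro distr_PiM_reindex prob_space_std_normal) auto

lemma indep_coords: "prob_space.indep_vars (iid_normal I) (\<lambda>_. borel) (\<lambda>t \<omega>. \<omega> t) I"
\<comment> \<open>The criterion through the joint law requires a nonempty index set; for the empty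
  one independence is unfolded directly.\<close>
proof (cases "I = {}")
  case True
  interpret prob_space "iid_normal I" by (rule prob_space_iid_normal)
  show ?thesis unfolding indep_vars_def indep_sets_def using True by simp
next
  case False
  interpret prob_space "iid_normal I" by (rule prob_space_iid_normal)
  have "distr (iid_normal I) (\<Pi>\<^sub>M i\<in>I. borel) (\<lambda>x. \<lambda>i\<in>I. x i) = distr (iid_normal I) (iid_normal I) (\<lambda>x. x)"
    by (rule distr_cong) (auto simp: space_PiM intro!: sets_PiM_cong)
  also have "\<dots> = (\<Pi>\<^sub>M i\<in>I. distr (iid_normal I) borel (\<lambda>\<omega>. \<omega> i))"
    by (simp add: distr_coord cong: PiM_cong)
  finally show ?thesis using False
    by (subst indep_vars_iff_distr_eq_PiM) auto
qed

text \<open>Invariance under \<open>restrict\<close> encodes dependence on the coordinates in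
  \<open>A\<close> alone: \<open>F\<close> factors through the restriction to \<open>A\<close>,
  \<open>G\<close> through that to \<open>B\<close>, and these restrictions are independent. All
  independence of finite windows below has this form.\<close>

lemma indep_var_disjoint_coords:
  assumes "A \<inter> B = {}" "A \<subseteq> I" "B \<subseteq> I"
    and "F \<in> measurable (iid_normal A) S" "G \<in> measurable (iid_normal B) T"
    and "\<And>\<omega>. F (restrict \<omega> A) = F \<omega>" "\<And>\<omega>. G (restrict \<omega> B) = G \<omega>"
  shows "prob_space.indep_var (iid_normal I) S F T G"
proof -
  interpret prob_space "iid_normal I" by (rule prob_space_iid_normal)
  have eq: "sets (\<Pi>\<^sub>M i\<in>A. borel) = sets (iid_normal A)" for A :: "nat set"
    by (intro sets_PiM_cong) auto
  have "indep_var (\<Pi>\<^sub>M i\<in>A. borel) (\<lambda>\<omega>. restrict \<omega> A) (\<Pi>\<^sub>M i\<in>B. borel) (\<lambda>\<omega>. restrict \<omega> B)"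
    using indep_var_restrict[OF indep_coords assms(1-3)] by simp
  moreover have "F \<in> measurable (\<Pi>\<^sub>M i\<in>A. borel) S" "G \<in> measurable (\<Pi>\<^sub>M i\<in>B. borel) T"
    using assms(4,5) by (simp_all cong: measurable_cong_sets add: eq)
  ultimately have "indep_var S (F \<circ> (\<lambda>\<omega>. restrict \<omega> A)) T (G \<circ> (\<lambda>\<omega>. restrict \<omega> B))"
    by (rule indep_var_compose)
  then show ?thesis by (simp add: comp_def assms)
qed

lemma expectation_mult_disjoint_coords:
  fixes F G :: "(nat \<Rightarrow> real) \<Rightarrow> real"
  assumes "A \<inter> B = {}" "A \<subseteq> I" "B \<subseteq> I"
    and "F \<in> borel_measurable (iid_normal A)" "G \<in> borel_measurable (iid_normal B)"
    and "\<And>\<omega>. F (restrict \<omega> A) = F \<omega>" "\<And>\<omega>. G (restrict \<omega> B) = G \<omega>"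
    and "integrable (iid_normal I) F" "integrable (iid_normal I) G"
  shows "(\<integral>\<omega>. F \<omega> * G \<omega> \<partial>iid_normal I) = (\<integral>\<omega>. F \<omega> \<partial>iid_normal I) * (\<integral>\<omega>. G \<omega> \<partial>iid_normal I)"
    and "integrable (iid_normal I) (\<lambda>\<omega>. F \<omega> * G \<omega>)"
  using prob_space.indep_var_lebesgue_integral[OF prob_space_iid_normal _ assms(8,9)]
    prob_space.indep_var_integrable[OF prob_space_iid_normal _ assms(8,9)]
    indep_var_disjoint_coords[OF assms(1-7)] by blast+

lemma std_normal_moments:
  assumes "distributed M lborel U std_normal_density"
  shows "integrable M (\<lambda>x. U x ^ j)"
    and "(\<integral>x. U x \<partial>M) = 0"
    and "(\<integral>x. (U x)\<^sup>2 \<partial>M) = 1"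
    and "(\<integral>x. U x ^ 8 \<partial>M) = 105"
proof -
  show "integrable M (\<lambda>x. U x ^ j)"
    using distributed_integrable[OF assms, of "\<lambda>x. x ^ j"] integrable_std_normal_moment[of j] by simp
  have int: "(\<integral>x. U x ^ j \<partial>M) = (\<integral>x. std_normal_density x * x ^ j \<partial>lborel)" for j
    using distributed_integral[OF assms, of "\<lambda>x. x ^ j"] by simp
  show "(\<integral>x. U x \<partial>M) = 0"
    using int[of 1] integral_std_normal_moment_odd[of 0] by simp
  show "(\<integral>x. (U x)\<^sup>2 \<partial>M) = 1"
    using int[of 2] integral_std_normal_moment_even[of 1] by simp
  show "(\<integral>x. U x ^ 8 \<partial>M) = 105"
    using int[of 8] integral_std_normal_moment_even[of 4] by (simp add: fact_numeral)
qed

text \<open>Two rounds of \<open>2 * x * y \<le> x^2 + y^2\<close>. Second moments of a product of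
  four factors are thus controlled by marginal eighth moments, whatever the joint law; the lagged
  factors below may coincide or be dependent.\<close>

lemma prod4_square_le: "(a * b * c * d)\<^sup>2 \<le> (a ^ 8 + b ^ 8 + c ^ 8 + d ^ 8) / (4::real)"
proof -
  have am: "x * y \<le> (x\<^sup>2 + y\<^sup>2) / 2" for x y :: real
    using sum_squares_bound[of x y] by simp
  have "(a * b * c * d)\<^sup>2 = (a\<^sup>2 * b\<^sup>2) * (c\<^sup>2 * d\<^sup>2)" by (simp add: power_mult_distrib)
  also have "\<dots> \<le> ((a\<^sup>2 * b\<^sup>2)\<^sup>2 + (c\<^sup>2 * d\<^sup>2)\<^sup>2) / 2" by (rule am)
  also have "(a\<^sup>2 * b\<^sup>2)\<^sup>2 = a ^ 4 * b ^ 4" by (simp add: power_mult_distrib)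
  also have "(c\<^sup>2 * d\<^sup>2)\<^sup>2 = c ^ 4 * d ^ 4" by (simp add: power_mult_distrib)
  also have "(a ^ 4 * b ^ 4 + c ^ 4 * d ^ 4) / 2
      \<le> (((a ^ 4)\<^sup>2 + (b ^ 4)\<^sup>2) / 2 + ((c ^ 4)\<^sup>2 + (d ^ 4)\<^sup>2) / 2) / 2"
    by (intro divide_right_mono add_mono am) simp
  finally show ?thesis by (simp add: field_simps)
qed

lemma prod4_L2:
  fixes U V W Z :: "'a \<Rightarrow> real"
  assumes [measurable]: "U \<in> borel_measurable M" "V \<in> borel_measurable M" "W \<in> borel_measurable M" "Z \<in> borel_measurable M"
    and int: "integrable M (\<lambda>x. U x ^ 8)" "integrable M (\<lambda>x. V x ^ 8)"
      "integrable M (\<lambda>x. W x ^ 8)" "integrable M (\<lambda>x. Z x ^ 8)"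
  shows "integrable M (\<lambda>x. (U x * V x * W x * Z x)\<^sup>2)"
    and "(\<integral>x. (U x * V x * W x * Z x)\<^sup>2 \<partial>M)
      \<le> ((\<integral>x. U x ^ 8 \<partial>M) + (\<integral>x. V x ^ 8 \<partial>M) + (\<integral>x. W x ^ 8 \<partial>M) + (\<integral>x. Z x ^ 8 \<partial>M)) / 4"
proof -
  have b: "integrable M (\<lambda>x. (U x ^ 8 + V x ^ 8 + W x ^ 8 + Z x ^ 8) / 4)" using int by simp
  show i: "integrable M (\<lambda>x. (U x * V x * W x * Z x)\<^sup>2)"
    by (rule Bochner_Integration.integrable_bound[OF b])
       (use prod4_square_le in \<open>auto simp: abs_of_nonneg\<close>)
  have "(\<integral>x. (U x * V x * W x * Z x)\<^sup>2 \<partial>M) \<le> (\<integral>x. (U x ^ 8 + V x ^ 8 + W x ^ 8 + Z x ^ 8) / 4 \<partial>M)"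
    by (intro integral_mono i b prod4_square_le)
  also have "\<dots> = ((\<integral>x. U x ^ 8 \<partial>M) + (\<integral>x. V x ^ 8 \<partial>M) + (\<integral>x. W x ^ 8 \<partial>M) + (\<integral>x. Z x ^ 8 \<partial>M)) / 4"
    using int by simp
  finally show "(\<integral>x. (U x * V x * W x * Z x)\<^sup>2 \<partial>M)
      \<le> ((\<integral>x. U x ^ 8 \<partial>M) + (\<integral>x. V x ^ 8 \<partial>M) + (\<integral>x. W x ^ 8 \<partial>M) + (\<integral>x. Z x ^ 8 \<partial>M)) / 4" .
qed

lemma std_normal_prod4:
  assumes "distributed M lborel U std_normal_density" "distributed M lborel V std_normal_density"
    "distributed M lborel W std_normal_density" "distributed M lborel Z std_normal_density"
  shows "integrable M (\<lambda>x. (U x * V x * W x * Z x)\<^sup>2)"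
    and "(\<integral>x. (U x * V x * W x * Z x)\<^sup>2 \<partial>M) \<le> 105"
proof -
  have "U \<in> borel_measurable M" "V \<in> borel_measurable M" "W \<in> borel_measurable M" "Z \<in> borel_measurable M"
    using assms by (auto simp: distributed_def)
  note L2 = prod4_L2[OF this assms[THEN std_normal_moments(1)]]
  show "integrable M (\<lambda>x. (U x * V x * W x * Z x)\<^sup>2)" by (rule L2)
  show "(\<integral>x. (U x * V x * W x * Z x)\<^sup>2 \<partial>M) \<le> 105"
    using L2(2) by (simp add: assms[THEN std_normal_moments(4)])
qed

lemma integrable_mult_L2:
  fixes U V :: "'a \<Rightarrow> real"
  assumes [measurable]: "U \<in> borel_measurable M" "V \<in> borel_measurable M"
    and "integrable M (\<lambda>x. (U x)\<^sup>2)" "integrable M (\<lambda>x. (V x)\<^sup>2)"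
  shows "integrable M (\<lambda>x. U x * V x)"
proof (rule Bochner_Integration.integrable_bound)
  show "integrable M (\<lambda>x. (U x)\<^sup>2 + (V x)\<^sup>2)" using assms by simp
  have "\<bar>u * v\<bar> \<le> u\<^sup>2 + v\<^sup>2" for u v :: real
    using sum_squares_bound[of "\<bar>u\<bar>" "\<bar>v\<bar>"] mult_nonneg_nonneg[of "\<bar>u\<bar>" "\<bar>v\<bar>"] unfolding abs_mult power2_abs by linarith
  then show "AE x in M. norm (U x * V x) \<le> norm ((U x)\<^sup>2 + (V x)\<^sup>2)" by auto
qed simp

lemma square_sum_le:
  fixes u :: "'i \<Rightarrow> real"
  shows "(\<Sum>i\<in>I. u i)\<^sup>2 \<le> real (card I) * (\<Sum>i\<in>I. (u i)\<^sup>2)"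
  using Cauchy_Schwarz_ineq_sum[of "\<lambda>_. 1" u I] by simp

lemma square_add_le: "(x + y)\<^sup>2 \<le> 2 * (x\<^sup>2 + y\<^sup>2)" for x y :: real
  using sum_squares_bound[of x y] by (simp add: power2_sum)

lemma L2_sum:
  fixes U :: "'i \<Rightarrow> 'a \<Rightarrow> real"
  assumes [measurable]: "\<And>i. i \<in> I \<Longrightarrow> U i \<in> borel_measurable M"
    and "\<And>i. i \<in> I \<Longrightarrow> integrable M (\<lambda>x. (U i x)\<^sup>2)"
  shows "integrable M (\<lambda>x. (\<Sum>i\<in>I. U i x)\<^sup>2)"
    and "(\<integral>x. (\<Sum>i\<in>I. U i x)\<^sup>2 \<partial>M) \<le> real (card I) * (\<Sum>i\<in>I. \<integral>x. (U i x)\<^sup>2 \<partial>M)"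
proof -
  have b: "integrable M (\<lambda>x. real (card I) * (\<Sum>i\<in>I. (U i x)\<^sup>2))" using assms by simp
  show i: "integrable M (\<lambda>x. (\<Sum>i\<in>I. U i x)\<^sup>2)"
    by (rule Bochner_Integration.integrable_bound[OF b])
       (use square_sum_le in \<open>auto simp: abs_of_nonneg sum_nonneg\<close>)
  have "(\<integral>x. (\<Sum>i\<in>I. U i x)\<^sup>2 \<partial>M) \<le> (\<integral>x. real (card I) * (\<Sum>i\<in>I. (U i x)\<^sup>2) \<partial>M)"
    by (intro integral_mono i b square_sum_le)
  also have "\<dots> = real (card I) * (\<Sum>i\<in>I. \<integral>x. (U i x)\<^sup>2 \<partial>M)"
    using assms by (subst integral_mult_right_zero, subst Bochner_Integration.integral_sum) auto
  finally show "(\<integral>x. (\<Sum>i\<in>I. U i x)\<^sup>2 \<partial>M) \<le> real (card I) * (\<Sum>i\<in>I. \<integral>x. (U i x)\<^sup>2 \<partial>M)" .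
qed

section \<open>A central limit theorem for functions of finite range\<close>

text \<open>Each index has at most \<open>2 * k\<close> partners with nonzero correlation, and each
  correlation is at most \<open>B\<close> because \<open>u * v\<close> is at most the mean of the
  squares. The gain over \<open>L2_sum\<close> is growth linear, not quadratic, in the number of
  terms.\<close>

lemma quadratic_mean_bound:
  fixes U :: "nat \<Rightarrow> 'a \<Rightarrow> real"
  assumes [measurable]: "\<And>i. i \<in> I \<Longrightarrow> U i \<in> borel_measurable M"
    and sq: "\<And>i. i \<in> I \<Longrightarrow> integrable M (\<lambda>x. (U i x)\<^sup>2)"
    and B: "\<And>i. i \<in> I \<Longrightarrow> (\<integral>x. (U i x)\<^sup>2 \<partial>M) \<le> B"
    and un: "\<And>i j. i \<in> I \<Longrightarrow> j \<in> I \<Longrightarrow> i + k \<le> j \<Longrightarrow> (\<integral>x. U i x * U j x \<partial>M) = 0"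
    and fin: "finite I"
  shows "(\<integral>x. (\<Sum>i\<in>I. U i x)\<^sup>2 \<partial>M) \<le> 2 * real k * B * real (card I)"
proof (cases "I = {}")
  case False
  then obtain i0 where "i0 \<in> I" by blast
  have B0: "0 \<le> B"
    by (rule order_trans[OF _ B[OF \<open>i0 \<in> I\<close>]]) simp
  have prod: "integrable M (\<lambda>x. U i x * U j x)" if "i \<in> I" "j \<in> I" for i j
    using that by (intro integrable_mult_L2 sq) auto
  have le: "(\<integral>x. U i x * U j x \<partial>M) \<le> B" if "i \<in> I" "j \<in> I" for i j
  proof -
    have "(\<integral>x. U i x * U j x \<partial>M) \<le> (\<integral>x. ((U i x)\<^sup>2 + (U j x)\<^sup>2) / 2 \<partial>M)"
    proof (intro integral_mono prod that)
      show "integrable M (\<lambda>x. ((U i x)\<^sup>2 + (U j x)\<^sup>2) / 2)" using sq that by auto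
      show "U i x * U j x \<le> ((U i x)\<^sup>2 + (U j x)\<^sup>2) / 2" for x
        using sum_squares_bound[of "U i x" "U j x"] by simp
    qed
    also have "\<dots> = ((\<integral>x. (U i x)\<^sup>2 \<partial>M) + (\<integral>x. (U j x)\<^sup>2 \<partial>M)) / 2"
      using sq that by simp
    also have "\<dots> \<le> B" using B[OF that(1)] B[OF that(2)] by simp
    finally show ?thesis .
  qed
  have "(\<integral>x. (\<Sum>i\<in>I. U i x)\<^sup>2 \<partial>M) = (\<integral>x. (\<Sum>i\<in>I. \<Sum>j\<in>I. U i x * U j x) \<partial>M)"
    by (simp add: power2_eq_square sum_product)
  also have "\<dots> = (\<Sum>i\<in>I. \<Sum>j\<in>I. \<integral>x. U i x * U j x \<partial>M)"
    using prod by (subst Bochner_Integration.integral_sum; (intro sum.cong refl Bochner_Integration.integral_sum)?) auto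
  \<comment> \<open>The window contains every index at distance less than \<open>k\<close> from
    \<open>i\<close>. Truncated subtraction only cuts off negative indices, so its size stays at
    most \<open>2 * k\<close>.\<close>
  also have "\<dots> \<le> (\<Sum>i\<in>I. \<Sum>j\<in>I. if j \<in> {i + 1 - k..<i + k} then B else 0)"
  proof (intro sum_mono)
    fix i j assume ij: "i \<in> I" "j \<in> I"
    show "(\<integral>x. U i x * U j x \<partial>M) \<le> (if j \<in> {i + 1 - k..<i + k} then B else 0)"
    proof (cases "j \<in> {i + 1 - k..<i + k}")
      case False
      then have "i + k \<le> j \<or> j + k \<le> i" by auto
      then show ?thesis
        using un[OF ij] un[OF ij(2,1)] False by (auto simp: mult.commute)
    qed (use le ij in auto)
  qed
  also have "\<dots> = (\<Sum>i\<in>I. real (card (I \<inter> {i + 1 - k..<i + k})) * B)"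
    unfolding sum.If_cases[OF fin] by (simp only: Collect_mem_eq sum_constant) simp
  also have "\<dots> \<le> (\<Sum>i\<in>I. real (2 * k) * B)"
  proof (intro sum_mono mult_right_mono B0)
    fix i
    have "card (I \<inter> {i + 1 - k..<i + k}) \<le> card {i + 1 - k..<i + k}" by (intro card_mono) auto
    then show "real (card (I \<inter> {i + 1 - k..<i + k})) \<le> real (2 * k)" by simp
  qed
  also have "\<dots> = 2 * real k * B * real (card I)" by simp
  finally show ?thesis .
qed simp

section \<open>Characteristic functions and L2 distance\<close>

lemma char_distr:
  assumes "U \<in> borel_measurable M"
  shows "char (distr M borel U) t = (CLINT x|M. iexp (t * U x))"
  unfolding char_def using assms by (subst integral_distr) auto

lemma char_distr_scale:
  assumes "U \<in> borel_measurable M"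
  shows "char (distr M borel (\<lambda>x. c * U x)) t = char (distr M borel U) (c * t)"
  using assms by (simp add: char_distr mult_ac)

lemma (in prob_space) expectation_abs_le_L2:
  fixes U :: "'a \<Rightarrow> real"
  assumes [measurable]: "U \<in> borel_measurable M" and sq: "integrable M (\<lambda>x. (U x)\<^sup>2)"
  shows "expectation (\<lambda>x. \<bar>U x\<bar>) \<le> sqrt (expectation (\<lambda>x. (U x)\<^sup>2))"
proof (rule real_le_rsqrt)
  have i: "integrable M U" by (rule square_integrable_imp_integrable[OF _ sq]) simp
  have "0 \<le> variance (\<lambda>x. \<bar>U x\<bar>)" by (rule variance_positive)
  also have "\<dots> = expectation (\<lambda>x. \<bar>U x\<bar>\<^sup>2) - (expectation (\<lambda>x. \<bar>U x\<bar>))\<^sup>2"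
    using i sq by (intro variance_eq) auto
  finally show "(expectation (\<lambda>x. \<bar>U x\<bar>))\<^sup>2 \<le> expectation (\<lambda>x. (U x)\<^sup>2)" by simp
qed

text \<open>The map \<open>iexp\<close> has Lipschitz constant 1. Thus an L2 coupling of two
  statistics transfers a limit in law from one to the other.\<close>

lemma (in prob_space) char_diff_le_L2:
  assumes [measurable]: "U \<in> borel_measurable M" "V \<in> borel_measurable M"
    and sq: "integrable M (\<lambda>x. (U x - V x)\<^sup>2)"
  shows "cmod (char (distr M borel U) t - char (distr M borel V) t)
    \<le> \<bar>t\<bar> * sqrt (expectation (\<lambda>x. (U x - V x)\<^sup>2))"
proof -
  have lip: "cmod (iexp a - iexp b) \<le> \<bar>a - b\<bar>" for a b :: real
  proof -
    have "iexp a - iexp b = iexp b * (iexp (a - b) - 1)"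
      by (simp add: algebra_simps flip: exp_add)
    then have "cmod (iexp a - iexp b) = cmod (iexp (a - b) - 1)"
      by (simp add: norm_mult)
    also have "\<dots> \<le> \<bar>a - b\<bar>" using iexp_approx1[of "a - b" 0] by simp
    finally show ?thesis .
  qed
  have iU: "integrable M (\<lambda>x. iexp (t * U x))" and iV: "integrable M (\<lambda>x. iexp (t * V x))"
    by (intro integrable_const_bound[where B = 1]; simp)+
  have iD: "integrable M (\<lambda>x. U x - V x)"
    by (rule square_integrable_imp_integrable[OF _ sq]) simp
  have "cmod (char (distr M borel U) t - char (distr M borel V) t)
      = cmod (CLINT x|M. iexp (t * U x) - iexp (t * V x))"
    using iU iV by (simp add: char_distr)
  also have "\<dots> \<le> (\<integral>x. cmod (iexp (t * U x) - iexp (t * V x)) \<partial>M)"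
    by (rule integral_norm_bound)
  also have "\<dots> \<le> (\<integral>x. \<bar>t\<bar> * \<bar>U x - V x\<bar> \<partial>M)"
  proof (intro integral_mono)
    show "integrable M (\<lambda>x. cmod (iexp (t * U x) - iexp (t * V x)))" using iU iV by simp
    show "integrable M (\<lambda>x. \<bar>t\<bar> * \<bar>U x - V x\<bar>)" using iD by simp
    show "cmod (iexp (t * U x) - iexp (t * V x)) \<le> \<bar>t\<bar> * \<bar>U x - V x\<bar>" for x
      using lip[of "t * U x" "t * V x"] by (simp add: abs_mult flip: right_diff_distrib)
  qed
  also have "\<dots> \<le> \<bar>t\<bar> * sqrt (expectation (\<lambda>x. (U x - V x)\<^sup>2))"
    using expectation_abs_le_L2[OF _ sq] by (simp add: mult_left_mono)
  finally show ?thesis .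
qed

text \<open>An approximation whose error vanishes only when \<open>n\<close> tends to infinity first
  and \<open>p\<close> afterwards; a single large \<open>p\<close> serves each tolerance. In the
  application \<open>p\<close> is a block length and \<open>n\<close> the number of summands. Asking
  for the premises only for large \<open>p\<close> leaves room for blocks too short to have positive
  variance.\<close>

lemma iterated_limit_approx:
  fixes a :: "nat \<Rightarrow> 'b :: real_normed_vector"
  assumes "\<forall>\<^sub>F p in sequentially. b p \<longlonglongrightarrow> \<beta> p"
    and "\<forall>\<^sub>F p in sequentially. e p \<longlonglongrightarrow> (\<delta> p :: real)"
    and "\<forall>\<^sub>F p in sequentially. \<forall>\<^sub>F n in sequentially. norm (a n - b p n) \<le> e p n"
    and "\<beta> \<longlonglongrightarrow> l" "\<delta> \<longlonglongrightarrow> 0"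
  shows "a \<longlonglongrightarrow> l"
proof (rule tendstoI)
  fix \<epsilon> :: real assume "0 < \<epsilon>"
  then have \<epsilon>: "0 < \<epsilon> / 3" by simp
  have "\<forall>\<^sub>F p in sequentially. b p \<longlonglongrightarrow> \<beta> p \<and> e p \<longlonglongrightarrow> \<delta> p \<and>
      (\<forall>\<^sub>F n in sequentially. norm (a n - b p n) \<le> e p n) \<and> dist (\<beta> p) l < \<epsilon> / 3 \<and> \<delta> p < \<epsilon> / 3"
    using assms(1-3) tendstoD[OF assms(4) \<epsilon>] order_tendstoD(2)[OF assms(5) \<epsilon>]
    by eventually_elim simp
  then obtain p where p: "b p \<longlonglongrightarrow> \<beta> p" "e p \<longlonglongrightarrow> \<delta> p"
      "\<forall>\<^sub>F n in sequentially. norm (a n - b p n) \<le> e p n" "dist (\<beta> p) l < \<epsilon> / 3" "\<delta> p < \<epsilon> / 3"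
    using eventually_happens[of _ sequentially] by auto
  show "\<forall>\<^sub>F n in sequentially. dist (a n) l < \<epsilon>"
    using p(3) tendstoD[OF p(1) \<epsilon>] order_tendstoD(2)[OF p(2) p(5)]
  proof eventually_elim
    case (elim n)
    have "dist (a n) l \<le> dist (a n) (b p n) + (dist (b p n) (\<beta> p) + dist (\<beta> p) l)"
      using dist_triangle[of "a n" l "b p n"] dist_triangle[of "b p n" l "\<beta> p"] by linarith
    then show ?case using elim p(4) by (simp add: dist_norm)
  qed
qed

abbreviation coord_block :: "nat \<Rightarrow> nat \<Rightarrow> (nat \<Rightarrow> real) \<Rightarrow> nat \<Rightarrow> real" where
  "coord_block k \<equiv> block k (\<lambda>t \<omega>. \<omega> t)"

interpretation null: prob_space null_law
  unfolding null_law_def by (rule prob_space_iid_normal)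

lemma measurable_coord_null_law [measurable]: "(\<lambda>\<omega>. \<omega> t) \<in> borel_measurable null_law"
  unfolding null_law_def by (rule measurable_coord)

lemma measurable_block [measurable]:
  assumes "\<And>t. X t \<in> borel_measurable M"
  shows "block k X i \<in> measurable M (std_normal_power k)"
  unfolding block_def[abs_def] std_normal_power_def using assms by measurable

lemma distr_coord_block:
  assumes "1 \<le> i"
  shows "distr null_law (std_normal_power k) (coord_block k i) = std_normal_power k"
  unfolding null_law_def std_normal_power_def block_def[abs_def]
  using assms by (intro distr_iid_normal_reindex) (auto simp: inj_on_def)

text \<open>Components are numbered from 1, so position \<open>i\<close> of a window starting at
  \<open>s\<close> is time \<open>s + i - 1\<close>. This writes several short blocks as functions
  of one longer window, whose law does not depend on where it starts.\<close>

lemma coord_block_coord_block: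
  assumes "i + k \<le> l + 1" "1 \<le> i"
  shows "coord_block k i (coord_block l s \<omega>) = coord_block k (s + i - 1) \<omega>"
  using assms by (auto simp: block_def fun_eq_iff intro!: arg_cong[of _ _ \<omega>])

lemma coord_block_restrict:
  assumes "{i..<i + k} \<subseteq> A"
  shows "coord_block k i (restrict \<omega> A) = coord_block k i \<omega>"
proof -
  have "i + j - 1 \<in> A" if "j \<in> {1..k}" for j using that by (intro subsetD[OF assms]) auto
  then show ?thesis by (auto simp: block_def fun_eq_iff)
qed

section \<open>Partial sums of a function of \<open>k\<close> consecutive coordinates\<close>

context
  fixes k :: nat and h :: "(nat \<Rightarrow> real) \<Rightarrow> real" and D :: "nat \<Rightarrow> (nat \<Rightarrow> real) \<Rightarrow> real"
  assumes h: "h \<in> mean_zero_L2 k"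
  defines "D \<equiv> \<lambda>i \<omega>. h (coord_block k i \<omega>)"
begin

private lemma h_measurable [measurable]: "h \<in> borel_measurable (std_normal_power k)"
  using h by (simp add: mean_zero_L2_def)

private lemma D_measurable [measurable]: "D i \<in> borel_measurable (iid_normal A)" "D i \<in> borel_measurable null_law"
  unfolding D_def by measurable

private lemma D_mean: "1 \<le> i \<Longrightarrow> (\<integral>\<omega>. D i \<omega> \<partial>null_law) = 0"
  using h integral_distr[of "coord_block k i" null_law "std_normal_power k" h]
  by (simp add: distr_coord_block D_def mean_zero_L2_def)

lemma block_L2: "1 \<le> i \<Longrightarrow> integrable null_law (\<lambda>\<omega>. (D i \<omega>)\<^sup>2)"
    "1 \<le> i \<Longrightarrow> (\<integral>\<omega>. (D i \<omega>)\<^sup>2 \<partial>null_law) = (\<integral>x. (h x)\<^sup>2 \<partial>std_normal_power k)"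
  using h integral_distr[of "coord_block k i" null_law "std_normal_power k" "\<lambda>x. (h x)\<^sup>2"]
    integrable_distr_eq[of "coord_block k i" null_law "std_normal_power k" "\<lambda>x. (h x)\<^sup>2"]
  by (simp_all add: distr_coord_block D_def mean_zero_L2_def)

private lemma D_integrable: "1 \<le> i \<Longrightarrow> integrable null_law (D i)"
  by (rule null.square_integrable_imp_integrable[OF _ block_L2(1)]) simp_all

text \<open>Both factors are read off one window of length \<open>k + r\<close>, and all such
  windows have the same law.\<close>

private lemma D_stationary:
  assumes "1 \<le> i"
  shows "(\<integral>\<omega>. D i \<omega> * D (i + r) \<omega> \<partial>null_law) = (\<integral>\<omega>. D 1 \<omega> * D (1 + r) \<omega> \<partial>null_law)"
proof -
  have eq: "(\<integral>\<omega>. D i \<omega> * D (i + r) \<omega> \<partial>null_law)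
      = (\<integral>y. h (coord_block k 1 y) * h (coord_block k (1 + r) y) \<partial>std_normal_power (k + r))"
    if "1 \<le> i" for i
  proof -
    have [measurable]: "coord_block k j \<in> measurable (std_normal_power (k + r)) (std_normal_power k)" for j
      unfolding std_normal_power_def[of "k + r"] by measurable
    show ?thesis
      using integral_distr[of "coord_block (k + r) i" null_law "std_normal_power (k + r)"
        "\<lambda>y. h (coord_block k 1 y) * h (coord_block k (1 + r) y)"] that
      by (simp add: distr_coord_block D_def coord_block_coord_block)
  qed
  show ?thesis using eq[of i] eq[of 1] assms by simp
qed

private lemma D_uncorrelated:
  assumes "1 \<le> i" "i + k \<le> j"
  shows "(\<integral>\<omega>. D i \<omega> * D j \<omega> \<partial>null_law) = 0"
proof -
  have "(\<integral>\<omega>. D i \<omega> * D j \<omega> \<partial>null_law) = (\<integral>\<omega>. D i \<omega> \<partial>null_law) * (\<integral>\<omega>. D j \<omega> \<partial>null_law)"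
    using assms D_integrable[of i] D_integrable[of j] unfolding null_law_def
    by (intro expectation_mult_disjoint_coords[of "{i..<i + k}" "{j..<j + k}"])
       (auto simp: D_def coord_block_restrict)
  then show ?thesis using assms by (simp add: D_mean)
qed

lemma null_sd_eq:
  "null_sd k h = sqrt ((\<integral>\<omega>. D 1 \<omega> * D 1 \<omega> \<partial>null_law) + 2 * (\<Sum>r=1..k-1. \<integral>\<omega>. D 1 \<omega> * D (1 + r) \<omega> \<partial>null_law))"
  using D_mean unfolding null_sd_def covariance_def Let_def by (simp add: D_def power2_eq_square)

private lemma sum_D_L2:
  assumes "finite I" "1 \<le> q"
  shows "integrable null_law (\<lambda>\<omega>. (\<Sum>i\<in>I. D (q + i) \<omega>)\<^sup>2)"
    and "(\<integral>\<omega>. (\<Sum>i\<in>I. D (q + i) \<omega>)\<^sup>2 \<partial>null_law)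
      \<le> 2 * real k * (\<integral>x. (h x)\<^sup>2 \<partial>std_normal_power k) * real (card I)"
proof -
  show "integrable null_law (\<lambda>\<omega>. (\<Sum>i\<in>I. D (q + i) \<omega>)\<^sup>2)"
    using assms by (intro L2_sum(1)) (auto intro: block_L2)
  show "(\<integral>\<omega>. (\<Sum>i\<in>I. D (q + i) \<omega>)\<^sup>2 \<partial>null_law)
      \<le> 2 * real k * (\<integral>x. (h x)\<^sup>2 \<partial>std_normal_power k) * real (card I)"
    using assms by (intro quadratic_mean_bound) (auto simp: block_L2 intro: D_uncorrelated)
qed

text \<open>With at least \<open>k - 1\<close> predecessors, the new summand meets every lag
  \<open>1, ..., k - 1\<close> exactly once, while longer lags contribute nothing; the variance
  therefore grows by exactly the radicand in \<open>null_sd\<close>. Positivity of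
  \<open>null_sd\<close> makes that radicand the square of \<open>null_sd\<close>.\<close>

private lemma variance_recursion:
  assumes "k \<le> p + 1" "1 \<le> q" "0 < null_sd k h"
  shows "(\<integral>\<omega>. (\<Sum>i<Suc p. D (q + i) \<omega>)\<^sup>2 \<partial>null_law) = (\<integral>\<omega>. (\<Sum>i<p. D (q + i) \<omega>)\<^sup>2 \<partial>null_law) + (null_sd k h)\<^sup>2"
proof -
  define \<gamma> where "\<gamma> r = (\<integral>\<omega>. D 1 \<omega> * D (1 + r) \<omega> \<partial>null_law)" for r
  have int: "integrable null_law (\<lambda>\<omega>. D (q + i) \<omega> * D (q + j) \<omega>)" for i j
    using assms by (intro integrable_mult_L2 block_L2) auto
  have cov: "(\<integral>\<omega>. D (q + i) \<omega> * D (q + p) \<omega> \<partial>null_law) = \<gamma> (p - i)" if "i \<le> p" for i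
    using D_stationary[of "q + i" "p - i"] that assms(2) by (simp add: \<gamma>_def add.assoc)
  have square_add: "(x + y)\<^sup>2 = x\<^sup>2 + (2 * (x * y) + y * y)" for x y :: real
    by (simp only: power2_sum) (simp add: power2_eq_square)
  have "(\<integral>\<omega>. (\<Sum>i<Suc p. D (q + i) \<omega>)\<^sup>2 \<partial>null_law) =
      (\<integral>\<omega>. (\<Sum>i<p. D (q + i) \<omega>)\<^sup>2 + (2 * (\<Sum>i<p. D (q + i) \<omega> * D (q + p) \<omega>) + D (q + p) \<omega> * D (q + p) \<omega>) \<partial>null_law)"
    by (simp only: sum.lessThan_Suc square_add sum_distrib_right)
  also have "\<dots> = (\<integral>\<omega>. (\<Sum>i<p. D (q + i) \<omega>)\<^sup>2 \<partial>null_law) + (2 * (\<Sum>i<p. \<gamma> (p - i)) + \<gamma> 0)"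
    using int sum_D_L2(1)[of "{..<p}" q] assms(2) cov[of p] by (simp add: cov)
  also have "(\<Sum>i<p. \<gamma> (p - i)) = (\<Sum>r=1..p. \<gamma> r)"
    by (rule sum.reindex_bij_witness[of _ "\<lambda>r. p - r" "\<lambda>i. p - i"]) auto
  also have "\<dots> = (\<Sum>r=1..k-1. \<gamma> r)"
    using assms(1) by (intro sum.mono_neutral_right) (auto simp: \<gamma>_def intro!: D_uncorrelated)
  finally have "(\<integral>\<omega>. (\<Sum>i<Suc p. D (q + i) \<omega>)\<^sup>2 \<partial>null_law)
    = (\<integral>\<omega>. (\<Sum>i<p. D (q + i) \<omega>)\<^sup>2 \<partial>null_law) + (\<gamma> 0 + 2 * (\<Sum>r=1..k-1. \<gamma> r))" by simp
  moreover have "(null_sd k h)\<^sup>2 = \<gamma> 0 + 2 * (\<Sum>r=1..k-1. \<gamma> r)"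
    using assms(3) unfolding null_sd_eq \<gamma>_def by (simp add: real_sqrt_gt_0_iff)
  ultimately show ?thesis by simp
qed

text \<open>From \<open>p = k\<close> on the variance is affine in \<open>p\<close> with slope the
  squared \<open>null_sd\<close>. The denominator is \<open>p + k\<close> because a block of length
  \<open>p\<close> occupies that much time together with its gap.\<close>

private lemma variance_rate:
  assumes "1 \<le> q" "0 < null_sd k h"
  shows "(\<lambda>p. (\<integral>\<omega>. (\<Sum>i<p. D (q + i) \<omega>)\<^sup>2 \<partial>null_law) / real (p + k)) \<longlonglongrightarrow> (null_sd k h)\<^sup>2"
proof (rule LIMSEQ_offset[of _ k])
  define v where "v p = (\<integral>\<omega>. (\<Sum>i<p. D (q + i) \<omega>)\<^sup>2 \<partial>null_law)" for p
  have v: "v (n + k) = v k + real n * (null_sd k h)\<^sup>2" for n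
    by (induction n) (use variance_recursion[OF _ assms] in \<open>simp_all add: v_def algebra_simps del: sum.lessThan_Suc\<close>)
  have "(\<lambda>n. (v k / real n + (null_sd k h)\<^sup>2) / (1 + 2 * real k / real n)) \<longlonglongrightarrow> (0 + (null_sd k h)\<^sup>2) / (1 + 0)"
    by (intro tendsto_intros lim_const_over_n) simp
  moreover have "\<forall>\<^sub>F n in sequentially. (v k / real n + (null_sd k h)\<^sup>2) / (1 + 2 * real k / real n)
      = (v k + real n * (null_sd k h)\<^sup>2) / (real n + 2 * real k)"
    using eventually_gt_at_top[of 0]
  proof eventually_elim
    case (elim n)
    then have "v k / real n + (null_sd k h)\<^sup>2 = (v k + real n * (null_sd k h)\<^sup>2) / real n"
      "1 + 2 * real k / real n = (real n + 2 * real k) / real n"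
      by (simp_all add: add_divide_distrib)
    then show ?case using elim by simp
  qed
  ultimately have "(\<lambda>n. (v k + real n * (null_sd k h)\<^sup>2) / (real n + 2 * real k)) \<longlonglongrightarrow> (null_sd k h)\<^sup>2"
    using Lim_transform_eventually by fastforce
  then show "(\<lambda>n. (\<integral>\<omega>. (\<Sum>i<n + k. D (q + i) \<omega>)\<^sup>2 \<partial>null_law) / real (n + k + k)) \<longlonglongrightarrow> (null_sd k h)\<^sup>2"
    unfolding v_def[symmetric] v by (simp add: add.assoc)
qed

text \<open>Blocks of length \<open>p\<close> separated by gaps of length \<open>k\<close> depend on disjoint sets of coordinates.\<close>

private lemma char_separated_blocks:
  assumes q: "1 \<le> q" and v: "v = (\<integral>\<omega>. (\<Sum>i<p. D (q + i) \<omega>)\<^sup>2 \<partial>null_law)" "0 < v"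
  shows "(\<lambda>m. char (distr null_law borel
      (\<lambda>\<omega>. (\<Sum>j<m. \<Sum>i<p. D (q + (j * (p + k) + i)) \<omega>) / sqrt (real m * v))) t)
    \<longlonglongrightarrow> exp (- (t\<^sup>2) / 2)"
proof -
  define L where "L = p + k"
  define U where "U j \<omega> = (\<Sum>i<p. D (q + (j * L + i)) \<omega>)" for j \<omega>
  have [measurable]: "U j \<in> borel_measurable null_law" "U j \<in> borel_measurable (iid_normal A)" for j A
    unfolding U_def by measurable
  \<comment> \<open>A block sum as a function of one window of length \<open>L\<close>: this shows
    that all block sums have the same law.\<close>
  define H where "H y = (\<Sum>i<p. h (coord_block k (i + 1) y))" for y
  have Hm [measurable]: "H \<in> borel_measurable (std_normal_power L)"
    unfolding H_def std_normal_power_def[of L] by measurable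
  have UH: "U j \<omega> = H (coord_block L (q + j * L) \<omega>)" for j \<omega>
    unfolding U_def H_def D_def
    by (intro sum.cong refl) (simp add: coord_block_coord_block L_def add.assoc)
  have dU: "distr null_law borel (U j) = distr (std_normal_power L) borel H" for j
  proof -
    have "distr (std_normal_power L) borel H
        = distr (distr null_law (std_normal_power L) (coord_block L (q + j * L))) borel H"
      using q by (simp add: distr_coord_block)
    also have "\<dots> = distr null_law borel (U j)"
      by (subst distr_distr) (auto simp: UH[abs_def] comp_def)
    finally show ?thesis by simp
  qed
  have EU: "(\<integral>\<omega>. f (U j \<omega>) \<partial>null_law) = (\<integral>\<omega>. f (U 0 \<omega>) \<partial>null_law)"
    if [measurable]: "f \<in> borel_measurable borel" for f :: "real \<Rightarrow> real" and j
    using arg_cong[OF dU[of j], of "\<lambda>M. integral\<^sup>L M f"] arg_cong[OF dU[of 0], of "\<lambda>M. integral\<^sup>L M f"]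
    by (simp add: integral_distr)
  have mean: "null.expectation (U j) = 0" for j
    using q unfolding U_def by (subst Bochner_Integration.integral_sum) (auto simp: D_mean D_integrable)
  have sq: "integrable null_law (\<lambda>\<omega>. (U j \<omega>)\<^sup>2)" for j
    using sum_D_L2(1)[of "{..<p}" "q + j * L"] q by (simp add: U_def add.assoc)
  have ind: "null.indep_vars (\<lambda>_. borel) U UNIV"
  proof -
    \<comment> \<open>The \<open>p\<close> windows of block \<open>j\<close> reach at most
      \<open>k - 1\<close> coordinates beyond their last starting point, so they stay inside this
      stretch of length \<open>p + k\<close>.\<close>
    define K where "K j = {q + j * L..<q + (j + 1) * L}" for j
    have disj: "disjoint_family_on K UNIV"
    proof (unfold disjoint_family_on_def, intro ballI impI)
      have "K m \<inter> K n = {}" if "m < n" for m n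
      proof -
        have "(m + 1) * L \<le> n * L" using that by (intro mult_right_mono) auto
        then show ?thesis by (auto simp: K_def)
      qed
      then show "K m \<inter> K n = {}" if "m \<noteq> n" for m n
        using that by (cases m n rule: linorder_cases) blast+
    qed
    have "null.indep_vars (\<lambda>_. borel) (\<lambda>t \<omega>. \<omega> t) {1..}"
      unfolding null_law_def by (rule indep_coords)
    then have "null.indep_vars (\<lambda>j. PiM (K j) (\<lambda>_. borel)) (\<lambda>j \<omega>. restrict \<omega> (K j)) UNIV"
      by (rule null.indep_vars_restrict[OF _ _ disj]) (use q in \<open>auto simp: K_def\<close>)
    moreover have "U j \<in> borel_measurable (PiM (K j) (\<lambda>_. borel))" for j
    proof -
      have "sets (PiM (K j) (\<lambda>_. borel)) = sets (iid_normal (K j))" by (intro sets_PiM_cong) auto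
      then show ?thesis by (simp cong: measurable_cong_sets)
    qed
    ultimately have "null.indep_vars (\<lambda>_. borel) (\<lambda>j \<omega>. U j (restrict \<omega> (K j))) UNIV"
      by (rule null.indep_vars_compose2)
    moreover have "U j (restrict \<omega> (K j)) = U j \<omega>" for j \<omega>
      unfolding U_def D_def
      by (intro sum.cong refl arg_cong[of _ _ h] coord_block_restrict) (auto simp: K_def L_def)
    ultimately show ?thesis by simp
  qed
  have var: "null.variance (U j) = (sqrt v)\<^sup>2" for j
    using v EU[of "\<lambda>x. x\<^sup>2" j] by (simp add: mean) (simp add: U_def)
  have "weak_conv_m (\<lambda>m. distr null_law borel (\<lambda>\<omega>. (\<Sum>j<m. U j \<omega>) / sqrt (real m * (sqrt v)\<^sup>2))) std_normal_distribution"
    by (rule null.central_limit_theorem_zero_mean[OF ind mean _ sq var dU]) (use v in simp)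
  then have "(\<lambda>m. char (distr null_law borel (\<lambda>\<omega>. (\<Sum>j<m. U j \<omega>) / sqrt (real m * (sqrt v)\<^sup>2))) t)
      \<longlonglongrightarrow> char std_normal_distribution t"
    by (intro levy_continuity1 real_dist_normal_dist) (auto intro!: null.real_distribution_distr)
  then show ?thesis using v by (simp add: U_def L_def char_std_normal_distribution)
qed

text \<open>For fixed \<open>p\<close> the blocks leave out a fraction of about
  \<open>k / (p + k)\<close> of the indices. Since the variance of a partial sum is at most
  proportional to the number of its terms, the omitted part is small in L2 after normalization,
  uniformly in large \<open>N\<close>, and disappears as \<open>p\<close> grows; meanwhile the
  variance rate of the blocks tends to the squared \<open>null_sd\<close>.\<close>

lemma char_finite_range_clt:
  assumes q: "1 \<le> q" and sd: "0 < null_sd k h"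
  shows "(\<lambda>N. char (distr null_law borel (\<lambda>\<omega>. (\<Sum>i<N. D (q + i) \<omega>) / sqrt (real N))) t)
    \<longlonglongrightarrow> exp (- (t\<^sup>2 * (null_sd k h)\<^sup>2) / 2)"
proof -
  define B where "B = 2 * real k * (\<integral>x. (h x)\<^sup>2 \<partial>std_normal_power k)"
  define v where "v p = (\<integral>\<omega>. (\<Sum>i<p. D (q + i) \<omega>)\<^sup>2 \<partial>null_law)" for p
  define S where "S I \<omega> = (\<Sum>i\<in>I. D (q + i) \<omega>)" for I \<omega>
  define J where "J p m = (\<lambda>(j, i). j * (p + k) + i) ` ({..<m} \<times> {..<p})" for p m
  define a where "a N = char (distr null_law borel (\<lambda>\<omega>. S {..<N} \<omega> / sqrt (real N))) t" for N
  define b where "b p N = char (distr null_law borel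
      (\<lambda>\<omega>. S (J p (N div (p + k))) \<omega> / sqrt (real (N div (p + k) * (p + k))))) t" for p N
  \<comment> \<open>First summand: the omitted indices, at most \<open>B\<close> times their number.
    Second summand: the block part, renormalized from \<open>sqrt (m * (p + k))\<close> to
    \<open>sqrt N\<close>. The factor 2 comes from \<open>square_add_le\<close>.\<close>
  define e where "e p N = (let m = real (N div (p + k)) in \<bar>t\<bar> * sqrt (2 * (B * (real N - m * p) / N
      + B * m * p * (1 / sqrt N - 1 / sqrt (m * real (p + k)))\<^sup>2)))" for p N
  have [measurable]: "S I \<in> borel_measurable null_law" for I unfolding S_def by measurable
  have L2: "integrable null_law (\<lambda>\<omega>. (S I \<omega>)\<^sup>2)" "(\<integral>\<omega>. (S I \<omega>)\<^sup>2 \<partial>null_law) \<le> B * real (card I)" if "finite I" for I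
    using sum_D_L2[OF that q] by (simp_all add: S_def B_def)
  have injJ: "inj_on (\<lambda>(j, i). j * (p + k) + i) ({..<m} \<times> {..<p})" for p m
  proof (rule inj_on_inverseI)
    fix x assume "x \<in> {..<m} \<times> {..<p}"
    then show "(\<lambda>n. (n div (p + k), n mod (p + k))) ((\<lambda>(j, i). j * (p + k) + i) x) = x" by auto
  qed
  have J: "finite (J p m)" "card (J p m) = m * p" for p m
    using card_image[OF injJ[of p m]] by (auto simp: J_def card_cartesian_product)
  have SJ: "S (J p m) \<omega> = (\<Sum>j<m. \<Sum>i<p. D (q + (j * (p + k) + i)) \<omega>)" for p m \<omega>
    unfolding S_def J_def by (subst sum.reindex[OF injJ]) (simp add: sum.cartesian_product case_prod_unfold)
  have filt: "filterlim (\<lambda>N. N div L) sequentially sequentially" if "0 < L" for L :: nat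
    unfolding filterlim_at_top
  proof
    fix z
    show "\<forall>\<^sub>F N in sequentially. z \<le> N div L"
      using eventually_ge_at_top[of "z * L"]
      by eventually_elim (use that in \<open>simp add: less_eq_div_iff_mult_less_eq\<close>)
  qed
  have rate: "(\<lambda>N. real (N div L) / real N) \<longlonglongrightarrow> 1 / real L" if "0 < L" for L :: nat
  proof (rule tendsto_sandwich)
    show "\<forall>\<^sub>F N in sequentially. 1 / real L - 1 / real N \<le> real (N div L) / real N"
      using eventually_gt_at_top[of 0]
    proof eventually_elim
      case (elim N)
      have "N < (N div L + 1) * L" using that by (simp add: dividend_less_div_times)
      then have "real N \<le> (real (N div L) + 1) * real L"
        by (metis less_imp_le of_nat_1 of_nat_add of_nat_le_iff of_nat_mult)
      then have "(real N - real L) / (real L * real N) \<le> (real (N div L) * real L) / (real L * real N)"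
        by (intro divide_right_mono) (simp_all add: algebra_simps)
      then show ?case using elim that by (simp add: diff_divide_distrib)
    qed
    show "\<forall>\<^sub>F N in sequentially. real (N div L) / real N \<le> 1 / real L"
      using eventually_gt_at_top[of 0]
    proof eventually_elim
      case (elim N)
      have "real (N div L) * real L \<le> real N"
        by (metis of_nat_le_iff of_nat_mult div_times_less_eq_dividend)
      then show ?case using elim that by (simp add: field_simps)
    qed
    show "(\<lambda>N. 1 / real L - 1 / real N) \<longlonglongrightarrow> 1 / real L" by real_asymp
  qed simp
  have b_lim: "b p \<longlonglongrightarrow> exp (- ((t\<^sup>2 * (v p / real (p + k))) / 2))" if vp: "0 < v p" and L: "0 < p + k" for p
  proof -
    define c where "c = sqrt (v p / real (p + k))"
    have "b p = (\<lambda>N. char (distr null_law borel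
        (\<lambda>\<omega>. S (J p (N div (p + k))) \<omega> / sqrt (real (N div (p + k)) * v p))) (c * t))"
    proof
      fix N
      \<comment> \<open>This includes \<open>m = 0\<close>, where both sides are 0 by the convention
        for division by zero.\<close>
      have scale: "x / sqrt (real (m * L)) = sqrt (w / real L) * (x / sqrt (real m * w))"
        if "0 < w" "0 < L" for x w :: real and m L :: nat
        using that by (simp add: real_sqrt_mult real_sqrt_divide)
      have "S I \<omega> / sqrt (real (N div (p + k) * (p + k)))
          = c * (S I \<omega> / sqrt (real (N div (p + k)) * v p))" for I \<omega>
        unfolding c_def by (rule scale[OF vp L])
      then show "b p N = char (distr null_law borel
        (\<lambda>\<omega>. S (J p (N div (p + k))) \<omega> / sqrt (real (N div (p + k)) * v p))) (c * t)"
        unfolding b_def by (simp only:) (rule char_distr_scale, measurable)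
    qed
    moreover have "(\<lambda>N. char (distr null_law borel
        (\<lambda>\<omega>. S (J p (N div (p + k))) \<omega> / sqrt (real (N div (p + k)) * v p))) (c * t)) \<longlonglongrightarrow> exp (- ((c * t)\<^sup>2) / 2)"
      unfolding SJ using filterlim_compose[OF char_separated_blocks[OF q v_def vp] filt[OF L]] .
    moreover have "(c * t)\<^sup>2 = t\<^sup>2 * (v p / real (p + k))"
      using vp by (simp add: c_def power_mult_distrib)
    ultimately show ?thesis by simp
  qed
  have e_lim: "e p \<longlonglongrightarrow> \<bar>t\<bar> * sqrt (2 * (B * (k / real (p + k))))" if L: "0 < p + k" for p
  proof -
    let ?m = "\<lambda>N. real (N div (p + k))"
    note r = rate[OF L]
    have "(\<lambda>N. B * (1 - ?m N / N * p) + B * p * (sqrt (?m N / N) - 1 / sqrt (real (p + k)))\<^sup>2)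
        \<longlonglongrightarrow> B * (1 - 1 / real (p + k) * p) + B * p * (sqrt (1 / real (p + k)) - 1 / sqrt (real (p + k)))\<^sup>2"
      by (intro tendsto_intros r)
    also have "1 - 1 / real (p + k) * p = k / real (p + k)"
    proof -
      have "real p + real k \<noteq> 0" using L by linarith
      then show ?thesis by (simp add: diff_eq_eq add.commute flip: add_divide_distrib)
    qed
    also have "B * (k / real (p + k)) + B * p * (sqrt (1 / real (p + k)) - 1 / sqrt (real (p + k)))\<^sup>2
        = B * (k / real (p + k))"
      by (simp add: real_sqrt_divide)
    finally have lim: "(\<lambda>N. \<bar>t\<bar> * sqrt (2 * (B * (1 - ?m N / N * p) + B * p * (sqrt (?m N / N) - 1 / sqrt (real (p + k)))\<^sup>2)))
        \<longlonglongrightarrow> \<bar>t\<bar> * sqrt (2 * (B * (k / real (p + k))))"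
      by (intro tendsto_intros)
    have "\<forall>\<^sub>F N in sequentially. \<bar>t\<bar> * sqrt (2 * (B * (1 - ?m N / N * p) + B * p * (sqrt (?m N / N) - 1 / sqrt (real (p + k)))\<^sup>2)) = e p N"
      using eventually_gt_at_top[of 0] eventually_ge_at_top[of "p + k"]
    proof eventually_elim
      case (elim N)
      have m: "0 < ?m N" using elim L by (simp add: div_greater_zero_iff)
      have "?m N * (1 / sqrt N - 1 / sqrt (?m N * real (p + k)))\<^sup>2
          = (sqrt (?m N) * (1 / sqrt N - 1 / sqrt (?m N * real (p + k))))\<^sup>2"
        using m by (simp add: power_mult_distrib)
      also have "sqrt (?m N) * (1 / sqrt N - 1 / sqrt (?m N * real (p + k))) = sqrt (?m N / N) - 1 / sqrt (real (p + k))"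
        using m L by (simp add: real_sqrt_mult real_sqrt_divide right_diff_distrib)
      finally have 1: "?m N * (1 / sqrt N - 1 / sqrt (?m N * real (p + k)))\<^sup>2
          = (sqrt (?m N / N) - 1 / sqrt (real (p + k)))\<^sup>2" .
      have 2: "B * ?m N * p * (1 / sqrt N - 1 / sqrt (?m N * real (p + k)))\<^sup>2
          = B * p * (sqrt (?m N / N) - 1 / sqrt (real (p + k)))\<^sup>2" by (simp only: mult_ac flip: 1)
      have 3: "B * (real N - ?m N * p) / N = B * (1 - ?m N / N * p)"
        using elim by (simp add: field_simps)
      show ?case unfolding e_def Let_def by (simp only: 2 3)
    qed
    then show ?thesis by (rule Lim_transform_eventually[OF lim])
  qed
  have ab: "norm (a N - b p N) \<le> e p N" if L: "0 < p + k" for p N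
  proof -
    define m where "m = N div (p + k)"
    define c where "c = 1 / sqrt N - 1 / sqrt (m * real (p + k))"
    have mN: "m * (p + k) \<le> N" by (simp add: m_def)
    have JN: "J p m \<subseteq> {..<N}"
    proof
      fix n assume "n \<in> J p m"
      then obtain j i where ji: "j < m" "i < p" "n = j * (p + k) + i" by (auto simp: J_def)
      have "(j + 1) * (p + k) \<le> m * (p + k)" using ji by (intro mult_right_mono) auto
      then show "n \<in> {..<N}" using ji mN by simp
    qed
    have split: "S {..<N} \<omega> = S ({..<N} - J p m) \<omega> + S (J p m) \<omega>" for \<omega>
      unfolding S_def using JN by (intro sum.subset_diff) auto
    have "S {..<N} \<omega> / sqrt (real N) - S (J p m) \<omega> / sqrt (real (m * (p + k)))
        = 1 / sqrt (real N) * S ({..<N} - J p m) \<omega> + c * S (J p m) \<omega>" for \<omega>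
      unfolding split c_def by (simp add: algebra_simps add_divide_distrib)
    then have W: "(S {..<N} \<omega> / sqrt (real N) - S (J p m) \<omega> / sqrt (real (m * (p + k))))\<^sup>2
        \<le> 2 * (1 / real N * (S ({..<N} - J p m) \<omega>)\<^sup>2 + c\<^sup>2 * (S (J p m) \<omega>)\<^sup>2)" for \<omega>
      using square_add_le[of "1 / sqrt (real N) * S ({..<N} - J p m) \<omega>" "c * S (J p m) \<omega>"]
      by (simp add: power_mult_distrib power_divide)
    have Wi: "integrable null_law (\<lambda>\<omega>. 2 * (1 / real N * (S ({..<N} - J p m) \<omega>)\<^sup>2 + c\<^sup>2 * (S (J p m) \<omega>)\<^sup>2))"
      using J by (intro Bochner_Integration.integrable_add integrable_mult_right L2) auto
    have Wsq: "integrable null_law (\<lambda>\<omega>. (S {..<N} \<omega> / sqrt (real N) - S (J p m) \<omega> / sqrt (real (m * (p + k))))\<^sup>2)"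
      by (rule Bochner_Integration.integrable_bound[OF Wi]) (use W in \<open>auto simp: abs_of_nonneg\<close>)
    have "norm (a N - b p N) \<le> \<bar>t\<bar> * sqrt (\<integral>\<omega>. (S {..<N} \<omega> / sqrt (real N) - S (J p m) \<omega> / sqrt (real (m * (p + k))))\<^sup>2 \<partial>null_law)"
      unfolding a_def b_def m_def[symmetric] by (intro null.char_diff_le_L2 Wsq) measurable
    also have "\<dots> \<le> \<bar>t\<bar> * sqrt (2 * (1 / real N * (B * (real N - real m * p)) + c\<^sup>2 * (B * (real m * p))))"
    proof (intro mult_left_mono real_sqrt_le_mono)
      have "(\<integral>\<omega>. (S {..<N} \<omega> / sqrt (real N) - S (J p m) \<omega> / sqrt (real (m * (p + k))))\<^sup>2 \<partial>null_law)
          \<le> (\<integral>\<omega>. 2 * (1 / real N * (S ({..<N} - J p m) \<omega>)\<^sup>2 + c\<^sup>2 * (S (J p m) \<omega>)\<^sup>2) \<partial>null_law)"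
        by (intro integral_mono Wsq Wi W)
      also have "\<dots> = 2 * (1 / real N * (\<integral>\<omega>. (S ({..<N} - J p m) \<omega>)\<^sup>2 \<partial>null_law) + c\<^sup>2 * (\<integral>\<omega>. (S (J p m) \<omega>)\<^sup>2 \<partial>null_law))"
        using L2(1)[of "{..<N} - J p m"] L2(1)[of "J p m"] J by simp
      also have "\<dots> \<le> 2 * (1 / real N * (B * real (card ({..<N} - J p m))) + c\<^sup>2 * (B * real (card (J p m))))"
        using J by (intro mult_left_mono add_mono L2) auto
      also have "real (card ({..<N} - J p m)) = real N - real m * p"
        using J JN card_mono[OF _ JN] by (simp add: card_Diff_subset of_nat_diff)
      finally show "(\<integral>\<omega>. (S {..<N} \<omega> / sqrt (real N) - S (J p m) \<omega> / sqrt (real (m * (p + k))))\<^sup>2 \<partial>null_law)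
          \<le> 2 * (1 / real N * (B * (real N - real m * p)) + c\<^sup>2 * (B * (real m * p)))"
        using J by simp
    qed auto
    also have "\<dots> = e p N" by (simp add: e_def c_def m_def Let_def mult_ac)
    finally show ?thesis .
  qed
  have v_lim: "(\<lambda>p. v p / real (p + k)) \<longlonglongrightarrow> (null_sd k h)\<^sup>2"
    unfolding v_def by (rule variance_rate[OF q sd])
  have "\<forall>\<^sub>F p in sequentially. 0 < v p / real (p + k)"
    using v_lim sd by (intro order_tendstoD(1)[OF v_lim]) simp
  then have pos: "\<forall>\<^sub>F p in sequentially. 0 < v p \<and> 0 < p + k"
    by eventually_elim (auto simp: zero_less_divide_iff)
  have "a \<longlonglongrightarrow> exp (- ((t\<^sup>2 * (null_sd k h)\<^sup>2) / 2))"
  proof (rule iterated_limit_approx)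
    show "\<forall>\<^sub>F p in sequentially. b p \<longlonglongrightarrow> exp (- ((t\<^sup>2 * (v p / real (p + k))) / 2))"
      using pos by eventually_elim (elim conjE, rule b_lim)
    show "\<forall>\<^sub>F p in sequentially. e p \<longlonglongrightarrow> \<bar>t\<bar> * sqrt (2 * (B * (k / real (p + k))))"
      using pos by eventually_elim (elim conjE, rule e_lim)
    show "\<forall>\<^sub>F p in sequentially. \<forall>\<^sub>F N in sequentially. norm (a N - b p N) \<le> e p N"
      using pos by eventually_elim (elim conjE, intro always_eventually allI ab)
    show "(\<lambda>p. complex_of_real (exp (- ((t\<^sup>2 * (v p / real (p + k))) / 2)))) \<longlonglongrightarrow> exp (- ((t\<^sup>2 * (null_sd k h)\<^sup>2) / 2))"
      by (intro tendsto_intros v_lim) auto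
    have "(\<lambda>p. real k / real (p + k)) \<longlonglongrightarrow> 0" by real_asymp
    then have "(\<lambda>p. \<bar>t\<bar> * sqrt (2 * (B * (k / real (p + k))))) \<longlonglongrightarrow> \<bar>t\<bar> * sqrt (2 * (B * 0))"
      by (intro tendsto_intros)
    then show "(\<lambda>p. \<bar>t\<bar> * sqrt (2 * (B * (k / real (p + k))))) \<longlonglongrightarrow> 0" by simp
  qed
  then show ?thesis by (simp add: a_def[abs_def] S_def)
qed

end

section \<open>Quartic forms under the null\<close>

lemma prod4_coords:
  assumes "{p, q, r, s} \<subseteq> I"
  shows "integrable (iid_normal I) (\<lambda>\<omega>. (\<omega> p * \<omega> q * \<omega> r * \<omega> s)\<^sup>2)"
    and "(\<integral>\<omega>. (\<omega> p * \<omega> q * \<omega> r * \<omega> s)\<^sup>2 \<partial>iid_normal I) \<le> 105"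
    and "integrable (iid_normal I) (\<lambda>\<omega>. \<omega> p * \<omega> q * \<omega> r * \<omega> s)"
proof -
  interpret prob_space "iid_normal I" by (rule prob_space_iid_normal)
  show i: "integrable (iid_normal I) (\<lambda>\<omega>. (\<omega> p * \<omega> q * \<omega> r * \<omega> s)\<^sup>2)"
    and "(\<integral>\<omega>. (\<omega> p * \<omega> q * \<omega> r * \<omega> s)\<^sup>2 \<partial>iid_normal I) \<le> 105"
    using assms by (intro std_normal_prod4 distributed_coord; simp)+
  show "integrable (iid_normal I) (\<lambda>\<omega>. \<omega> p * \<omega> q * \<omega> r * \<omega> s)"
    by (rule square_integrable_imp_integrable[OF _ i]) simp
qed

lemma prod3_coords:
  assumes "{p, q, r} \<subseteq> I"
  shows "integrable (iid_normal I) (\<lambda>\<omega>. (\<omega> p * \<omega> q * \<omega> r)\<^sup>2)"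
    and "integrable (iid_normal I) (\<lambda>\<omega>. \<omega> p * \<omega> q * \<omega> r)"
proof -
  interpret prob_space "iid_normal I" by (rule prob_space_iid_normal)
  show i: "integrable (iid_normal I) (\<lambda>\<omega>. (\<omega> p * \<omega> q * \<omega> r)\<^sup>2)"
    using prod4_L2(1)[of "\<lambda>\<omega>. \<omega> p" "iid_normal I" "\<lambda>\<omega>. \<omega> q" "\<lambda>\<omega>. \<omega> r" "\<lambda>_. 1"] assms
    by (simp add: std_normal_moments(1)[OF distributed_coord])
  show "integrable (iid_normal I) (\<lambda>\<omega>. \<omega> p * \<omega> q * \<omega> r)"
    by (rule square_integrable_imp_integrable[OF _ i]) simp
qed

text \<open>A coordinate that occurs once splits off as an independent factor of mean 0. Every
  vanishing moment of a product of coordinates below is an instance.\<close>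

lemma expectation_isolated_coord:
  fixes G :: "(nat \<Rightarrow> real) \<Rightarrow> real"
  assumes "p \<in> I" "p \<notin> B" "B \<subseteq> I" "G \<in> borel_measurable (iid_normal B)"
    and "\<And>\<omega>. G (restrict \<omega> B) = G \<omega>" "integrable (iid_normal I) G"
  shows "(\<integral>\<omega>. \<omega> p * G \<omega> \<partial>iid_normal I) = 0"
proof -
  note m = std_normal_moments[OF distributed_coord[OF assms(1)]]
  have "(\<integral>\<omega>. \<omega> p * G \<omega> \<partial>iid_normal I) = (\<integral>\<omega>. \<omega> p \<partial>iid_normal I) * (\<integral>\<omega>. G \<omega> \<partial>iid_normal I)"
    using assms m(1)[of 1] by (intro expectation_mult_disjoint_coords[of "{p}" B]) auto
  then show ?thesis by (simp add: m(2))
qed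

lemma expectation_prod4_isolated:
  assumes "{p, q, r, s} \<subseteq> I" "p \<notin> {q, r, s}"
  shows "(\<integral>\<omega>. \<omega> p * \<omega> q * \<omega> r * \<omega> s \<partial>iid_normal I) = 0"
  using expectation_isolated_coord[of p I "{q, r, s}" "\<lambda>\<omega>. \<omega> q * \<omega> r * \<omega> s"] prod3_coords[of q r s I] assms
  by (simp add: mult.assoc)

lemma expectation_prod4_pairs:
  assumes "{p, r} \<subseteq> I" "p \<noteq> r"
  shows "(\<integral>\<omega>. \<omega> p * \<omega> p * \<omega> r * \<omega> r \<partial>iid_normal I) = 1"
proof -
  note m = std_normal_moments[OF distributed_coord[of _ I]]
  have "(\<integral>\<omega>. (\<omega> p)\<^sup>2 * (\<omega> r)\<^sup>2 \<partial>iid_normal I) = (\<integral>\<omega>. (\<omega> p)\<^sup>2 \<partial>iid_normal I) * (\<integral>\<omega>. (\<omega> r)\<^sup>2 \<partial>iid_normal I)"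
    using assms by (intro expectation_mult_disjoint_coords[of "{p}" "{r}"] m) auto
  moreover have "\<omega> p * \<omega> p * \<omega> r * \<omega> r = (\<omega> p)\<^sup>2 * (\<omega> r)\<^sup>2" for \<omega> :: "nat \<Rightarrow> real"
    by (simp add: power2_eq_square)
  ultimately have "(\<integral>\<omega>. \<omega> p * \<omega> p * \<omega> r * \<omega> r \<partial>iid_normal I)
      = (\<integral>\<omega>. (\<omega> p)\<^sup>2 \<partial>iid_normal I) * (\<integral>\<omega>. (\<omega> r)\<^sup>2 \<partial>iid_normal I)"
    by (simp only:)
  then show ?thesis using assms by (simp add: m)
qed

lemma expectation_prod4_square:
  assumes "{a, b, c, d} \<subseteq> I" "distinct [a, b, c, d]"
  shows "(\<integral>\<omega>. (\<omega> a * \<omega> b * \<omega> c * \<omega> d)\<^sup>2 \<partial>iid_normal I) = 1"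
proof -
  note m = std_normal_moments[OF distributed_coord[of _ I]]
  have L2: "integrable (iid_normal I) (\<lambda>\<omega>. (\<omega> c)\<^sup>2 * (\<omega> d)\<^sup>2)" "(\<integral>\<omega>. (\<omega> c)\<^sup>2 * (\<omega> d)\<^sup>2 \<partial>iid_normal I) = 1"
    using expectation_mult_disjoint_coords[of "{c}" "{d}" I "\<lambda>\<omega>. (\<omega> c)\<^sup>2" "\<lambda>\<omega>. (\<omega> d)\<^sup>2"] assms by (auto simp: m)
  have L3: "integrable (iid_normal I) (\<lambda>\<omega>. (\<omega> b)\<^sup>2 * ((\<omega> c)\<^sup>2 * (\<omega> d)\<^sup>2))"
    "(\<integral>\<omega>. (\<omega> b)\<^sup>2 * ((\<omega> c)\<^sup>2 * (\<omega> d)\<^sup>2) \<partial>iid_normal I) = 1"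
    using expectation_mult_disjoint_coords[of "{b}" "{c, d}" I "\<lambda>\<omega>. (\<omega> b)\<^sup>2" "\<lambda>\<omega>. (\<omega> c)\<^sup>2 * (\<omega> d)\<^sup>2"] assms L2 by (auto simp: m)
  have "(\<integral>\<omega>. (\<omega> a)\<^sup>2 * ((\<omega> b)\<^sup>2 * ((\<omega> c)\<^sup>2 * (\<omega> d)\<^sup>2)) \<partial>iid_normal I) = 1"
    using expectation_mult_disjoint_coords[of "{a}" "{b, c, d}" I "\<lambda>\<omega>. (\<omega> a)\<^sup>2" "\<lambda>\<omega>. (\<omega> b)\<^sup>2 * ((\<omega> c)\<^sup>2 * (\<omega> d)\<^sup>2)"] assms L3 by (auto simp: m)
  then show ?thesis by (simp add: power_mult_distrib mult.assoc)
qed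

lemma expectation_prod4_prod4_isolated:
  assumes "{p, q, r, s} \<union> {a, b, c, d} \<subseteq> I" "p \<notin> {q, r, s} \<union> {a, b, c, d}"
  shows "(\<integral>\<omega>. (\<omega> p * \<omega> q * \<omega> r * \<omega> s) * (\<omega> a * \<omega> b * \<omega> c * \<omega> d) \<partial>iid_normal I) = 0"
proof -
  have "integrable (iid_normal I) (\<lambda>\<omega>. (\<omega> q * \<omega> r * \<omega> s) * (\<omega> a * \<omega> b * \<omega> c * \<omega> d))"
    using assms by (intro integrable_mult_L2 prod3_coords prod4_coords) auto
  then show ?thesis
    using expectation_isolated_coord[of p I "{q, r, s} \<union> {a, b, c, d}" "\<lambda>\<omega>. (\<omega> q * \<omega> r * \<omega> s) * (\<omega> a * \<omega> b * \<omega> c * \<omega> d)"] assms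
    by (simp add: mult.assoc)
qed

text \<open>If the first index set is contained in the second, the two increasing quadruples
  coincide and the integrand is a square; otherwise some index of the first quadruple is isolated
  and the expectation is 0.\<close>

lemma expectation_prod4_prod4_nonneg:
  assumes "a < b" "b < c" "c < d" "p < q" "q < r" "r < s" "{a, b, c, d} \<union> {p, q, r, s} \<subseteq> I"
  shows "0 \<le> (\<integral>\<omega>. (\<omega> a * \<omega> b * \<omega> c * \<omega> d) * (\<omega> p * \<omega> q * \<omega> r * \<omega> s) \<partial>iid_normal I)"
proof -
  have eq: "[a, b, c, d] = [p, q, r, s]" if sub: "set [a, b, c, d] \<subseteq> set [p, q, r, s]"
  proof (rule strict_sorted_equal)
    have "card (set [a, b, c, d]) = 4" "card (set [p, q, r, s]) = 4"
      using assms(1-6) by (subst distinct_card; simp)+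
    then show "set [a, b, c, d] = set [p, q, r, s]"
      using card_subset_eq[OF _ sub] by simp
  qed (use assms(1-6) in auto)
  consider "{a, b, c, d} \<subseteq> {p, q, r, s}" | "a \<notin> {p, q, r, s}" | "b \<notin> {p, q, r, s}" | "c \<notin> {p, q, r, s}" | "d \<notin> {p, q, r, s}"
    by blast
  then show ?thesis
  proof cases
    case 1
    then show ?thesis using eq by simp
  next
    case 2
    with expectation_prod4_prod4_isolated[of a b c d p q r s I] assms show ?thesis by simp
  next
    case 3
    with expectation_prod4_prod4_isolated[of b a c d p q r s I] assms show ?thesis by (simp add: mult_ac)
  next
    case 4
    with expectation_prod4_prod4_isolated[of c a b d p q r s I] assms show ?thesis by (simp add: mult_ac)
  next
    case 5
    with expectation_prod4_prod4_isolated[of d a b c p q r s I] assms show ?thesis by (simp add: mult_ac)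
  qed
qed

definition quads :: "nat \<Rightarrow> (nat \<times> nat \<times> nat \<times> nat) set" where
  "quads k = {(a, b, c, d). 1 \<le> a \<and> a < b \<and> b < c \<and> c < d \<and> d \<le> k}"

text \<open>The set of quadruples is a parameter so that the full symmetric polynomial and its
  incremental component are instances of the same results.\<close>

definition quartic :: "(nat \<times> nat \<times> nat \<times> nat) set \<Rightarrow> (nat \<Rightarrow> real) \<Rightarrow> real" where
  "quartic Q x = (\<Sum>(a, b, c, d)\<in>Q. x a * x b * x c * x d)"

lemma finite_quads: "finite (quads k)"
proof (rule finite_subset)
  show "quads k \<subseteq> {..k} \<times> {..k} \<times> {..k} \<times> {..k}" by (auto simp: quads_def)
qed simp

lemma elem_sym4_eq_quartic: "elem_sym4 k = quartic (quads k)"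
  by (simp add: fun_eq_iff elem_sym4_def quartic_def quads_def)

lemma elem_sym4_incr_eq_quartic: "elem_sym4_incr k = quartic {(a, b, c, d) \<in> quads k. a = 1 \<and> d = k}"
proof
  fix x
  have "elem_sym4_incr k x = (\<Sum>(i, j) \<in> {(i, j). 2 \<le> i \<and> i < j \<and> j \<le> k - 1}. x 1 * x i * x j * x k)"
    unfolding elem_sym4_incr_def sum_distrib_left by (intro sum.cong) (auto simp: mult_ac)
  also have "\<dots> = quartic {(a, b, c, d) \<in> quads k. a = 1 \<and> d = k} x"
    unfolding quartic_def
    by (rule sum.reindex_bij_witness[of _ "\<lambda>(a, b, c, d). (b, c)" "\<lambda>(i, j). (1, i, j, k)"])
       (auto simp: quads_def)
  finally show "elem_sym4_incr k x = quartic {(a, b, c, d) \<in> quads k. a = 1 \<and> d = k} x" .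
qed

context
  fixes k :: nat and Q :: "(nat \<times> nat \<times> nat \<times> nat) set"
  assumes Q: "Q \<subseteq> quads k"
begin

lemma finite_subset_quads: "finite Q"
  using Q finite_quads by (rule finite_subset)

lemma quartic_mean_zero_L2: "quartic Q \<in> mean_zero_L2 k"
proof -
  have sub: "{a, b, c, d} \<subseteq> {1..k}" "a \<notin> {b, c, d}" if "(a, b, c, d) \<in> Q" for a b c d
    using that Q by (auto simp: quads_def)
  have [measurable]: "(\<lambda>x. x i) \<in> borel_measurable (std_normal_power k)" for i
    unfolding std_normal_power_def by measurable
  have "integrable (std_normal_power k) (\<lambda>x. (quartic Q x)\<^sup>2)"
    unfolding quartic_def std_normal_power_def
    using sub(1) by (intro L2_sum(1)) (auto intro!: prod4_coords split: prod.splits)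
  moreover have "(\<integral>x. quartic Q x \<partial>std_normal_power k) = 0"
  proof -
    have *: "integrable (std_normal_power k) (\<lambda>x. case t of (a, b, c, d) \<Rightarrow> x a * x b * x c * x d)"
      "(\<integral>x. (case t of (a, b, c, d) \<Rightarrow> x a * x b * x c * x d) \<partial>std_normal_power k) = 0" if t: "t \<in> Q" for t
    proof -
      obtain a b c d where "t = (a, b, c, d)" by (cases t)
      with t show "integrable (std_normal_power k) (\<lambda>x. case t of (a, b, c, d) \<Rightarrow> x a * x b * x c * x d)"
        "(\<integral>x. (case t of (a, b, c, d) \<Rightarrow> x a * x b * x c * x d) \<partial>std_normal_power k) = 0"
        using prod4_coords(3)[OF sub(1), of a b c d] expectation_prod4_isolated[OF sub, of a b c d]
        unfolding std_normal_power_def by simp_all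
    qed
    show ?thesis
      unfolding quartic_def by (subst Bochner_Integration.integral_sum) (simp_all add: *)
  qed
  moreover have "quartic Q \<in> borel_measurable (std_normal_power k)"
    unfolding quartic_def[abs_def] case_prod_unfold by measurable
  ultimately show ?thesis unfolding mean_zero_L2_def by blast
qed

lemma quartic_coord_block:
  "quartic Q (block k X i \<omega>) = (\<Sum>(a, b, c, d)\<in>Q. X (i + a - 1) \<omega> * X (i + b - 1) \<omega> * X (i + c - 1) \<omega> * X (i + d - 1) \<omega>)"
  unfolding quartic_def
proof (intro sum.cong refl)
  fix t assume t: "t \<in> Q"
  obtain a b c d where abcd: "t = (a, b, c, d)" by (cases t)
  with t Q have "{a, b, c, d} \<subseteq> {1..k}" by (auto simp: quads_def)
  then show "(case t of (a, b, c, d) \<Rightarrow> block k X i \<omega> a * block k X i \<omega> b * block k X i \<omega> c * block k X i \<omega> d)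
      = (case t of (a, b, c, d) \<Rightarrow> X (i + a - 1) \<omega> * X (i + b - 1) \<omega> * X (i + c - 1) \<omega> * X (i + d - 1) \<omega>)"
    by (simp add: abcd block_def)
qed

text \<open>Expanded into pairs of monomials, the variance and all lag covariances are sums of
  nonnegative terms, and a single monomial paired with itself already contributes 1 to the
  variance.\<close>

lemma null_sd_quartic_pos:
  assumes "Q \<noteq> {}"
  shows "0 < null_sd k (quartic Q)"
proof -
  let ?D = "\<lambda>i \<omega>. quartic Q (coord_block k i \<omega>)"
  define m where "m i t \<omega> = (case t of (a, b, c, d) \<Rightarrow> \<omega> (i + a - 1) * \<omega> (i + b - 1) * \<omega> (i + c - 1) * \<omega> (i + d - 1))"
    for i :: nat and t :: "nat \<times> nat \<times> nat \<times> nat" and \<omega> :: "nat \<Rightarrow> real"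
  have [measurable]: "m i t \<in> borel_measurable null_law" for i t
    unfolding m_def by (auto split: prod.split)
  have L2: "integrable null_law (\<lambda>\<omega>. (m i t \<omega>)\<^sup>2)" if "t \<in> Q" "1 \<le> i" for i t
    unfolding m_def null_law_def using that Q by (auto simp: quads_def split: prod.split intro!: prod4_coords)
  have nonneg: "0 \<le> (\<integral>\<omega>. m i t \<omega> * m j u \<omega> \<partial>null_law)" if "t \<in> Q" "u \<in> Q" "1 \<le> i" "1 \<le> j" for i j t u
  proof -
    obtain a b c d a' b' c' d' where tu: "t = (a, b, c, d)" "u = (a', b', c', d')"
      using prod_cases4[of t] prod_cases4[of u] by metis
    have "t \<in> quads k" "u \<in> quads k" using that(1,2) Q by blast+
    then have "1 \<le> a" "a < b" "b < c" "c < d" "1 \<le> a'" "a' < b'" "b' < c'" "c' < d'"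
      by (simp_all add: tu quads_def)
    then show ?thesis
      unfolding tu m_def null_law_def prod.case using that(3,4)
      by (intro expectation_prod4_prod4_nonneg) auto
  qed
  have D: "?D i \<omega> = (\<Sum>t\<in>Q. m i t \<omega>)" for i \<omega>
    by (simp add: quartic_coord_block m_def)
  have E: "(\<integral>\<omega>. ?D i \<omega> * ?D j \<omega> \<partial>null_law) = (\<Sum>t\<in>Q. \<Sum>u\<in>Q. \<integral>\<omega>. m i t \<omega> * m j u \<omega> \<partial>null_law)"
    if "1 \<le> i" "1 \<le> j" for i j
    unfolding D sum_product using that
    by (subst Bochner_Integration.integral_sum; (intro sum.cong refl Bochner_Integration.integral_sum)?)
       (auto intro!: integrable_mult_L2 L2)
  obtain t where t: "t \<in> Q" using assms by blast
  have "1 = (\<integral>\<omega>. m 1 t \<omega> * m 1 t \<omega> \<partial>null_law)"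
  proof -
    obtain a b c d where abcd: "t = (a, b, c, d)" by (cases t)
    with t Q have "1 \<le> a" "a < b" "b < c" "c < d" by (auto simp: quads_def)
    then have "(\<integral>\<omega>. (\<omega> a * \<omega> b * \<omega> c * \<omega> d)\<^sup>2 \<partial>null_law) = 1"
      unfolding null_law_def by (intro expectation_prod4_square) auto
    then show ?thesis by (simp add: m_def abcd power2_eq_square)
  qed
  also have "\<dots> \<le> (\<Sum>u\<in>Q. \<integral>\<omega>. m 1 t \<omega> * m 1 u \<omega> \<partial>null_law)"
    using t nonneg by (intro member_le_sum[of t Q "\<lambda>u. \<integral>\<omega>. m 1 t \<omega> * m 1 u \<omega> \<partial>null_law"] finite_subset_quads) auto
  also have "\<dots> \<le> (\<Sum>t\<in>Q. \<Sum>u\<in>Q. \<integral>\<omega>. m 1 t \<omega> * m 1 u \<omega> \<partial>null_law)"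
    using t nonneg by (intro member_le_sum[of t Q "\<lambda>t. \<Sum>u\<in>Q. \<integral>\<omega>. m 1 t \<omega> * m 1 u \<omega> \<partial>null_law"] finite_subset_quads)
      (auto intro!: sum_nonneg)
  finally have "1 \<le> (\<integral>\<omega>. ?D 1 \<omega> * ?D 1 \<omega> \<partial>null_law)" by (simp add: E)
  moreover have "0 \<le> (\<Sum>r=1..k-1. \<integral>\<omega>. ?D 1 \<omega> * ?D (1 + r) \<omega> \<partial>null_law)"
    using nonneg by (intro sum_nonneg) (auto simp: E intro!: sum_nonneg)
  ultimately show ?thesis by (simp add: null_sd_eq[OF quartic_mean_zero_L2])
qed

end

section \<open>The incremental component\<close>

lemma orthogonal_of_coord_free:
  fixes f u :: "(nat \<Rightarrow> real) \<Rightarrow> real"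
  assumes i: "i \<in> {1..k}" and fu: "integrable (std_normal_power k) (\<lambda>x. f x * u x)"
    and [measurable]: "f \<in> borel_measurable (std_normal_power k)" "u \<in> borel_measurable (std_normal_power k)"
    and f: "\<And>x y. f (x(i := y)) = f x"
    and u: "AE x in std_normal_power k. (\<integral>y. u (x(i := y)) \<partial>std_normal) = 0"
  shows "(\<integral>x. f x * u x \<partial>std_normal_power k) = 0"
proof -
  interpret prob_space std_normal by (rule prob_space_std_normal)
  interpret product_sigma_finite "\<lambda>_ :: nat. std_normal" ..
  define J where "J = {1..k} - {i}"
  define \<phi> where "\<phi> x = (\<integral>y. u (x(i := y)) \<partial>std_normal)" for x
  have J: "finite J" "i \<notin> J" and P: "std_normal_power k = iid_normal (insert i J)"
    using i by (auto simp: J_def std_normal_power_def insert_absorb)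
  have [measurable]: "\<phi> \<in> borel_measurable (std_normal_power k)"
  proof -
    have "(\<lambda>z. (fst z)(i := snd z)) \<in> measurable (std_normal_power k \<Otimes>\<^sub>M std_normal) (std_normal_power k)"
      unfolding P by (rule measurable_fun_upd[where J = "insert i J"]) auto
    then have "(\<lambda>z. u ((fst z)(i := snd z))) \<in> borel_measurable (std_normal_power k \<Otimes>\<^sub>M std_normal)"
      by (rule measurable_compose) fact
    then have [measurable]: "(\<lambda>(x, y). u (x(i := y))) \<in> borel_measurable (std_normal_power k \<Otimes>\<^sub>M std_normal)"
      unfolding case_prod_unfold .
    show ?thesis unfolding \<phi>_def by (rule borel_measurable_lebesgue_integral) fact
  qed
  have z: "AE x in std_normal_power k. f x * \<phi> x = 0" using u by (auto simp: \<phi>_def)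
  have int: "integrable (std_normal_power k) (\<lambda>x. f x * \<phi> x)"
    by (subst integrable_cong_AE[OF _ _ z]) auto
  \<comment> \<open>Fubini with coordinate \<open>i\<close> innermost: \<open>f\<close> is constant
    in it and leaves the inner integral, which then is \<phi>.\<close>
  have "(\<integral>x. f x * u x \<partial>std_normal_power k) = (\<integral>x. f x * \<phi> x \<partial>iid_normal J)"
    using product_integral_insert[OF J, of "\<lambda>x. f x * u x"] fu by (simp add: P f \<phi>_def)
  \<comment> \<open>Coordinate \<open>i\<close> is put back with total mass 1, because \<phi> is
    known to vanish only almost everywhere on the full product.\<close>
  also have "\<dots> = (\<integral>x. f x * \<phi> x \<partial>std_normal_power k)"
    using product_integral_insert[OF J, of "\<lambda>x. f x * \<phi> x"] int by (simp add: P f \<phi>_def prob_space[unfolded space_std_normal])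
  also have "\<dots> = 0" using integral_cong_AE[OF _ _ z] by simp
  finally show ?thesis .
qed

text \<open>An increasing quadruple in \<open>{1..k}\<close> contains 1 only as \<open>a\<close> and
  \<open>k\<close> only as \<open>d\<close>. Monomials containing both are linear in each of these
  coordinates and lie in the increment space; any other monomial is constant in coordinate 1 or in
  coordinate \<open>k\<close>, hence orthogonal to that space.\<close>

lemma incremental_component_quartic:
  assumes "k \<ge> 4"
  shows "incremental_component k (quartic (quads k)) (quartic {(a, b, c, d) \<in> quads k. a = 1 \<and> d = k})"
    (is "incremental_component k ?g ?g1")
proof -
  let ?Q1 = "{(a, b, c, d) \<in> quads k. a = 1 \<and> d = k}"
  have [measurable]: "(\<lambda>x. x i) \<in> borel_measurable (std_normal_power k)" for i
    unfolding std_normal_power_def by measurable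
  note g = quartic_mean_zero_L2[OF subset_refl, of k]
  have g1: "?g1 \<in> mean_zero_L2 k" by (rule quartic_mean_zero_L2) auto
  have lin: "(\<integral>y. ?g1 (x(i := y)) \<partial>std_normal) = 0" if i: "i \<in> {1, k}" for x i
  proof -
    obtain C where C: "?g1 (x(i := y)) = y * C" for y
    proof
      show "?g1 (x(i := y)) = y * (\<Sum>(a, b, c, d)\<in>?Q1. (if i = 1 then x d else x a) * x b * x c)" for y
        unfolding quartic_def sum_distrib_left
      proof (intro sum.cong refl)
        fix t assume "t \<in> ?Q1"
        then obtain b c where "t = (1, b, c, k)" "1 < b" "b < c" "c < k" by (auto simp: quads_def)
        then show "(case t of (a, b, c, d) \<Rightarrow> (x(i := y)) a * (x(i := y)) b * (x(i := y)) c * (x(i := y)) d)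
            = y * (case t of (a, b, c, d) \<Rightarrow> (if i = 1 then x d else x a) * x b * x c)"
          using i assms by auto
      qed
    qed
    have "(\<integral>y. y \<partial>std_normal) = 0"
      using integral_std_normal_distribution_moment_odd[of 1] by (simp add: std_normal_def)
    then show ?thesis unfolding C by simp
  qed
  have inc: "?g1 \<in> increment_space k"
    using g1 lin by (simp add: increment_space_def)
  have "(\<integral>x. (?g x - ?g1 x) * u x \<partial>std_normal_power k) = 0" if u: "u \<in> increment_space k" for u
  proof -
    have um [measurable]: "u \<in> borel_measurable (std_normal_power k)" and u2: "integrable (std_normal_power k) (\<lambda>x. (u x)\<^sup>2)"
      and u0: "AE x in std_normal_power k. (\<integral>y. u (x(1 := y)) \<partial>std_normal) = 0"
        "AE x in std_normal_power k. (\<integral>y. u (x(k := y)) \<partial>std_normal) = 0"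
      using u unfolding increment_space_def mean_zero_L2_def mem_Collect_eq by blast+
    have int: "integrable (std_normal_power k) (\<lambda>x. (x a * x b * x c * x d) * u x)"
      if t: "(a, b, c, d) \<in> quads k" for a b c d
    proof (rule integrable_mult_L2)
      show "integrable (std_normal_power k) (\<lambda>x. (x a * x b * x c * x d)\<^sup>2)"
        unfolding std_normal_power_def using t by (intro prod4_coords) (auto simp: quads_def)
      show "(\<lambda>x. x a * x b * x c * x d) \<in> borel_measurable (std_normal_power k)" by measurable
    qed (rule um u2)+
    have int': "integrable (std_normal_power k) (\<lambda>x. (case t of (a, b, c, d) \<Rightarrow> x a * x b * x c * x d) * u x)"
      if "t \<in> quads k" for t
      using int that by (cases t) simp
    have "(\<integral>x. (?g x - ?g1 x) * u x \<partial>std_normal_power k)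
        = (\<integral>x. (\<Sum>t\<in>quads k - ?Q1. (case t of (a, b, c, d) \<Rightarrow> x a * x b * x c * x d) * u x) \<partial>std_normal_power k)"
    proof (rule Bochner_Integration.integral_cong)
      fix x
      have "?g x = (\<Sum>(a, b, c, d)\<in>quads k - ?Q1. x a * x b * x c * x d) + ?g1 x"
        unfolding quartic_def by (rule sum.subset_diff) (auto simp: finite_quads)
      then show "(?g x - ?g1 x) * u x = (\<Sum>t\<in>quads k - ?Q1. (case t of (a, b, c, d) \<Rightarrow> x a * x b * x c * x d) * u x)"
        unfolding sum_distrib_right[symmetric] by (simp only: add_diff_cancel_right')
    qed simp
    also have "\<dots> = (\<Sum>t\<in>quads k - ?Q1. \<integral>x. (case t of (a, b, c, d) \<Rightarrow> x a * x b * x c * x d) * u x \<partial>std_normal_power k)"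
      by (rule Bochner_Integration.integral_sum) (rule int', erule DiffD1)
    also have "\<dots> = 0"
    proof (intro sum.neutral ballI)
      fix t assume "t \<in> quads k - ?Q1"
      then obtain a b c d where t: "t = (a, b, c, d)" "(a, b, c, d) \<in> quads k" "a \<noteq> 1 \<or> d \<noteq> k"
        by (cases t) auto
      then consider "1 \<notin> {a, b, c, d}" | "k \<notin> {a, b, c, d}" by (auto simp: quads_def)
      then have "(\<integral>x. (x a * x b * x c * x d) * u x \<partial>std_normal_power k) = 0"
      proof cases
        case 1
        then show ?thesis using assms int[OF t(2)] u0(1) by (intro orthogonal_of_coord_free[of 1]) auto
      next
        case 2
        then show ?thesis using assms int[OF t(2)] u0(2) by (intro orthogonal_of_coord_free[of k]) auto
      qed
      then show "(\<integral>x. (case t of (a, b, c, d) \<Rightarrow> x a * x b * x c * x d) * u x \<partial>std_normal_power k) = 0"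
        by (simp add: t)
    qed
    finally show ?thesis .
  qed
  with g inc show ?thesis by (simp add: incremental_component_def)
qed

section \<open>The AR(1) path on the null space\<close>

lemma gaussian_ar1_prob_space: "gaussian_ar1 M \<rho> X \<Longrightarrow> prob_space M"
  by (simp add: gaussian_ar1_def)

lemma sets_PiM_borel_eq: "sets (\<Pi>\<^sub>M s\<in>I. borel) = sets (iid_normal I)"
  by (intro sets_PiM_cong) auto

lemma gaussian_ar1_past_measurable:
  assumes "gaussian_ar1 M \<rho> X" "2 \<le> t"
  shows "(\<lambda>\<omega>. \<lambda>s\<in>{1..<t}. X s \<omega>) \<in> measurable M (\<Pi>\<^sub>M s\<in>{1..<t}. borel)"
proof -
  interpret prob_space M by (rule gaussian_ar1_prob_space[OF assms(1)])
  show ?thesis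
    using assms by (auto simp: gaussian_ar1_def dest: indep_var_rv1)
qed

text \<open>Induction on the length of the past. The law up to time \<open>t\<close> is the image,
  under a map \<open>G\<close> depending only on \<rho> and \<open>t\<close>, of the product of the
  law of the past and the innovation law; the model enters only through the law of the past.\<close>

lemma gaussian_ar1_law_unique:
  assumes X: "gaussian_ar1 M \<rho> X" and Y: "gaussian_ar1 N \<rho> Y" and "2 \<le> t"
  shows "distr M (\<Pi>\<^sub>M s\<in>{1..<t}. borel) (\<lambda>\<omega>. \<lambda>s\<in>{1..<t}. X s \<omega>)
    = distr N (\<Pi>\<^sub>M s\<in>{1..<t}. borel) (\<lambda>\<omega>. \<lambda>s\<in>{1..<t}. Y s \<omega>)"
  using \<open>2 \<le> t\<close>
proof (induction t rule: dec_induct)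
  case base
  have eq: "distr M (\<Pi>\<^sub>M s\<in>{1..<2}. borel) (\<lambda>\<omega>. \<lambda>s\<in>{1..<2}. X s \<omega>)
      = distr std_normal (\<Pi>\<^sub>M s\<in>{1..<2}. borel) (\<lambda>x. \<lambda>s\<in>{1..<2}. x)"
    if "gaussian_ar1 M \<rho> X" for M :: "'c measure" and X
  proof -
    have d: "distributed M lborel (X 1) std_normal_density" using that by (simp add: gaussian_ar1_def)
    then have m [measurable]: "X 1 \<in> borel_measurable M" by (auto simp: distributed_def)
    have "distr M borel (X 1) = std_normal"
      using d by (auto simp: distributed_def std_normal_def cong: distr_cong)
    then have "distr std_normal (\<Pi>\<^sub>M s\<in>{1..<2}. borel) (\<lambda>x. \<lambda>s\<in>{1..<2 :: nat}. x)
        = distr (distr M borel (X 1)) (\<Pi>\<^sub>M s\<in>{1..<2}. borel) (\<lambda>x. \<lambda>s\<in>{1..<2}. x)" by simp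
    also have "\<dots> = distr M (\<Pi>\<^sub>M s\<in>{1..<2}. borel) (\<lambda>\<omega>. \<lambda>s\<in>{1..<2 :: nat}. X 1 \<omega>)"
      using m by (subst distr_distr) (simp_all add: comp_def)
    also have "(\<lambda>\<omega>. \<lambda>s\<in>{1..<2 :: nat}. X 1 \<omega>) = (\<lambda>\<omega>. \<lambda>s\<in>{1..<2}. X s \<omega>)"
      by (intro ext restrict_ext) (auto simp: less_Suc_eq numeral_2_eq_2)
    finally show ?thesis by (rule sym)
  qed
  show ?case unfolding eq[OF X] eq[OF Y] ..
next
  case (step t)
  define G where "G = (\<lambda>(x, e). \<lambda>s\<in>{1..<Suc t}. if s = t then \<rho> * x (t - 1) + e t else x s :: real)"
  have G [measurable]: "G \<in> measurable ((\<Pi>\<^sub>M s\<in>{1..<t}. borel) \<Otimes>\<^sub>M (\<Pi>\<^sub>M s\<in>{t}. borel)) (\<Pi>\<^sub>M s\<in>{1..<Suc t}. borel)"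
    unfolding G_def case_prod_unfold
  proof (rule measurable_restrict)
    fix s assume s: "s \<in> {1..<Suc t}"
    have "t - 1 \<in> {1..<t}" using step by auto
    then have 1: "(\<lambda>x. \<rho> * fst x (t - 1) + snd x t) \<in> borel_measurable ((\<Pi>\<^sub>M s\<in>{1..<t}. borel) \<Otimes>\<^sub>M (\<Pi>\<^sub>M s\<in>{t}. borel))"
      by measurable
    show "(\<lambda>x. if s = t then \<rho> * fst x (t - 1) + snd x t else fst x s)
        \<in> borel_measurable ((\<Pi>\<^sub>M s\<in>{1..<t}. borel) \<Otimes>\<^sub>M (\<Pi>\<^sub>M s\<in>{t}. borel))"
    proof (cases "s = t")
      case False
      then have "s \<in> {1..<t}" using s by auto
      then have "(\<lambda>x. fst x s) \<in> borel_measurable ((\<Pi>\<^sub>M s\<in>{1..<t}. borel) \<Otimes>\<^sub>M (\<Pi>\<^sub>M s\<in>{t}. borel))"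
        by measurable
      then show ?thesis using False by simp
    qed (use 1 in simp)
  qed
  have eq: "distr M (\<Pi>\<^sub>M s\<in>{1..<Suc t}. borel) (\<lambda>\<omega>. \<lambda>s\<in>{1..<Suc t}. X s \<omega>)
      = distr (distr M (\<Pi>\<^sub>M s\<in>{1..<t}. borel) (\<lambda>\<omega>. \<lambda>s\<in>{1..<t}. X s \<omega>) \<Otimes>\<^sub>M
          distr (density lborel (normal_density 0 (sqrt (1 - \<rho>\<^sup>2)))) (\<Pi>\<^sub>M s\<in>{t}. borel) (\<lambda>x. \<lambda>s\<in>{t}. x))
        (\<Pi>\<^sub>M s\<in>{1..<Suc t}. borel) G"
    if X: "gaussian_ar1 M \<rho> X" for M :: "'c measure" and X
  proof -
    interpret prob_space M by (rule gaussian_ar1_prob_space[OF X])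
    obtain \<epsilon> :: "nat \<Rightarrow> 'c \<Rightarrow> real" where
      d: "\<And>t. 2 \<le> t \<Longrightarrow> distributed M lborel (\<epsilon> t) (normal_density 0 (sqrt (1 - \<rho>\<^sup>2)))" and
      i: "\<And>t. 2 \<le> t \<Longrightarrow> indep_var (\<Pi>\<^sub>M s\<in>{1..<t}. borel) (\<lambda>\<omega>. \<lambda>s\<in>{1..<t}. X s \<omega>)
                   (\<Pi>\<^sub>M s\<in>{t}. borel) (\<lambda>\<omega>. \<lambda>s\<in>{t}. \<epsilon> s \<omega>)" and
      r: "\<And>t \<omega>. 2 \<le> t \<Longrightarrow> \<omega> \<in> space M \<Longrightarrow> X t \<omega> = \<rho> * X (t - 1) \<omega> + \<epsilon> t \<omega>"
      using X unfolding gaussian_ar1_def by blast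
    note i = i[OF step(1)] and d = d[OF step(1)] and r = r[OF step(1)]
    note rv = indep_var_rv1[OF i] indep_var_rv2[OF i]
    have m [measurable]: "\<epsilon> t \<in> borel_measurable M" using d by (auto simp: distributed_def)
    have "distr M borel (\<epsilon> t) = density lborel (normal_density 0 (sqrt (1 - \<rho>\<^sup>2)))"
      using d by (auto simp: distributed_def cong: distr_cong)
    then have "distr (density lborel (normal_density 0 (sqrt (1 - \<rho>\<^sup>2)))) (\<Pi>\<^sub>M s\<in>{t}. borel) (\<lambda>x. \<lambda>s\<in>{t}. x)
        = distr (distr M borel (\<epsilon> t)) (\<Pi>\<^sub>M s\<in>{t}. borel) (\<lambda>x. \<lambda>s\<in>{t}. x)" by simp
    also have "\<dots> = distr M (\<Pi>\<^sub>M s\<in>{t}. borel) (\<lambda>\<omega>. \<lambda>s\<in>{t}. \<epsilon> t \<omega>)"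
      by (subst distr_distr) (simp_all add: comp_def)
    also have "(\<lambda>\<omega>. \<lambda>s\<in>{t}. \<epsilon> t \<omega>) = (\<lambda>\<omega>. \<lambda>s\<in>{t}. \<epsilon> s \<omega>)"
      by (intro ext restrict_ext) auto
    finally have e: "distr (density lborel (normal_density 0 (sqrt (1 - \<rho>\<^sup>2)))) (\<Pi>\<^sub>M s\<in>{t}. borel) (\<lambda>x. \<lambda>s\<in>{t}. x)
        = distr M (\<Pi>\<^sub>M s\<in>{t}. borel) (\<lambda>\<omega>. \<lambda>s\<in>{t}. \<epsilon> s \<omega>)" .
    have joint: "distr M (\<Pi>\<^sub>M s\<in>{1..<t}. borel) (\<lambda>\<omega>. \<lambda>s\<in>{1..<t}. X s \<omega>) \<Otimes>\<^sub>M
        distr M (\<Pi>\<^sub>M s\<in>{t}. borel) (\<lambda>\<omega>. \<lambda>s\<in>{t}. \<epsilon> s \<omega>)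
        = distr M ((\<Pi>\<^sub>M s\<in>{1..<t}. borel) \<Otimes>\<^sub>M (\<Pi>\<^sub>M s\<in>{t}. borel)) (\<lambda>\<omega>. (\<lambda>s\<in>{1..<t}. X s \<omega>, \<lambda>s\<in>{t}. \<epsilon> s \<omega>))"
      using i unfolding indep_var_distribution_eq by blast
    have comp: "distr (distr M ((\<Pi>\<^sub>M s\<in>{1..<t}. borel) \<Otimes>\<^sub>M (\<Pi>\<^sub>M s\<in>{t}. borel)) (\<lambda>\<omega>. (\<lambda>s\<in>{1..<t}. X s \<omega>, \<lambda>s\<in>{t}. \<epsilon> s \<omega>)))
          (\<Pi>\<^sub>M s\<in>{1..<Suc t}. borel) G
        = distr M (\<Pi>\<^sub>M s\<in>{1..<Suc t}. borel) (G \<circ> (\<lambda>\<omega>. (\<lambda>s\<in>{1..<t}. X s \<omega>, \<lambda>s\<in>{t}. \<epsilon> s \<omega>)))"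
      by (rule distr_distr[OF G measurable_Pair[OF rv]])
    have fin: "distr M (\<Pi>\<^sub>M s\<in>{1..<Suc t}. borel) (\<lambda>\<omega>. \<lambda>s\<in>{1..<Suc t}. X s \<omega>)
        = distr M (\<Pi>\<^sub>M s\<in>{1..<Suc t}. borel) (G \<circ> (\<lambda>\<omega>. (\<lambda>s\<in>{1..<t}. X s \<omega>, \<lambda>s\<in>{t}. \<epsilon> s \<omega>)))"
    proof (intro distr_cong refl)
      fix \<omega> assume "\<omega> \<in> space M"
      then show "(\<lambda>s\<in>{1..<Suc t}. X s \<omega>) = (G \<circ> (\<lambda>\<omega>. (\<lambda>s\<in>{1..<t}. X s \<omega>, \<lambda>s\<in>{t}. \<epsilon> s \<omega>))) \<omega>"
        using r[of \<omega>] step(1) by (auto simp: G_def fun_eq_iff)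
    qed
    show ?thesis unfolding fin e joint comp ..
  qed
  show ?case unfolding eq[OF X] eq[OF Y] step.IH ..
qed

text \<open>Carries statistics of a finite stretch of the path over to a convenient realization.
  Invariance under \<open>restrict\<close> lets \<open>H\<close> be applied to the whole path, whose
  value at time 0 is arbitrary.\<close>

lemma gaussian_ar1_distr_eq:
  assumes "gaussian_ar1 M \<rho> X" "gaussian_ar1 N \<rho> Y" "2 \<le> t"
    and H: "H \<in> borel_measurable (iid_normal {1..<t})"
    and restrict: "\<And>x. H (restrict x {1..<t}) = H x"
  shows "distr M borel (\<lambda>\<omega>. H (\<lambda>s. X s \<omega>)) = distr N borel (\<lambda>\<omega>. H (\<lambda>s. Y s \<omega>))"
    and "(\<lambda>\<omega>. H (\<lambda>s. X s \<omega>)) \<in> borel_measurable M"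
proof -
  have H': "H \<in> borel_measurable (\<Pi>\<^sub>M s\<in>{1..<t}. borel)"
    using H by (simp cong: measurable_cong_sets add: sets_PiM_borel_eq)
  note m = gaussian_ar1_past_measurable[OF assms(1,3)] gaussian_ar1_past_measurable[OF assms(2,3)]
  have F: "(\<lambda>\<omega>. H (\<lambda>s. X s \<omega>)) = H \<circ> (\<lambda>\<omega>. \<lambda>s\<in>{1..<t}. X s \<omega>)"
    by (simp only: comp_def restrict)
  have G: "(\<lambda>\<omega>. H (\<lambda>s. Y s \<omega>)) = H \<circ> (\<lambda>\<omega>. \<lambda>s\<in>{1..<t}. Y s \<omega>)"
    by (simp only: comp_def restrict)
  show "distr M borel (\<lambda>\<omega>. H (\<lambda>s. X s \<omega>)) = distr N borel (\<lambda>\<omega>. H (\<lambda>s. Y s \<omega>))"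
    unfolding F G distr_distr[OF H' m(1), symmetric] distr_distr[OF H' m(2), symmetric]
      gaussian_ar1_law_unique[OF assms(1-3)] ..
  show "(\<lambda>\<omega>. H (\<lambda>s. X s \<omega>)) \<in> borel_measurable M" unfolding F using m(1) H' by (rule measurable_comp)
qed

text \<open>\<open>ar1_path \<rho> t\<close> uses the coordinates \<open>1, \<dots>, t + 1\<close>. The stationary model is taken to be
  \<open>X t = ar1_path \<rho> (t + 2)\<close>, so that three steps of the recursion can be unfolded already at time \<open>1\<close>.\<close>

primrec ar1_path :: "real \<Rightarrow> nat \<Rightarrow> (nat \<Rightarrow> real) \<Rightarrow> real" where
  "ar1_path \<rho> 0 = (\<lambda>\<omega>. \<omega> 1)"
| "ar1_path \<rho> (Suc t) = (\<lambda>\<omega>. \<rho> * ar1_path \<rho> t \<omega> + sqrt (1 - \<rho>\<^sup>2) * \<omega> (Suc (Suc t)))"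

lemma ar1_path_measurable [measurable]:
  "ar1_path \<rho> t \<in> borel_measurable (iid_normal A)" "ar1_path \<rho> t \<in> borel_measurable null_law"
  by (induction t) simp_all

lemma ar1_path_restrict: "{1..Suc t} \<subseteq> A \<Longrightarrow> ar1_path \<rho> t (restrict \<omega> A) = ar1_path \<rho> t \<omega>"
  by (induction t) (auto simp: subset_iff)

lemma distributed_coord_null_law: "1 \<le> t \<Longrightarrow> distributed null_law lborel (\<lambda>\<omega>. \<omega> t) std_normal_density"
  unfolding null_law_def by (rule distributed_coord) simp

lemma distributed_scaled_coord:
  assumes "\<bar>\<rho>\<bar> < 1" "1 \<le> t"
  shows "distributed null_law lborel (\<lambda>\<omega>. sqrt (1 - \<rho>\<^sup>2) * \<omega> t) (normal_density 0 (sqrt (1 - \<rho>\<^sup>2)))"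
proof -
  have "0 < sqrt (1 - \<rho>\<^sup>2)" using assms(1) by (simp add: abs_square_less_1)
  then show ?thesis
    using null.normal_density_affine[OF distributed_coord_null_law[OF assms(2)], of "sqrt (1 - \<rho>\<^sup>2)" 0]
    by simp
qed

lemma distributed_ar1_path:
  assumes \<rho>: "\<bar>\<rho>\<bar> < 1"
  shows "distributed null_law lborel (ar1_path \<rho> t) std_normal_density"
proof (induction t)
  case 0
  then show ?case by (simp add: distributed_coord_null_law)
next
  case (Suc t)
  have \<rho>2: "\<rho>\<^sup>2 < 1" using \<rho> by (simp add: abs_square_less_1)
  show ?case
  \<comment> \<open>The affine rule for normal densities needs a nonzero factor; for other \<rho>
    the variances add up to \<open>\<rho>^2 + (1 - \<rho>^2) = 1\<close>.\<close>
  proof (cases "\<rho> = 0")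
    case True
    then show ?thesis by (simp add: distributed_coord_null_law)
  next
    case False
    have ind: "null.indep_var borel (\<lambda>\<omega>. 0 + \<rho> * ar1_path \<rho> t \<omega>) borel (\<lambda>\<omega>. sqrt (1 - \<rho>\<^sup>2) * \<omega> (Suc (Suc t)))"
      unfolding null_law_def
      by (rule indep_var_disjoint_coords[of "{1..Suc t}" "{Suc (Suc t)}"]) (auto simp: ar1_path_restrict)
    have "distributed null_law lborel (\<lambda>\<omega>. (0 + \<rho> * ar1_path \<rho> t \<omega>) + sqrt (1 - \<rho>\<^sup>2) * \<omega> (Suc (Suc t)))
        (normal_density (0 + \<rho> * 0 + 0) (sqrt ((\<bar>\<rho>\<bar> * 1)\<^sup>2 + (sqrt (1 - \<rho>\<^sup>2))\<^sup>2)))"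
      using False \<rho>2 by (intro null.add_indep_normal[OF ind] null.normal_density_affine[OF Suc] distributed_scaled_coord \<rho>) auto
    then show ?thesis using \<rho>2 by simp
  qed
qed

lemma gaussian_ar1_ar1_path:
  assumes \<rho>: "\<bar>\<rho>\<bar> < 1"
  shows "gaussian_ar1 null_law \<rho> (\<lambda>t. ar1_path \<rho> (t + 2))"
  unfolding gaussian_ar1_def
\<comment> \<open>The step of the recursion leading to \<open>ar1_path \<rho> (t + 2)\<close> reads
  coordinate \<open>t + 3\<close>, which is therefore the innovation at time
  \<open>t\<close>.\<close>
proof (intro conjI exI[of _ "\<lambda>t \<omega>. sqrt (1 - \<rho>\<^sup>2) * \<omega> (t + 3)"] allI impI ballI)
  show "prob_space null_law" by (rule null.prob_space_axioms)
  show "distributed null_law lborel (ar1_path \<rho> (1 + 2)) std_normal_density"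
    by (rule distributed_ar1_path[OF \<rho>])
  show "distributed null_law lborel (\<lambda>\<omega>. sqrt (1 - \<rho>\<^sup>2) * \<omega> (t + 3)) (normal_density 0 (sqrt (1 - \<rho>\<^sup>2)))" for t
    by (rule distributed_scaled_coord[OF \<rho>]) simp
  show "null.indep_vars (\<lambda>_. borel) (\<lambda>t \<omega>. sqrt (1 - \<rho>\<^sup>2) * \<omega> (t + 3)) {2..}"
  proof -
    have "null.indep_vars (\<lambda>_. borel) (\<lambda>t \<omega>. \<omega> t) {1..}"
      unfolding null_law_def by (rule indep_coords)
    then have "null.indep_vars (\<lambda>t. PiM {t + 3} (\<lambda>_. borel)) (\<lambda>t \<omega>. restrict \<omega> {t + 3}) {2..}"
      by (rule null.indep_vars_restrict) (auto simp: disjoint_family_on_def)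
    then have "null.indep_vars (\<lambda>_. borel) (\<lambda>t \<omega>. sqrt (1 - \<rho>\<^sup>2) * restrict \<omega> {t + 3} (t + 3)) {2..}"
      by (rule null.indep_vars_compose2) measurable
    then show ?thesis by simp
  qed
  fix t :: nat assume t: "2 \<le> t"
  show "null.indep_var (\<Pi>\<^sub>M s\<in>{1..<t}. borel) (\<lambda>\<omega>. \<lambda>s\<in>{1..<t}. ar1_path \<rho> (s + 2) \<omega>)
      (\<Pi>\<^sub>M s\<in>{t}. borel) (\<lambda>\<omega>. \<lambda>s\<in>{t}. sqrt (1 - \<rho>\<^sup>2) * \<omega> (s + 3))"
    unfolding null_law_def
  proof (rule indep_var_disjoint_coords[of "{1..t + 2}" "{t + 3}"])
    show "(\<lambda>\<omega>. \<lambda>s\<in>{1..<t}. ar1_path \<rho> (s + 2) \<omega>) \<in> measurable (iid_normal {1..t + 2}) (\<Pi>\<^sub>M s\<in>{1..<t}. borel)"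
      by (rule measurable_restrict) measurable
    show "(\<lambda>\<omega>. \<lambda>s\<in>{t}. sqrt (1 - \<rho>\<^sup>2) * \<omega> (s + 3)) \<in> measurable (iid_normal {t + 3}) (\<Pi>\<^sub>M s\<in>{t}. borel)"
      by (rule measurable_restrict) measurable
    show "(\<lambda>s\<in>{1..<t}. ar1_path \<rho> (s + 2) (restrict \<omega> {1..t + 2})) = (\<lambda>s\<in>{1..<t}. ar1_path \<rho> (s + 2) \<omega>)" for \<omega>
      by (intro restrict_ext ar1_path_restrict) auto
  qed auto
  show "ar1_path \<rho> (t + 2) \<omega> = \<rho> * ar1_path \<rho> (t - 1 + 2) \<omega> + sqrt (1 - \<rho>\<^sup>2) * \<omega> (t + 3)" for \<omega>
    using t by (cases t) (simp_all add: eval_nat_numeral)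
qed


section \<open>Expansion of the path in powers of \<rho>\<close>

definition ar1_coef :: "real \<Rightarrow> nat \<Rightarrow> real" where
  "ar1_coef \<rho> j = (if j < 3 then \<rho> ^ j * sqrt (1 - \<rho>\<^sup>2) else \<rho> ^ 3)"

text \<open>Powers of \<rho> and \<open>sqrt (1 - \<rho>^2)\<close> are kept in
  \<open>ar1_coef\<close>, so that every lag is standard normal. Lag 3 is the path three steps
  before \<open>ar1_path \<rho> (t + 2)\<close>; it exists already for \<open>t = 1\<close>.\<close>

definition ar1_lag :: "real \<Rightarrow> nat \<Rightarrow> nat \<Rightarrow> (nat \<Rightarrow> real) \<Rightarrow> real" where
  "ar1_lag \<rho> t j = (if j < 3 then (\<lambda>\<omega>. \<omega> (t + 3 - j)) else ar1_path \<rho> (t - 1))"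

lemma ar1_path_expansion:
  assumes "1 \<le> t"
  shows "ar1_path \<rho> (t + 2) \<omega> = (\<Sum>j\<le>3. ar1_coef \<rho> j * ar1_lag \<rho> t j \<omega>)"
  using assms by (cases t) (simp_all add: ar1_coef_def ar1_lag_def eval_nat_numeral algebra_simps)

lemma ar1_lag_measurable [measurable]:
  "ar1_lag \<rho> t j \<in> borel_measurable null_law" "ar1_lag \<rho> t j \<in> borel_measurable (iid_normal A)"
  unfolding ar1_lag_def by simp_all

lemma distributed_ar1_lag:
  assumes "\<bar>\<rho>\<bar> < 1"
  shows "distributed null_law lborel (ar1_lag \<rho> t j) std_normal_density"
  using assms by (auto simp: ar1_lag_def intro!: distributed_coord_null_law distributed_ar1_path)

lemma abs_ar1_coef_le:
  assumes "\<bar>\<rho>\<bar> < 1" "j \<le> 3"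
  shows "\<bar>ar1_coef \<rho> j\<bar> \<le> \<bar>\<rho>\<bar> ^ j"
proof (cases "j < 3")
  case True
  have "sqrt (1 - \<rho>\<^sup>2) \<le> 1" "0 \<le> sqrt (1 - \<rho>\<^sup>2)" using assms(1) by (auto simp: abs_square_le_1)
  then show ?thesis
    using True mult_left_mono[of "sqrt (1 - \<rho>\<^sup>2)" 1 "\<bar>\<rho>\<bar> ^ j"] by (simp add: ar1_coef_def abs_mult power_abs)
next
  case False
  then have "j = 3" using assms(2) by simp
  then show ?thesis by (simp add: ar1_coef_def power_abs)
qed

text \<open>Elements of \<open>quad\<close> serve both as index quadruples \<open>(a, b, c, d)\<close> of monomials and as quadruples of lags;
  lag \<open>3\<close> stands for the remainder \<open>\<rho>\<^sup>3 X\<^bsub>t-3\<^esub>\<close>.\<close>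

type_synonym quad = "nat \<times> nat \<times> nat \<times> nat"

definition lag_indices :: "quad set" where
  "lag_indices = {..3} \<times> {..3} \<times> {..3} \<times> {..3}"

fun lag_order :: "quad \<Rightarrow> nat" where
  "lag_order (j1, j2, j3, j4) = j1 + j2 + j3 + j4"

fun lag_coef :: "real \<Rightarrow> quad \<Rightarrow> real" where
  "lag_coef \<rho> (j1, j2, j3, j4) = ar1_coef \<rho> j1 * ar1_coef \<rho> j2 * ar1_coef \<rho> j3 * ar1_coef \<rho> j4"

fun lag_prod :: "real \<Rightarrow> nat \<Rightarrow> quad \<Rightarrow> quad \<Rightarrow> (nat \<Rightarrow> real) \<Rightarrow> real" where
  "lag_prod \<rho> i (a, b, c, d) (j1, j2, j3, j4) = (\<lambda>\<omega>. ar1_lag \<rho> (i + a - 1) j1 \<omega> * ar1_lag \<rho> (i + b - 1) j2 \<omega>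
     * ar1_lag \<rho> (i + c - 1) j3 \<omega> * ar1_lag \<rho> (i + d - 1) j4 \<omega>)"

text \<open>The mean of \<open>lag_prod\<close> for lag orders up to 2. At higher orders it is 0 by
  convention, not as an expectation; the true mean is then part of the error.\<close>

fun lag_mean :: "quad \<Rightarrow> quad \<Rightarrow> real" where
  "lag_mean (a, b, c, d) j = (if j = (0, 1, 0, 1) \<and> b = a + 1 \<and> d = c + 1 then 1 else 0)"

lemma finite_lag_indices [simp]: "finite lag_indices"
  by (simp add: lag_indices_def)

lemma lag_prod_measurable [measurable]: "lag_prod \<rho> i t j \<in> borel_measurable null_law"
  "lag_prod \<rho> i t j \<in> borel_measurable (iid_normal A)"
  by (cases t; cases j; simp)+

lemma lag_prod_L2:
  assumes "\<bar>\<rho>\<bar> < 1"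
  shows "integrable null_law (\<lambda>\<omega>. (lag_prod \<rho> i t j \<omega>)\<^sup>2)" "(\<integral>\<omega>. (lag_prod \<rho> i t j \<omega>)\<^sup>2 \<partial>null_law) \<le> 105"
    "integrable null_law (lag_prod \<rho> i t j)"
proof -
  obtain a b c d j1 j2 j3 j4 where eq: "t = (a, b, c, d)" "j = (j1, j2, j3, j4)"
    using prod_cases4[of t] prod_cases4[of j] by metis
  show L2: "integrable null_law (\<lambda>\<omega>. (lag_prod \<rho> i t j \<omega>)\<^sup>2)"
    unfolding eq lag_prod.simps by (intro std_normal_prod4 distributed_ar1_lag assms)
  show "(\<integral>\<omega>. (lag_prod \<rho> i t j \<omega>)\<^sup>2 \<partial>null_law) \<le> 105"
    unfolding eq lag_prod.simps by (intro std_normal_prod4 distributed_ar1_lag assms)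
  show "integrable null_law (lag_prod \<rho> i t j)"
    by (rule null.square_integrable_imp_integrable[OF _ L2]) simp
qed

lemma abs_lag_coef_le:
  assumes "\<bar>\<rho>\<bar> < 1" "j \<in> lag_indices"
  shows "\<bar>lag_coef \<rho> j\<bar> \<le> \<bar>\<rho>\<bar> ^ lag_order j"
proof -
  obtain j1 j2 j3 j4 where j: "j = (j1, j2, j3, j4)" by (cases j)
  then have "j1 \<le> 3" "j2 \<le> 3" "j3 \<le> 3" "j4 \<le> 3" using assms(2) by (auto simp: lag_indices_def)
  then show ?thesis
    unfolding j lag_coef.simps lag_order.simps abs_mult power_add
    by (intro mult_mono abs_ar1_coef_le assms(1) mult_nonneg_nonneg) auto
qed

text \<open>No lag can be 3 here, so each of the four factors carries
  \<open>sqrt (1 - \<rho>^2)\<close>.\<close>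

lemma lag_coef_low_order:
  assumes "\<bar>\<rho>\<bar> < 1" "lag_order j \<le> 2"
  shows "lag_coef \<rho> j = (1 - \<rho>\<^sup>2)\<^sup>2 * \<rho> ^ lag_order j"
proof -
  obtain j1 j2 j3 j4 where j: "j = (j1, j2, j3, j4)" by (cases j)
  have "0 \<le> 1 - \<rho>\<^sup>2" using assms(1) by (simp add: abs_square_le_1)
  then have "sqrt (1 - \<rho>\<^sup>2) * sqrt (1 - \<rho>\<^sup>2) * (sqrt (1 - \<rho>\<^sup>2) * sqrt (1 - \<rho>\<^sup>2)) = (1 - \<rho>\<^sup>2)\<^sup>2"
    by (simp add: power2_eq_square)
  then show ?thesis
    using assms(2) by (simp add: j ar1_coef_def power_add mult_ac)
qed

lemma quartic_ar1_path_expansion: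
  assumes Q: "Q \<subseteq> quads k" and "1 \<le> i"
  shows "quartic Q (block k (\<lambda>t. ar1_path \<rho> (t + 2)) i \<omega>)
    = (\<Sum>t\<in>Q. \<Sum>j\<in>lag_indices. lag_coef \<rho> j * lag_prod \<rho> i t j \<omega>)"
  unfolding quartic_coord_block[OF Q]
proof (intro sum.cong refl)
  fix t assume t: "t \<in> Q"
  obtain a b c d where abcd: "t = (a, b, c, d)" by (cases t)
  have "(a, b, c, d) \<in> quads k" using t Q abcd by blast
  then have ge: "1 \<le> i + a - 1" "1 \<le> i + b - 1" "1 \<le> i + c - 1" "1 \<le> i + d - 1"
    using assms(2) by (auto simp: quads_def)
  define x where "x e j = ar1_coef \<rho> j * ar1_lag \<rho> (i + e - 1) j \<omega>" for e j
  have "(case t of (a, b, c, d) \<Rightarrow> ar1_path \<rho> (i + a - 1 + 2) \<omega> * ar1_path \<rho> (i + b - 1 + 2) \<omega>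
      * ar1_path \<rho> (i + c - 1 + 2) \<omega> * ar1_path \<rho> (i + d - 1 + 2) \<omega>)
    = (\<Sum>j\<le>3. x a j) * ((\<Sum>j\<le>3. x b j) * ((\<Sum>j\<le>3. x c j) * (\<Sum>j\<le>3. x d j)))"
    unfolding abcd prod.case ge[THEN ar1_path_expansion] x_def by (simp only: mult.assoc)
  also have "\<dots> = (\<Sum>(j1, j2, j3, j4)\<in>lag_indices. x a j1 * (x b j2 * (x c j3 * x d j4)))"
    unfolding lag_indices_def sum_product sum.cartesian_product by (simp add: case_prod_unfold)
  also have "\<dots> = (\<Sum>j\<in>lag_indices. lag_coef \<rho> j * lag_prod \<rho> i t j \<omega>)"
    by (intro sum.cong refl) (auto simp: abcd x_def mult_ac)
  finally show "(case t of (a, b, c, d) \<Rightarrow> ar1_path \<rho> (i + a - 1 + 2) \<omega> * ar1_path \<rho> (i + b - 1 + 2) \<omega>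
      * ar1_path \<rho> (i + c - 1 + 2) \<omega> * ar1_path \<rho> (i + d - 1 + 2) \<omega>)
    = (\<Sum>j\<in>lag_indices. lag_coef \<rho> j * lag_prod \<rho> i t j \<omega>)" .
qed

text \<open>Letting two indices at distance \<open>\<delta>\<close> meet costs lag at least
  \<open>\<delta>\<close>, and the total budget is 2. The first and fourth are too far apart. If the
  first met the third, the budget would be spent and the second would stay isolated. So first meets
  second and third meets fourth; each meeting costs at least 1, hence exactly 1.\<close>

lemma low_order_pairing:
  fixes a b c d i :: nat
  assumes "a < b" "b < c" "c < d" "j1 + j2 + j3 + j4 \<le> 2"
    and "p + j1 = i + a" "q + j2 = i + b" "r + j3 = i + c" "s + j4 = i + d"
    and "p \<in> {q, r, s}" "q \<in> {p, r, s}" "r \<in> {p, q, s}" "s \<in> {p, q, r}"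
  shows "j1 = 0 \<and> j2 = 1 \<and> j3 = 0 \<and> j4 = 1 \<and> b = a + 1 \<and> d = c + 1"
proof -
  have "p \<noteq> s" using assms(1-8) by linarith
  moreover have "p \<noteq> r"
  proof
    assume "p = r"
    then have "j3 = 2" "j1 = 0" "j2 = 0" "j4 = 0" using assms(1-8) by linarith+
    with \<open>p = r\<close> show False using assms(1-8,10) by auto
  qed
  ultimately have "p = q" using assms(9) by simp
  moreover from this have "r = s" using assms(11) \<open>p \<noteq> r\<close> by simp
  ultimately show ?thesis using assms(1-8) by linarith
qed

text \<open>At these orders every lag is a plain coordinate. The mean is 0 if one of the four
  coordinates is isolated; otherwise the pairing is forced and two independent squares
  remain.\<close>

lemma expectation_lag_prod:
  assumes t: "t \<in> quads k" and i: "1 \<le> i" and j: "lag_order j \<le> 2"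
  shows "(\<integral>\<omega>. lag_prod \<rho> i t j \<omega> \<partial>null_law) = lag_mean t j"
proof -
  obtain a b c d j1 j2 j3 j4 where eq: "t = (a, b, c, d)" "j = (j1, j2, j3, j4)"
    using prod_cases4[of t] prod_cases4[of j] by metis
  have abcd: "1 \<le> a" "a < b" "b < c" "c < d" using t by (simp_all add: eq quads_def)
  have js: "j1 + j2 + j3 + j4 \<le> 2" using j by (simp add: eq)
  define p q r s where "p = i + a + 2 - j1" and "q = i + b + 2 - j2" and "r = i + c + 2 - j3" and "s = i + d + 2 - j4"
  have sums: "p + j1 = (i + 2) + a" "q + j2 = (i + 2) + b" "r + j3 = (i + 2) + c" "s + j4 = (i + 2) + d"
    using js by (auto simp: p_def q_def r_def s_def)
  have ge: "p \<in> {1..}" "q \<in> {1..}" "r \<in> {1..}" "s \<in> {1..}"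
    using js i abcd by (auto simp: p_def q_def r_def s_def)
  have prod: "lag_prod \<rho> i t j \<omega> = \<omega> p * \<omega> q * \<omega> r * \<omega> s" for \<omega>
    using js i abcd by (simp add: eq ar1_lag_def p_def q_def r_def s_def)
  show ?thesis
  proof (cases "p \<in> {q, r, s} \<and> q \<in> {p, r, s} \<and> r \<in> {p, q, s} \<and> s \<in> {p, q, r}")
    case True
    then have j: "j1 = 0" "j2 = 1" "j3 = 0" "j4 = 1" "b = a + 1" "d = c + 1"
      using low_order_pairing[OF abcd(2-4) js sums] by blast+
    then have "q = p" "s = r" "p \<noteq> r" using sums abcd by auto
    then have "(\<integral>\<omega>. lag_prod \<rho> i t j \<omega> \<partial>null_law) = 1"
      unfolding prod null_law_def using ge expectation_prod4_pairs[of p r "{1..}"] by simp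
    then show ?thesis using j by (simp add: eq)
  next
    case False
    then consider "p \<notin> {q, r, s}" | "q \<notin> {p, r, s}" | "r \<notin> {p, q, s}" | "s \<notin> {p, q, r}" by blast
    then have "(\<integral>\<omega>. \<omega> p * \<omega> q * \<omega> r * \<omega> s \<partial>iid_normal {1..}) = 0"
    proof cases
      case 1
      then show ?thesis using ge by (intro expectation_prod4_isolated) auto
    next
      case 2
      then have "(\<integral>\<omega>. \<omega> q * \<omega> p * \<omega> r * \<omega> s \<partial>iid_normal {1..}) = 0"
        using ge by (intro expectation_prod4_isolated) auto
      then show ?thesis by (simp add: mult_ac)
    next
      case 3
      then have "(\<integral>\<omega>. \<omega> r * \<omega> p * \<omega> q * \<omega> s \<partial>iid_normal {1..}) = 0"
        using ge by (intro expectation_prod4_isolated) auto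
      then show ?thesis by (simp add: mult_ac)
    next
      case 4
      then have "(\<integral>\<omega>. \<omega> s * \<omega> p * \<omega> q * \<omega> r \<partial>iid_normal {1..}) = 0"
        using ge by (intro expectation_prod4_isolated) auto
      then show ?thesis by (simp add: mult_ac)
    qed
    moreover have "lag_mean t j = 0"
    proof (rule ccontr)
      assume "lag_mean t j \<noteq> 0"
      then have "q = p" "s = r" using sums by (auto simp: eq split: if_splits)
      then show False using False by simp
    qed
    ultimately show ?thesis by (simp add: prod null_law_def)
  qed
qed

lemma lag_mean_high_order: "lag_order j \<noteq> 2 \<Longrightarrow> lag_mean t j = 0"
  by (cases t) auto

lemma lag_prod_term_bound:
  assumes \<rho>: "\<bar>\<rho>\<bar> < 1" and t: "t \<in> quads k" and i: "1 \<le> i" and j: "j \<in> lag_indices"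
  shows "\<bar>lag_coef \<rho> j * (\<integral>\<omega>. lag_prod \<rho> i t j \<omega> \<partial>null_law) - \<rho>\<^sup>2 * lag_mean t j\<bar> \<le> 11 * \<bar>\<rho>\<bar> ^ 3"
proof (cases "lag_order j \<le> 2")
  case True
  note e = expectation_lag_prod[OF t i True] lag_coef_low_order[OF \<rho> True]
  show ?thesis
  proof (cases "lag_order j = 2")
    case 2: True
    have r2: "\<rho>\<^sup>2 \<le> 1" using \<rho> by (simp add: abs_square_le_1)
    have m: "\<bar>lag_mean t j\<bar> \<le> 1" by (cases t) auto
    \<comment> \<open>The error is \<open>\<rho>^2 * ((1 - \<rho>^2)^2 - 1)\<close>, hence of fourth
      order; one factor \<rho> is given away to reach the common cubic bound.\<close>
    have "lag_coef \<rho> j * (\<integral>\<omega>. lag_prod \<rho> i t j \<omega> \<partial>null_law) - \<rho>\<^sup>2 * lag_mean t j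
        = \<rho> ^ 3 * (\<rho> * (\<rho>\<^sup>2 - 2)) * lag_mean t j"
      unfolding e 2 by (simp add: power2_eq_square power3_eq_cube algebra_simps)
    then have "\<bar>lag_coef \<rho> j * (\<integral>\<omega>. lag_prod \<rho> i t j \<omega> \<partial>null_law) - \<rho>\<^sup>2 * lag_mean t j\<bar>
        = \<bar>\<rho>\<bar> ^ 3 * (\<bar>\<rho>\<bar> * \<bar>\<rho>\<^sup>2 - 2\<bar>) * \<bar>lag_mean t j\<bar>"
      by (simp add: abs_mult power_abs)
    also have "\<dots> \<le> \<bar>\<rho>\<bar> ^ 3 * (1 * 2) * 1"
      using \<rho> r2 m by (intro mult_mono) (auto simp: abs_if)
    finally show ?thesis using zero_le_power[of "\<bar>\<rho>\<bar>" 3] by linarith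
  qed (simp add: e lag_mean_high_order)
next
  case False
  have "\<bar>\<integral>\<omega>. lag_prod \<rho> i t j \<omega> \<partial>null_law\<bar> \<le> (\<integral>\<omega>. \<bar>lag_prod \<rho> i t j \<omega>\<bar> \<partial>null_law)"
    by (rule integral_abs_bound)
  also have "\<dots> \<le> sqrt (\<integral>\<omega>. (lag_prod \<rho> i t j \<omega>)\<^sup>2 \<partial>null_law)"
    by (intro null.expectation_abs_le_L2 lag_prod_L2 \<rho>) simp
  \<comment> \<open>The constant 11 is an integer whose square exceeds the eighth moment
    105.\<close>
  also have "\<dots> \<le> sqrt (11\<^sup>2)"
    using lag_prod_L2(2)[OF \<rho>, of i t j] by (intro real_sqrt_le_mono) simp
  finally have E: "\<bar>\<integral>\<omega>. lag_prod \<rho> i t j \<omega> \<partial>null_law\<bar> \<le> 11" by simp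
  have "\<bar>lag_coef \<rho> j\<bar> \<le> \<bar>\<rho>\<bar> ^ lag_order j" by (rule abs_lag_coef_le[OF \<rho> j])
  also have "\<dots> \<le> \<bar>\<rho>\<bar> ^ 3" using \<rho> False by (intro power_decreasing) auto
  finally have "\<bar>lag_coef \<rho> j\<bar> * \<bar>\<integral>\<omega>. lag_prod \<rho> i t j \<omega> \<partial>null_law\<bar> \<le> \<bar>\<rho>\<bar> ^ 3 * 11"
    using E by (intro mult_mono) auto
  then show ?thesis using False by (simp add: lag_mean_high_order abs_mult mult.commute)
qed

definition adjacent_pairs :: "quad set \<Rightarrow> quad set" where
  "adjacent_pairs Q = {(a, b, c, d) \<in> Q. b = a + 1 \<and> d = c + 1}"

lemma sum_lag_mean:
  assumes "finite Q"
  shows "(\<Sum>t\<in>Q. \<Sum>j\<in>lag_indices. lag_mean t j) = real (card (adjacent_pairs Q))"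
proof -
  have "(\<Sum>j\<in>lag_indices. lag_mean t j) = (if t \<in> adjacent_pairs UNIV then 1 else 0)" for t
  proof -
    obtain a b c d where t: "t = (a, b, c, d)" by (cases t)
    have "(\<Sum>j\<in>lag_indices. lag_mean t j) = (\<Sum>j\<in>lag_indices. if j = (0, 1, 0, 1) then (if t \<in> adjacent_pairs UNIV then 1 else 0) else 0)"
      by (intro sum.cong) (auto simp: t adjacent_pairs_def)
    then show ?thesis by (simp add: lag_indices_def)
  qed
  then have "(\<Sum>t\<in>Q. \<Sum>j\<in>lag_indices. lag_mean t j) = (\<Sum>t\<in>Q. if t \<in> adjacent_pairs UNIV then 1 else 0)"
    by simp
  also have "\<dots> = real (card (Q \<inter> adjacent_pairs UNIV))"
    using assms by (simp add: sum.If_cases Int_def)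
  also have "Q \<inter> adjacent_pairs UNIV = adjacent_pairs Q" by (auto simp: adjacent_pairs_def)
  finally show ?thesis .
qed

lemma block_mean_quartic_bound:
  assumes X: "gaussian_ar1 M \<rho> X" and \<rho>: "\<bar>\<rho>\<bar> < 1" and Q: "Q \<subseteq> quads k"
  shows "\<bar>block_mean M X k (quartic Q) - real (card (adjacent_pairs Q)) * \<rho>\<^sup>2\<bar>
    \<le> 11 * real (card Q * card lag_indices) * \<bar>\<rho>\<bar> ^ 3"
proof -
  let ?Y = "\<lambda>t. ar1_path \<rho> (t + 2)"
  let ?E = "\<lambda>t j. \<integral>\<omega>. lag_prod \<rho> 1 t j \<omega> \<partial>null_law"
  have fin: "finite Q" using Q finite_quads by (rule finite_subset)
  have qm: "quartic Q \<in> borel_measurable (std_normal_power k)"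
    using quartic_mean_zero_L2[OF Q] unfolding mean_zero_L2_def by blast
  define H where "H y = quartic Q (coord_block k 1 y)" for y
  \<comment> \<open>A window one step longer than the block, so that the condition
    \<open>2 \<le> t\<close> on its end holds for every \<open>k\<close>.\<close>
  have Hm: "H \<in> borel_measurable (iid_normal {1..<k + 2})"
    unfolding H_def by (rule measurable_compose[OF _ qm]) measurable
  have Hr: "H (restrict x {1..<k + 2}) = H x" for x
    unfolding H_def by (subst coord_block_restrict) auto
  note law = gaussian_ar1_distr_eq[OF X gaussian_ar1_ar1_path[OF \<rho>] _ Hm Hr]
    gaussian_ar1_distr_eq(2)[OF gaussian_ar1_ar1_path[OF \<rho>] X _ Hm Hr]
  have "block_mean M X k (quartic Q) = (\<integral>x. x \<partial>distr M borel (\<lambda>\<omega>. H (\<lambda>s. X s \<omega>)))"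
    using law(2) by (subst integral_distr) (simp_all add: block_mean_def H_def block_def)
  also have "\<dots> = (\<integral>\<omega>. quartic Q (block k ?Y 1 \<omega>) \<partial>null_law)"
    using law(1,3) by (simp only:) (subst integral_distr, simp_all add: H_def block_def)
  also have "\<dots> = (\<Sum>t\<in>Q. \<Sum>j\<in>lag_indices. lag_coef \<rho> j * ?E t j)"
    unfolding quartic_ar1_path_expansion[OF Q order_refl]
    using lag_prod_L2(3)[OF \<rho>] by simp
  finally have "block_mean M X k (quartic Q) - real (card (adjacent_pairs Q)) * \<rho>\<^sup>2
      = (\<Sum>t\<in>Q. \<Sum>j\<in>lag_indices. lag_coef \<rho> j * ?E t j - \<rho>\<^sup>2 * lag_mean t j)"
    unfolding sum_lag_mean[OF fin, symmetric]
    by (simp add: sum_subtractf sum_distrib_left sum_distrib_right mult.commute)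
  also have "\<bar>\<dots>\<bar> \<le> (\<Sum>t\<in>Q. \<bar>\<Sum>j\<in>lag_indices. lag_coef \<rho> j * ?E t j - \<rho>\<^sup>2 * lag_mean t j\<bar>)"
    by (rule sum_abs)
  also have "\<dots> \<le> (\<Sum>t\<in>Q. \<Sum>j\<in>lag_indices. 11 * \<bar>\<rho>\<bar> ^ 3)"
    using Q by (intro sum_mono order_trans[OF sum_abs] lag_prod_term_bound[OF \<rho>]) auto
  also have "\<dots> = 11 * real (card Q * card lag_indices) * \<bar>\<rho>\<bar> ^ 3" by simp
  finally show ?thesis .
qed

section \<open>The second-order scaling\<close>

text \<open>Order at most 2 excludes lag 3, the only one that reads the whole past. With lags 0 to 2
  the coordinates read run from \<open>i + 1\<close> to \<open>i + k + 2\<close>, a range of length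
  \<open>k + 2\<close>.\<close>

lemma lag_prod_restrict:
  assumes t: "t \<in> quads k" and i: "1 \<le> i" and j: "lag_order j \<le> 2" and A: "{i + 1..i + k + 2} \<subseteq> A"
  shows "lag_prod \<rho> i t j (restrict \<omega> A) = lag_prod \<rho> i t j \<omega>"
proof -
  obtain a b c d j1 j2 j3 j4 where eq: "t = (a, b, c, d)" "j = (j1, j2, j3, j4)"
    using prod_cases4[of t] prod_cases4[of j] by metis
  have le: "a \<in> {1..k}" "b \<in> {1..k}" "c \<in> {1..k}" "d \<in> {1..k}" using t by (auto simp: eq quads_def)
  have js: "j1 \<le> 2" "j2 \<le> 2" "j3 \<le> 2" "j4 \<le> 2" using j by (auto simp: eq)
  have "ar1_lag \<rho> (i + e - 1) l (restrict \<omega> A) = ar1_lag \<rho> (i + e - 1) l \<omega>" if "e \<in> {1..k}" "l \<le> 2" for e l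
  proof -
    have "i + e - 1 + 3 - l \<in> A" using that i by (intro subsetD[OF A]) auto
    then show ?thesis using that by (simp add: ar1_lag_def)
  qed
  then show ?thesis using le js by (simp add: eq)
qed

text \<open>\<open>quadratic_mean_bound\<close> with range \<open>k + 2\<close> and second moments
  at most 105, whence \<open>210 = 2 * 105\<close>. The growth is linear in \<open>N\<close>
  although summands may be strongly dependent at short distances.\<close>

lemma lag_prod_centered_L2:
  assumes \<rho>: "\<bar>\<rho>\<bar> < 1" and t: "t \<in> quads k" and j: "lag_order j \<le> 2"
  shows "integrable null_law (\<lambda>\<omega>. (\<Sum>i=1..N. lag_prod \<rho> i t j \<omega> - lag_mean t j)\<^sup>2)"
    and "(\<integral>\<omega>. (\<Sum>i=1..N. lag_prod \<rho> i t j \<omega> - lag_mean t j)\<^sup>2 \<partial>null_law) \<le> 210 * real (k + 2) * real N"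
proof -
  let ?U = "\<lambda>i \<omega>. lag_prod \<rho> i t j \<omega> - lag_mean t j"
  have U2: "integrable null_law (\<lambda>\<omega>. (?U i \<omega>)\<^sup>2)" "(\<integral>\<omega>. (?U i \<omega>)\<^sup>2 \<partial>null_law) \<le> 105" if "1 \<le> i" for i
  proof -
    note L = lag_prod_L2[OF \<rho>, of i t j]
    show "integrable null_law (\<lambda>\<omega>. (?U i \<omega>)\<^sup>2)" using L by (simp add: power2_diff)
    have "(\<integral>\<omega>. (?U i \<omega>)\<^sup>2 \<partial>null_law) = (\<integral>\<omega>. (lag_prod \<rho> i t j \<omega>)\<^sup>2 \<partial>null_law) - (lag_mean t j)\<^sup>2"
      using null.variance_eq[OF L(3,1)] by (simp add: expectation_lag_prod[OF t that j])
    also have "\<dots> \<le> 105" using L(2) zero_le_power2[of "lag_mean t j"] by linarith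
    finally show "(\<integral>\<omega>. (?U i \<omega>)\<^sup>2 \<partial>null_law) \<le> 105" .
  qed
  have U0: "(\<integral>\<omega>. ?U i \<omega> \<partial>null_law) = 0" if "1 \<le> i" for i
    using lag_prod_L2(3)[OF \<rho>, of i t j] by (simp add: expectation_lag_prod[OF t that j] null.prob_space)
  have U1: "integrable null_law (?U i)" for i
    using lag_prod_L2(3)[OF \<rho>, of i t j] by simp
  show "integrable null_law (\<lambda>\<omega>. (\<Sum>i=1..N. ?U i \<omega>)\<^sup>2)"
    by (intro L2_sum(1) U2) auto
  have "(\<integral>\<omega>. ?U i \<omega> * ?U l \<omega> \<partial>null_law) = 0" if il: "1 \<le> i" "i + (k + 2) \<le> l" for i l
  proof -
    have "(\<integral>\<omega>. ?U i \<omega> * ?U l \<omega> \<partial>null_law) = (\<integral>\<omega>. ?U i \<omega> \<partial>null_law) * (\<integral>\<omega>. ?U l \<omega> \<partial>null_law)"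
      unfolding null_law_def
    proof (rule expectation_mult_disjoint_coords(1)[of "{i + 1..i + k + 2}" "{l + 1..l + k + 2}"])
      show "?U i (restrict \<omega> {i + 1..i + k + 2}) = ?U i \<omega>" for \<omega>
        using il by (subst lag_prod_restrict[OF t _ j]) auto
      show "?U l (restrict \<omega> {l + 1..l + k + 2}) = ?U l \<omega>" for \<omega>
        using il by (subst lag_prod_restrict[OF t _ j]) auto
    qed (use il U1[unfolded null_law_def] in auto)
    then show ?thesis using U0[OF il(1)] by simp
  qed
  then have "(\<integral>\<omega>. (\<Sum>i=1..N. ?U i \<omega>)\<^sup>2 \<partial>null_law) \<le> 2 * real (k + 2) * 105 * real (card {1..N})"
    by (intro quadratic_mean_bound) (auto intro: U2)
  then show "(\<integral>\<omega>. (\<Sum>i=1..N. ?U i \<omega>)\<^sup>2 \<partial>null_law) \<le> 210 * real (k + 2) * real N" by simp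
qed

text \<open>Under the scaling \<open>\<rho>\<^sup>2 \<sim> C / \<surd>N\<close>, a lag monomial of order \<open>0\<close> keeps its fluctuations,
  one of order \<open>2\<close> contributes only its mean, and all others vanish.\<close>

definition lag_limit :: "real \<Rightarrow> real \<Rightarrow> nat \<Rightarrow> quad \<Rightarrow> quad \<Rightarrow> (nat \<Rightarrow> real) \<Rightarrow> real" where
  "lag_limit C \<rho> N t j \<omega> =
     (if lag_order j = 0 then (\<Sum>i=1..N. lag_prod \<rho> i t j \<omega>) / sqrt (real N) else C * lag_mean t j)"

definition lag_error :: "real \<Rightarrow> real \<Rightarrow> nat \<Rightarrow> quad \<Rightarrow> quad \<Rightarrow> (nat \<Rightarrow> real) \<Rightarrow> real" where
  "lag_error C \<rho> N t j \<omega> =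
     lag_coef \<rho> j * ((\<Sum>i=1..N. lag_prod \<rho> i t j \<omega>) / sqrt (real N)) - lag_limit C \<rho> N t j \<omega>"

text \<open>The three summands cover the lag orders \<open>0\<close>, \<open>1\<close> and \<open>2\<close>, and \<open>\<ge> 3\<close>; \<open>x\<close> is \<open>\<surd>N \<rho>\<^sup>2\<close>,
  and \<open>105\<close> is the eighth moment of \<open>N(0,1)\<close>.\<close>

definition lag_error_bound :: "nat \<Rightarrow> real \<Rightarrow> real \<Rightarrow> real \<Rightarrow> real" where
  "lag_error_bound k C \<rho> x = 210 * real (k + 2) * ((1 - \<rho>\<^sup>2)\<^sup>2 - 1)\<^sup>2 +
     (420 * real (k + 2) * \<rho>\<^sup>2 + 2 * ((1 - \<rho>\<^sup>2)\<^sup>2 * x - C)\<^sup>2) + 105 * (x\<^sup>2 * \<rho>\<^sup>2)"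

lemma lag_error_measurable [measurable]: "lag_error C \<rho> N t j \<in> borel_measurable null_law"
  unfolding lag_error_def lag_limit_def by measurable

text \<open>Order 0: a sum of bounded normalized variance with coefficient
  \<open>(1 - \<rho>^2)^2 - 1\<close>. Orders 1 and 2: bounded normalized variance times at most
  \<open>\<rho>^2\<close>, plus the squared error of the mean. From order 3 on, long-range
  dependence through the remainder is possible, so the second moment of the sum is bounded by
  \<open>105 * N^2\<close>; after division by \<open>N\<close> the squared coefficient, at most
  \<open>\<rho> ^ 6\<close>, compensates.\<close>

lemma lag_error_L2:
  assumes \<rho>: "\<bar>\<rho>\<bar> < 1" and t: "t \<in> quads k" and j: "j \<in> lag_indices" and N: "0 < N"
  shows "integrable null_law (\<lambda>\<omega>. (lag_error C \<rho> N t j \<omega>)\<^sup>2)"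
    and "(\<integral>\<omega>. (lag_error C \<rho> N t j \<omega>)\<^sup>2 \<partial>null_law) \<le> lag_error_bound k C \<rho> (sqrt (real N) * \<rho>\<^sup>2)"
proof -
  let ?S = "\<lambda>\<omega>. \<Sum>i=1..N. lag_prod \<rho> i t j \<omega>"
  let ?R = "\<lambda>\<omega>. \<Sum>i=1..N. lag_prod \<rho> i t j \<omega> - lag_mean t j"
  have sqN: "(sqrt (real N))\<^sup>2 = real N" by simp
  have S: "?S \<omega> = ?R \<omega> + real N * lag_mean t j" for \<omega>
  proof -
    have "?R \<omega> = ?S \<omega> - real N * lag_mean t j" by (simp add: sum_subtractf)
    then show ?thesis by linarith
  qed
  have parts: "0 \<le> 210 * real (k + 2) * ((1 - \<rho>\<^sup>2)\<^sup>2 - 1)\<^sup>2" "0 \<le> 420 * real (k + 2) * \<rho>\<^sup>2"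
    "0 \<le> 2 * ((1 - \<rho>\<^sup>2)\<^sup>2 * (sqrt (real N) * \<rho>\<^sup>2) - C)\<^sup>2" "0 \<le> 105 * ((sqrt (real N) * \<rho>\<^sup>2)\<^sup>2 * \<rho>\<^sup>2)"
    by auto
  consider "lag_order j = 0" | "lag_order j \<in> {1, 2}" | "3 \<le> lag_order j" by fastforce
  then have "integrable null_law (\<lambda>\<omega>. (lag_error C \<rho> N t j \<omega>)\<^sup>2) \<and>
    (\<integral>\<omega>. (lag_error C \<rho> N t j \<omega>)\<^sup>2 \<partial>null_law) \<le> lag_error_bound k C \<rho> (sqrt (real N) * \<rho>\<^sup>2)"
  proof cases
    case 1
    then have le: "lag_order j \<le> 2" by simp
    have m: "lag_mean t j = 0" using 1 by (simp add: lag_mean_high_order)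
    note L = lag_prod_centered_L2[OF \<rho> t le, of N]
    have "lag_error C \<rho> N t j \<omega> = ((1 - \<rho>\<^sup>2)\<^sup>2 - 1) / sqrt (real N) * ?R \<omega>" for \<omega>
      unfolding lag_error_def lag_limit_def S m lag_coef_low_order[OF \<rho> le] using 1 by (simp add: algebra_simps diff_divide_distrib)
    then have eq: "(lag_error C \<rho> N t j \<omega>)\<^sup>2 = ((1 - \<rho>\<^sup>2)\<^sup>2 - 1)\<^sup>2 / real N * (?R \<omega>)\<^sup>2" for \<omega>
      by (simp only: power_mult_distrib power_divide sqN)
    have "((1 - \<rho>\<^sup>2)\<^sup>2 - 1)\<^sup>2 / real N * (\<integral>\<omega>. (?R \<omega>)\<^sup>2 \<partial>null_law) \<le> ((1 - \<rho>\<^sup>2)\<^sup>2 - 1)\<^sup>2 / real N * (210 * real (k + 2) * real N)"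
      by (intro mult_left_mono L) auto
    also have "\<dots> = 210 * real (k + 2) * ((1 - \<rho>\<^sup>2)\<^sup>2 - 1)\<^sup>2" using N by simp
    finally have "((1 - \<rho>\<^sup>2)\<^sup>2 - 1)\<^sup>2 / real N * (\<integral>\<omega>. (?R \<omega>)\<^sup>2 \<partial>null_law) \<le> lag_error_bound k C \<rho> (sqrt (real N) * \<rho>\<^sup>2)"
      using parts unfolding lag_error_bound_def by linarith
    then show ?thesis unfolding eq using L(1) by simp
  next
    case 2
    then have le: "lag_order j \<le> 2" by auto
    note L = lag_prod_centered_L2[OF \<rho> t le, of N]
    have c: "(lag_coef \<rho> j)\<^sup>2 \<le> \<rho>\<^sup>2"
    proof -
      have "\<bar>lag_coef \<rho> j\<bar> \<le> \<bar>\<rho>\<bar> ^ lag_order j" by (rule abs_lag_coef_le[OF \<rho> j])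
      also have "\<dots> \<le> \<bar>\<rho>\<bar> ^ 1" using \<rho> 2 by (intro power_decreasing) auto
      finally show ?thesis by (simp add: abs_le_square_iff)
    qed
    \<comment> \<open>At order 1 both sides vanish with \<open>lag_mean\<close>; at order 2 the
      coefficient is explicit.\<close>
    have bias: "(sqrt (real N) * lag_coef \<rho> j - C) * lag_mean t j
        = ((1 - \<rho>\<^sup>2)\<^sup>2 * (sqrt (real N) * \<rho>\<^sup>2) - C) * lag_mean t j"
      using 2 by (auto simp: lag_mean_high_order lag_coef_low_order[OF \<rho> le])
    have m: "(lag_mean t j)\<^sup>2 \<le> 1" by (cases t) auto
    have rt: "real N * x / sqrt (real N) = sqrt (real N) * x" for x
      using real_div_sqrt[of "real N"] by (simp flip: times_divide_eq_left)
    have "lag_error C \<rho> N t j \<omega> = lag_coef \<rho> j / sqrt (real N) * ?R \<omega> + (sqrt (real N) * lag_coef \<rho> j - C) * lag_mean t j" for \<omega>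
      unfolding lag_error_def lag_limit_def S using 2
      by (auto simp: algebra_simps add_divide_distrib rt)
    then have "(lag_error C \<rho> N t j \<omega>)\<^sup>2 \<le> 2 * ((lag_coef \<rho> j / sqrt (real N) * ?R \<omega>)\<^sup>2
        + (((1 - \<rho>\<^sup>2)\<^sup>2 * (sqrt (real N) * \<rho>\<^sup>2) - C) * lag_mean t j)\<^sup>2)" for \<omega>
      unfolding bias by (simp only: square_add_le)
    then have b: "(lag_error C \<rho> N t j \<omega>)\<^sup>2 \<le> 2 * ((lag_coef \<rho> j)\<^sup>2 / real N * (?R \<omega>)\<^sup>2
        + ((1 - \<rho>\<^sup>2)\<^sup>2 * (sqrt (real N) * \<rho>\<^sup>2) - C)\<^sup>2 * (lag_mean t j)\<^sup>2)" for \<omega>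
      by (simp only: power_mult_distrib power_divide sqN)
    have int: "integrable null_law (\<lambda>\<omega>. 2 * ((lag_coef \<rho> j)\<^sup>2 / real N * (?R \<omega>)\<^sup>2
        + ((1 - \<rho>\<^sup>2)\<^sup>2 * (sqrt (real N) * \<rho>\<^sup>2) - C)\<^sup>2 * (lag_mean t j)\<^sup>2))"
      by (intro integrable_mult_right Bochner_Integration.integrable_add) (use L(1) in simp_all)
    have i: "integrable null_law (\<lambda>\<omega>. (lag_error C \<rho> N t j \<omega>)\<^sup>2)"
      by (rule Bochner_Integration.integrable_bound[OF int])
         (use order_trans[OF b abs_ge_self] in \<open>auto\<close>)
    have "(\<integral>\<omega>. (lag_error C \<rho> N t j \<omega>)\<^sup>2 \<partial>null_law) \<le> (\<integral>\<omega>. 2 * ((lag_coef \<rho> j)\<^sup>2 / real N * (?R \<omega>)\<^sup>2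
        + ((1 - \<rho>\<^sup>2)\<^sup>2 * (sqrt (real N) * \<rho>\<^sup>2) - C)\<^sup>2 * (lag_mean t j)\<^sup>2) \<partial>null_law)"
      by (intro integral_mono i int b)
    also have "\<dots> = 2 * ((lag_coef \<rho> j)\<^sup>2 / real N * (\<integral>\<omega>. (?R \<omega>)\<^sup>2 \<partial>null_law)
        + ((1 - \<rho>\<^sup>2)\<^sup>2 * (sqrt (real N) * \<rho>\<^sup>2) - C)\<^sup>2 * (lag_mean t j)\<^sup>2)"
      using L(1) by (simp add: null.prob_space)
    also have "\<dots> \<le> 2 * (\<rho>\<^sup>2 / real N * (210 * real (k + 2) * real N)
        + ((1 - \<rho>\<^sup>2)\<^sup>2 * (sqrt (real N) * \<rho>\<^sup>2) - C)\<^sup>2 * 1)"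
      using c m L(2) by (intro mult_left_mono add_mono mult_mono divide_right_mono) auto
    also have "\<dots> = 420 * real (k + 2) * \<rho>\<^sup>2 + 2 * ((1 - \<rho>\<^sup>2)\<^sup>2 * (sqrt (real N) * \<rho>\<^sup>2) - C)\<^sup>2"
      using N by simp
    also have "\<dots> \<le> lag_error_bound k C \<rho> (sqrt (real N) * \<rho>\<^sup>2)"
      using parts unfolding lag_error_bound_def by linarith
    finally show ?thesis using i by blast
  next
    case 3
    have m: "lag_mean t j = 0" using 3 by (simp add: lag_mean_high_order)
    have c: "(lag_coef \<rho> j)\<^sup>2 \<le> (\<rho> ^ 3)\<^sup>2"
    proof -
      have "\<bar>lag_coef \<rho> j\<bar> \<le> \<bar>\<rho>\<bar> ^ lag_order j" by (rule abs_lag_coef_le[OF \<rho> j])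
      also have "\<dots> \<le> \<bar>\<rho>\<bar> ^ 3" using \<rho> 3 by (intro power_decreasing) auto
      finally show ?thesis by (simp only: abs_le_square_iff flip: power_abs)
    qed
    have L: "integrable null_law (\<lambda>\<omega>. (?S \<omega>)\<^sup>2)" "(\<integral>\<omega>. (?S \<omega>)\<^sup>2 \<partial>null_law) \<le> real N * (real N * 105)"
    proof -
      show "integrable null_law (\<lambda>\<omega>. (?S \<omega>)\<^sup>2)" by (intro L2_sum(1) lag_prod_L2 \<rho>) auto
      have "(\<integral>\<omega>. (?S \<omega>)\<^sup>2 \<partial>null_law) \<le> real (card {1..N}) * (\<Sum>i=1..N. \<integral>\<omega>. (lag_prod \<rho> i t j \<omega>)\<^sup>2 \<partial>null_law)"
        by (intro L2_sum(2) lag_prod_L2 \<rho>) auto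
      also have "\<dots> \<le> real (card {1..N}) * (\<Sum>i=1..N. 105)"
        by (intro mult_left_mono sum_mono lag_prod_L2 \<rho>) auto
      finally show "(\<integral>\<omega>. (?S \<omega>)\<^sup>2 \<partial>null_law) \<le> real N * (real N * 105)" by simp
    qed
    have "lag_error C \<rho> N t j \<omega> = lag_coef \<rho> j / sqrt (real N) * ?S \<omega>" for \<omega>
      unfolding lag_error_def lag_limit_def m using 3 by simp
    then have eq: "(lag_error C \<rho> N t j \<omega>)\<^sup>2 = (lag_coef \<rho> j)\<^sup>2 / real N * (?S \<omega>)\<^sup>2" for \<omega>
      by (simp only: power_mult_distrib power_divide sqN)
    have "(lag_coef \<rho> j)\<^sup>2 / real N * (\<integral>\<omega>. (?S \<omega>)\<^sup>2 \<partial>null_law) \<le> (\<rho> ^ 3)\<^sup>2 / real N * (real N * (real N * 105))"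
      using c L(2) by (intro mult_mono divide_right_mono) auto
    also have "\<dots> = 105 * ((sqrt (real N) * \<rho>\<^sup>2)\<^sup>2 * \<rho>\<^sup>2)"
      using N by (simp add: power_mult_distrib flip: power_mult power_add)
    finally have "(lag_coef \<rho> j)\<^sup>2 / real N * (\<integral>\<omega>. (?S \<omega>)\<^sup>2 \<partial>null_law) \<le> lag_error_bound k C \<rho> (sqrt (real N) * \<rho>\<^sup>2)"
      using parts unfolding lag_error_bound_def by linarith
    then show ?thesis unfolding eq using L(1) by simp
  qed
  then show "integrable null_law (\<lambda>\<omega>. (lag_error C \<rho> N t j \<omega>)\<^sup>2)"
    and "(\<integral>\<omega>. (lag_error C \<rho> N t j \<omega>)\<^sup>2 \<partial>null_law) \<le> lag_error_bound k C \<rho> (sqrt (real N) * \<rho>\<^sup>2)" by blast+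
qed

lemma lag_error_bound_tendsto:
  assumes "\<rho> \<longlonglongrightarrow> 0" "x \<longlonglongrightarrow> C"
  shows "(\<lambda>n. lag_error_bound k C (\<rho> n) (x n)) \<longlonglongrightarrow> 0"
proof -
  have "(\<lambda>n. lag_error_bound k C (\<rho> n) (x n)) \<longlonglongrightarrow> 210 * real (k + 2) * ((1 - 0\<^sup>2)\<^sup>2 - 1)\<^sup>2 +
     (420 * real (k + 2) * 0\<^sup>2 + 2 * ((1 - 0\<^sup>2)\<^sup>2 * C - C)\<^sup>2) + 105 * (C\<^sup>2 * 0\<^sup>2)"
    unfolding lag_error_bound_def by (intro tendsto_intros assms)
  then show ?thesis by simp
qed

section \<open>Passage to the limit in law\<close>

lemma char_distr_shift:
  assumes "U \<in> borel_measurable M"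
  shows "char (distr M borel (\<lambda>x. U x + b)) t = iexp (t * b) * char (distr M borel U) t"
proof -
  have "iexp (t * (U x + b)) = iexp (t * b) * iexp (t * U x)" for x
    by (simp add: algebra_simps flip: exp_add)
  then show ?thesis using assms by (simp add: char_distr)
qed

lemma char_normal_density:
  "char (density lborel (normal_density m 1)) t = iexp (t * m) * exp (- (t\<^sup>2) / 2)"
proof -
  interpret N: prob_space std_normal_distribution by (rule prob_space_normal_density) simp
  have "distributed std_normal_distribution lborel (\<lambda>x. x) std_normal_density"
    unfolding distributed_def by (auto simp: distr_id2)
  from N.normal_density_affine[OF this, of 1 m]
  have "distributed std_normal_distribution lborel (\<lambda>x. x + m) (normal_density m 1)"
    by (simp add: add.commute)
  then have "density lborel (normal_density m 1) = distr std_normal_distribution borel (\<lambda>x. x + m)"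
    by (auto simp: distributed_def cong: distr_cong)
  moreover have "distr std_normal_distribution borel (\<lambda>x. x) = std_normal_distribution"
    by (rule distr_id2) simp
  ultimately show ?thesis
    by (simp add: char_distr_shift char_std_normal_distribution)
qed

text \<open>The normalized sum minus the shifted null statistic is exactly a finite sum of
  \<open>lag_error\<close> terms, whose number does not grow with \<open>n\<close>. Each tends to 0
  in L2, so the characteristic functions merge.\<close>

lemma normalized_sum_ar1_path_char:
  assumes Q: "Q \<subseteq> quads k" "Q \<noteq> {}"
    and \<rho>: "\<rho> \<longlonglongrightarrow> 0" and N: "filterlim N sequentially sequentially"
    and scale: "(\<lambda>n. sqrt (real (N n)) * (\<rho> n)\<^sup>2) \<longlonglongrightarrow> C"
  shows "(\<lambda>n. char (distr null_law borel (\<lambda>\<omega>. (\<Sum>i=1..N n. quartic Q (block k (\<lambda>s. ar1_path (\<rho> n) (s + 2)) i \<omega>)) / sqrt (real (N n)))) t)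
    \<longlonglongrightarrow> iexp (t * (C * real (card (adjacent_pairs Q)))) * exp (- (t\<^sup>2 * (null_sd k (quartic Q))\<^sup>2) / 2)"
proof -
  let ?b = "C * real (card (adjacent_pairs Q))"
  define V where "V n \<omega> = (\<Sum>i=1..N n. quartic Q (block k (\<lambda>s. ar1_path (\<rho> n) (s + 2)) i \<omega>)) / sqrt (real (N n))" for n \<omega>
  \<comment> \<open>Lag 0 at time \<open>i\<close> is coordinate \<open>i + 3\<close>, so the null
    blocks start at 4.\<close>
  define S where "S N \<omega> = (\<Sum>i<N. quartic Q (coord_block k (4 + i) \<omega>)) / sqrt (real N)" for N \<omega>
  have fin: "finite Q" using Q(1) finite_quads by (rule finite_subset)
  have [measurable]: "quartic Q \<in> borel_measurable (std_normal_power k)"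
    using quartic_mean_zero_L2[OF Q(1)] unfolding mean_zero_L2_def by blast
  have [measurable]: "V n \<in> borel_measurable null_law" "S N \<in> borel_measurable null_law" for n N
    unfolding V_def S_def by measurable
  have decomp: "V n \<omega> - (S (N n) \<omega> + ?b) = (\<Sum>x\<in>Q \<times> lag_indices. lag_error C (\<rho> n) (N n) (fst x) (snd x) \<omega>)" for n \<omega>
  proof -
    have "V n \<omega> = (\<Sum>i=1..N n. \<Sum>t\<in>Q. \<Sum>j\<in>lag_indices. lag_coef (\<rho> n) j * lag_prod (\<rho> n) i t j \<omega>) / sqrt (real (N n))"
      unfolding V_def by (intro arg_cong2[of _ _ _ _ "(/)"] sum.cong refl quartic_ar1_path_expansion Q) auto
    also have "(\<Sum>i=1..N n. \<Sum>t\<in>Q. \<Sum>j\<in>lag_indices. lag_coef (\<rho> n) j * lag_prod (\<rho> n) i t j \<omega>)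
        = (\<Sum>t\<in>Q. \<Sum>j\<in>lag_indices. lag_coef (\<rho> n) j * (\<Sum>i=1..N n. lag_prod (\<rho> n) i t j \<omega>))"
      unfolding sum_distrib_left by (subst sum.swap, intro sum.cong refl, rule sum.swap)
    finally have 1: "V n \<omega> = (\<Sum>t\<in>Q. \<Sum>j\<in>lag_indices. lag_coef (\<rho> n) j * ((\<Sum>i=1..N n. lag_prod (\<rho> n) i t j \<omega>) / sqrt (real (N n))))"
      by (simp add: sum_divide_distrib[where A = Q] sum_divide_distrib[where A = lag_indices])
    \<comment> \<open>Only \<open>(0, 0, 0, 0)\<close> has order 0, and \<open>lag_mean\<close>
      vanishes there; so the case distinction in \<open>lag_limit\<close> becomes a sum of two
      terms.\<close>
    have lim0: "(\<Sum>j\<in>lag_indices. lag_limit C (\<rho> n) (N n) t j \<omega>)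
        = (\<Sum>i=1..N n. lag_prod (\<rho> n) i t (0, 0, 0, 0) \<omega>) / sqrt (real (N n)) + C * (\<Sum>j\<in>lag_indices. lag_mean t j)" for t
    proof -
      have "lag_limit C (\<rho> n) (N n) t j \<omega> = (if j = (0, 0, 0, 0) then (\<Sum>i=1..N n. lag_prod (\<rho> n) i t (0, 0, 0, 0) \<omega>) / sqrt (real (N n)) else 0)
          + C * lag_mean t j" for j
      proof (cases "j = (0, 0, 0, 0)")
        case False
        then have "lag_order j \<noteq> 0" by (cases j) auto
        then show ?thesis using False by (simp add: lag_limit_def)
      qed (simp add: lag_limit_def lag_mean_high_order)
      moreover have "(0, 0, 0, 0) \<in> lag_indices" by (simp add: lag_indices_def)
      ultimately show ?thesis by (simp add: sum.distrib sum_distrib_left)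
    qed
    have lag0: "(\<Sum>t\<in>Q. lag_prod (\<rho> n) i t (0, 0, 0, 0) \<omega>) = quartic Q (coord_block k (i + 3) \<omega>)" for i
      unfolding quartic_coord_block[OF Q(1)]
    proof (intro sum.cong refl)
      fix t assume t: "t \<in> Q"
      obtain a b c d where abcd: "t = (a, b, c, d)" by (cases t)
      have "(a, b, c, d) \<in> quads k" using t Q abcd by blast
      then have "1 \<le> a" "1 \<le> b" "1 \<le> c" "1 \<le> d" by (auto simp: quads_def)
      then show "lag_prod (\<rho> n) i t (0, 0, 0, 0) \<omega> = (case t of (a, b, c, d) \<Rightarrow>
          \<omega> (i + 3 + a - 1) * \<omega> (i + 3 + b - 1) * \<omega> (i + 3 + c - 1) * \<omega> (i + 3 + d - 1))"
        by (simp add: abcd ar1_lag_def)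
    qed
    have "(\<Sum>t\<in>Q. \<Sum>j\<in>lag_indices. lag_limit C (\<rho> n) (N n) t j \<omega>)
        = (\<Sum>t\<in>Q. (\<Sum>i=1..N n. lag_prod (\<rho> n) i t (0, 0, 0, 0) \<omega>) / sqrt (real (N n))) + ?b"
      unfolding lim0 sum.distrib sum_distrib_left[symmetric] sum_lag_mean[OF fin] ..
    also have "(\<Sum>t\<in>Q. (\<Sum>i=1..N n. lag_prod (\<rho> n) i t (0, 0, 0, 0) \<omega>) / sqrt (real (N n)))
        = (\<Sum>i=1..N n. quartic Q (coord_block k (i + 3) \<omega>)) / sqrt (real (N n))"
      unfolding lag0[symmetric] sum_divide_distrib[symmetric] by (rule arg_cong2[of _ _ _ _ "(/)"], rule sum.swap, rule refl)
    also have "(\<Sum>i=1..N n. quartic Q (coord_block k (i + 3) \<omega>)) = (\<Sum>i<N n. quartic Q (coord_block k (4 + i) \<omega>))"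
      by (rule sum.reindex_bij_witness[of _ Suc "\<lambda>i. i - 1"]) (auto simp: add.commute)
    finally have 2: "(\<Sum>t\<in>Q. \<Sum>j\<in>lag_indices. lag_limit C (\<rho> n) (N n) t j \<omega>) = S (N n) \<omega> + ?b"
      by (simp add: S_def)
    show ?thesis
      unfolding 1 2[symmetric] sum_subtractf[symmetric] sum.cartesian_product
      by (simp add: case_prod_unfold lag_error_def)
  qed
  define B where "B n = real (card (Q \<times> lag_indices)) * (real (card (Q \<times> lag_indices)) * lag_error_bound k C (\<rho> n) (sqrt (real (N n)) * (\<rho> n)\<^sup>2))" for n
  have "(\<lambda>n. B n) \<longlonglongrightarrow> real (card (Q \<times> lag_indices)) * (real (card (Q \<times> lag_indices)) * 0)"
    unfolding B_def by (intro tendsto_intros lag_error_bound_tendsto \<rho> scale)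
  then have B: "B \<longlonglongrightarrow> 0" by simp
  have "\<forall>\<^sub>F n in sequentially. \<bar>\<rho> n\<bar> < 1"
    using order_tendstoD(2)[OF tendsto_rabs_zero[OF \<rho>], of 1] by simp
  moreover have "\<forall>\<^sub>F n in sequentially. 0 < N n"
    by (rule eventually_compose_filterlim[OF eventually_gt_at_top N])
  ultimately have close: "\<forall>\<^sub>F n in sequentially. norm (char (distr null_law borel (V n)) t - char (distr null_law borel (\<lambda>\<omega>. S (N n) \<omega> + ?b)) t)
      \<le> \<bar>t\<bar> * sqrt (B n)"
  proof eventually_elim
    case (elim n)
    have e: "integrable null_law (\<lambda>\<omega>. (lag_error C (\<rho> n) (N n) (fst x) (snd x) \<omega>)\<^sup>2)"
      "(\<integral>\<omega>. (lag_error C (\<rho> n) (N n) (fst x) (snd x) \<omega>)\<^sup>2 \<partial>null_law) \<le> lag_error_bound k C (\<rho> n) (sqrt (real (N n)) * (\<rho> n)\<^sup>2)"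
      if "x \<in> Q \<times> lag_indices" for x
      using that Q(1) by (intro lag_error_L2 elim; auto)+
    have sq: "integrable null_law (\<lambda>\<omega>. (V n \<omega> - (S (N n) \<omega> + ?b))\<^sup>2)"
      unfolding decomp by (intro L2_sum(1) e) auto
    have "(\<integral>\<omega>. (V n \<omega> - (S (N n) \<omega> + ?b))\<^sup>2 \<partial>null_law)
        \<le> real (card (Q \<times> lag_indices)) * (\<Sum>x\<in>Q \<times> lag_indices. \<integral>\<omega>. (lag_error C (\<rho> n) (N n) (fst x) (snd x) \<omega>)\<^sup>2 \<partial>null_law)"
      unfolding decomp by (intro L2_sum(2) e) auto
    also have "\<dots> \<le> real (card (Q \<times> lag_indices)) * (\<Sum>x\<in>Q \<times> lag_indices. lag_error_bound k C (\<rho> n) (sqrt (real (N n)) * (\<rho> n)\<^sup>2))"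
      by (intro mult_left_mono sum_mono e) auto
    also have "\<dots> = B n" by (simp add: B_def)
    finally have "sqrt (\<integral>\<omega>. (V n \<omega> - (S (N n) \<omega> + ?b))\<^sup>2 \<partial>null_law) \<le> sqrt (B n)" by (rule real_sqrt_le_mono)
    then have "\<bar>t\<bar> * sqrt (\<integral>\<omega>. (V n \<omega> - (S (N n) \<omega> + ?b))\<^sup>2 \<partial>null_law) \<le> \<bar>t\<bar> * sqrt (B n)" by (rule mult_left_mono) simp
    note bnd = this
    have "V n \<in> borel_measurable null_law" "(\<lambda>\<omega>. S (N n) \<omega> + ?b) \<in> borel_measurable null_law"
      by measurable
    from order_trans[OF null.char_diff_le_L2[OF this sq] bnd] show ?case .
  qed
  have "(\<lambda>n. \<bar>t\<bar> * sqrt (B n)) \<longlonglongrightarrow> \<bar>t\<bar> * sqrt 0" by (intro tendsto_intros B)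
  then have "(\<lambda>n. \<bar>t\<bar> * sqrt (B n)) \<longlonglongrightarrow> 0" by simp
  with close have diff: "(\<lambda>n. char (distr null_law borel (V n)) t - char (distr null_law borel (\<lambda>\<omega>. S (N n) \<omega> + ?b)) t) \<longlonglongrightarrow> 0"
    by (rule Lim_null_comparison)
  have lim: "(\<lambda>n. char (distr null_law borel (\<lambda>\<omega>. S (N n) \<omega> + ?b)) t)
      \<longlonglongrightarrow> iexp (t * ?b) * exp (- (t\<^sup>2 * (null_sd k (quartic Q))\<^sup>2) / 2)"
  proof -
    have "(\<lambda>n. char (distr null_law borel (S n)) t) \<longlonglongrightarrow> exp (- (t\<^sup>2 * (null_sd k (quartic Q))\<^sup>2) / 2)"
      unfolding S_def by (rule char_finite_range_clt[OF quartic_mean_zero_L2[OF Q(1)] _ null_sd_quartic_pos[OF Q]]) simp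
    from filterlim_compose[OF this N] show ?thesis
      by (subst char_distr_shift) (auto intro!: tendsto_intros)
  qed
  from tendsto_add[OF diff lim] show ?thesis by (simp add: V_def[abs_def])
qed

lemma second_order_scaling:
  fixes c :: real
  defines "\<rho> \<equiv> \<lambda>n::nat. c * real n powr (-1/4)"
  shows "\<rho> \<longlonglongrightarrow> 0" and "filterlim (\<lambda>n. n - k + 1) sequentially sequentially"
    and "(\<lambda>n. sqrt (real (n - k + 1)) * (\<rho> n)\<^sup>2) \<longlonglongrightarrow> c\<^sup>2"
proof -
  have "(\<lambda>n::nat. real n powr (-1/4)) \<longlonglongrightarrow> 0" by real_asymp
  then show "\<rho> \<longlonglongrightarrow> 0" unfolding \<rho>_def by (rule tendsto_mult_right_zero)
  show "filterlim (\<lambda>n. n - k + 1) sequentially sequentially"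
    unfolding filterlim_at_top
  proof
    fix z
    show "\<forall>\<^sub>F n in sequentially. z \<le> n - k + 1"
      using eventually_ge_at_top[of "z + k"] by eventually_elim simp
  qed
  have "(\<lambda>n::nat. sqrt (real n - real k + 1) * (real n powr (-1/4))\<^sup>2) \<longlonglongrightarrow> 1"
    by real_asymp
  then have "(\<lambda>n::nat. sqrt (real n - real k + 1) * (real n powr (-1/4))\<^sup>2 * c\<^sup>2) \<longlonglongrightarrow> 1 * c\<^sup>2"
    by (intro tendsto_intros)
  then have "(\<lambda>n::nat. sqrt (real n - real k + 1) * (real n powr (-1/4))\<^sup>2 * c\<^sup>2) \<longlonglongrightarrow> c\<^sup>2" by simp
  moreover have "\<forall>\<^sub>F n in sequentially. sqrt (real n - real k + 1) * (real n powr (-1/4))\<^sup>2 * c\<^sup>2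
      = sqrt (real (n - k + 1)) * (\<rho> n)\<^sup>2"
    using eventually_ge_at_top[of k]
    by eventually_elim (simp add: \<rho>_def of_nat_diff power_mult_distrib)
  ultimately show "(\<lambda>n. sqrt (real (n - k + 1)) * (\<rho> n)\<^sup>2) \<longlonglongrightarrow> c\<^sup>2"
    by (rule Lim_transform_eventually)
qed

lemma quartic_second_order_limit:
  fixes M :: "real \<Rightarrow> 'a measure" and X :: "real \<Rightarrow> nat \<Rightarrow> 'a \<Rightarrow> real" and c :: real
  assumes ar1: "\<And>\<rho>. \<bar>\<rho>\<bar> < 1 \<Longrightarrow> gaussian_ar1 (M \<rho>) \<rho> (X \<rho>)"
    and Q: "Q \<subseteq> quads k" "Q \<noteq> {}"
  defines "\<rho> \<equiv> \<lambda>n::nat. c * real n powr (-1/4)"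
  shows "weak_conv_m (\<lambda>n. distr (M (\<rho> n)) borel (normalized_sum k (quartic Q) (X (\<rho> n)) n))
    (density lborel (normal_density (real (card (adjacent_pairs Q)) * c\<^sup>2 / null_sd k (quartic Q)) 1))"
proof -
  let ?Y = "\<lambda>\<rho> s. ar1_path \<rho> (s + 2)"
  let ?L = "density lborel (normal_density (real (card (adjacent_pairs Q)) * c\<^sup>2 / null_sd k (quartic Q)) 1)"
  define \<mu> where "\<mu> n = distr null_law borel (normalized_sum k (quartic Q) (?Y (\<rho> n)) n)" for n
  have sc: "\<rho> \<longlonglongrightarrow> 0" "filterlim (\<lambda>n. n - k + 1) sequentially sequentially"
    "(\<lambda>n. sqrt (real (n - k + 1)) * (\<rho> n)\<^sup>2) \<longlonglongrightarrow> c\<^sup>2"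
    unfolding \<rho>_def by (rule second_order_scaling)+
  note sd = null_sd_quartic_pos[OF Q]
  have qm [measurable]: "quartic Q \<in> borel_measurable (std_normal_power k)"
    using quartic_mean_zero_L2[OF Q(1)] unfolding mean_zero_L2_def by blast
  have [measurable]: "normalized_sum k (quartic Q) (?Y r) n \<in> borel_measurable null_law" for r n
    unfolding normalized_sum_def[abs_def] by measurable
  have weak: "weak_conv_m \<mu> ?L"
  proof (rule levy_continuity)
    show "real_distribution (\<mu> n)" for n
      unfolding \<mu>_def by (rule null.real_distribution_distr) measurable
    show "real_distribution ?L"
      by (intro real_distribution.intro real_distribution_axioms.intro prob_space_normal_density) simp_all
    fix t
    let ?s = "null_sd k (quartic Q)"
    have eq: "normalized_sum k (quartic Q) (?Y (\<rho> n)) n = (\<lambda>\<omega>. 1 / ?s * ((\<Sum>i=1..n - k + 1. quartic Q (block k (?Y (\<rho> n)) i \<omega>)) / sqrt (real (n - k + 1))))" for n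
    proof
      have "real (n - k + 1) powr (-1/2) = 1 / sqrt (real (n - k + 1))"
        by (simp add: powr_minus_divide powr_half_sqrt flip: minus_divide_left)
      then show "normalized_sum k (quartic Q) (?Y (\<rho> n)) n \<omega>
          = 1 / ?s * ((\<Sum>i=1..n - k + 1. quartic Q (block k (?Y (\<rho> n)) i \<omega>)) / sqrt (real (n - k + 1)))" for \<omega>
        unfolding normalized_sum_def by (simp only: mult_1 times_divide_eq_left divide_divide_eq_left mult.commute)
    qed
    have "char (\<mu> n) t = char (distr null_law borel (\<lambda>\<omega>. (\<Sum>i=1..n - k + 1. quartic Q (block k (?Y (\<rho> n)) i \<omega>)) / sqrt (real (n - k + 1)))) (1 / ?s * t)" for n
      unfolding \<mu>_def eq by (rule char_distr_scale) measurable
    moreover have "(\<lambda>n. char (distr null_law borel (\<lambda>\<omega>. (\<Sum>i=1..n - k + 1. quartic Q (block k (?Y (\<rho> n)) i \<omega>)) / sqrt (real (n - k + 1)))) (1 / ?s * t))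
        \<longlonglongrightarrow> iexp (1 / ?s * t * (c\<^sup>2 * real (card (adjacent_pairs Q)))) * exp (- ((1 / ?s * t)\<^sup>2 * ?s\<^sup>2) / 2)"
      by (rule normalized_sum_ar1_path_char[OF Q sc])
    moreover have "1 / ?s * t * (c\<^sup>2 * real (card (adjacent_pairs Q))) = t * (real (card (adjacent_pairs Q)) * c\<^sup>2 / ?s)"
      "(1 / ?s * t)\<^sup>2 * ?s\<^sup>2 = t\<^sup>2"
      using sd by (simp_all add: power_mult_distrib power_divide)
    ultimately show "(\<lambda>n. char (\<mu> n) t) \<longlonglongrightarrow> char ?L t"
      by (simp only: char_normal_density)
  qed
  \<comment> \<open>For small \<open>n\<close> the parameter may lie outside the unit interval,
    where nothing is assumed about the given model; its laws agree with those of the constructed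
    path only eventually.\<close>
  have "\<forall>\<^sub>F n in sequentially. \<bar>\<rho> n\<bar> < 1"
    using order_tendstoD(2)[OF tendsto_rabs_zero[OF sc(1)], of 1] by simp
  then have ev: "\<forall>\<^sub>F n in sequentially. \<mu> n = distr (M (\<rho> n)) borel (normalized_sum k (quartic Q) (X (\<rho> n)) n)"
  proof eventually_elim
    case (elim n)
    define H where "H = normalized_sum k (quartic Q) (\<lambda>s y. y s) n"
    \<comment> \<open>The sum reads times up to \<open>n\<close>, or up to \<open>k\<close> if
      \<open>n < k\<close>, when truncated subtraction leaves the single block \<open>i = 1\<close>.
      This window covers both cases.\<close>
    have Hm: "H \<in> borel_measurable (iid_normal {1..<n + k + 2})"
      unfolding H_def normalized_sum_def[abs_def] by measurable
    have Hr: "H (restrict x {1..<n + k + 2}) = H x" for x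
    proof -
      have "coord_block k i (restrict x {1..<n + k + 2}) = coord_block k i x" if "i \<in> {1..n - k + 1}" for i
        using that by (intro coord_block_restrict) auto
      then show ?thesis unfolding H_def normalized_sum_def by simp
    qed
    have path: "normalized_sum k (quartic Q) Z n = (\<lambda>\<omega>. H (\<lambda>s. Z s \<omega>))" for Z :: "nat \<Rightarrow> 'c \<Rightarrow> real"
      by (simp add: fun_eq_iff H_def normalized_sum_def block_def)
    have "2 \<le> n + k + 2" by simp
    from gaussian_ar1_distr_eq(1)[OF ar1[OF elim] gaussian_ar1_ar1_path[OF elim] this Hm Hr]
    show ?case unfolding \<mu>_def path by (rule sym)
  qed
  show ?thesis
    unfolding weak_conv_m_def weak_conv_def
  proof (intro allI impI)
    fix x assume "isCont (cdf ?L) x"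
    then have "(\<lambda>n. cdf (\<mu> n) x) \<longlonglongrightarrow> cdf ?L x"
      using weak by (simp add: weak_conv_m_def weak_conv_def)
    then show "(\<lambda>n. cdf (distr (M (\<rho> n)) borel (normalized_sum k (quartic Q) (X (\<rho> n)) n)) x) \<longlonglongrightarrow> cdf ?L x"
      by (rule Lim_transform_eventually) (use ev in eventually_elim, simp)
  qed
qed

text \<open>Contracting each of the adjacent pairs \<open>(a, a + 1)\<close> and
  \<open>(c, c + 1)\<close> to a point leaves \<open>a < e\<close> with
  \<open>e = c - 1 \<le> k - 2\<close>: a two-element subset of \<open>{1..k - 2}\<close>.\<close>

lemma card_adjacent_pairs_quads: "card (adjacent_pairs (quads k)) = (k - 2) choose 2"
proof -
  have "adjacent_pairs (quads k) = (\<lambda>(e, a). (a, a + 1, e + 1, e + 2)) ` (SIGMA e:{1..k - 2}. {1..<e})"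
  proof (intro set_eqI iffI)
    fix t assume "t \<in> adjacent_pairs (quads k)"
    then obtain a c where t: "t = (a, a + 1, c, c + 1)" "1 \<le> a" "a + 1 < c" "c + 1 \<le> k"
      by (auto simp: adjacent_pairs_def quads_def)
    then show "t \<in> (\<lambda>(e, a). (a, a + 1, e + 1, e + 2)) ` (SIGMA e:{1..k - 2}. {1..<e})"
      by (intro image_eqI[of _ _ "(c - 1, a)"]) auto
  qed (auto simp: adjacent_pairs_def quads_def)
  then have "card (adjacent_pairs (quads k)) = card (SIGMA e:{1..k - 2}. {1..<e})"
    by (simp add: card_image inj_on_def)
  also have "\<dots> = (\<Sum>e=1..k - 2. e - 1)" by simp
  also have "\<dots> = (k - 2) choose 2"
  proof (induction "k - 2" arbitrary: k)
    case (Suc n)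
    have "(\<Sum>e=1..n. e - 1) = n choose 2" using Suc(1)[of "n + 2"] by simp
    then show ?case unfolding Suc(2)[symmetric] by (simp add: numeral_2_eq_2)
  qed simp
  finally show ?thesis .
qed

lemma adjacent_pairs_incr:
  assumes "k \<ge> 4"
  shows "adjacent_pairs {(a, b, c, d) \<in> quads k. a = 1 \<and> d = k} = {(1, 2, k - 1, k)}"
  using assms by (auto simp: adjacent_pairs_def quads_def)

text \<open>Both claims come from the one explicit bound on the unit interval: it is the cubic
  remainder itself, and it bounds the difference quotient at 0 by a linear plus a quadratic
  term.\<close>

lemma block_mean_quartic_asymptotics:
  fixes M :: "real \<Rightarrow> 'a measure" and X :: "real \<Rightarrow> nat \<Rightarrow> 'a \<Rightarrow> real"
  assumes ar1: "\<And>\<rho>. \<bar>\<rho>\<bar> < 1 \<Longrightarrow> gaussian_ar1 (M \<rho>) \<rho> (X \<rho>)"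
    and Q: "Q \<subseteq> quads k"
  defines "m \<equiv> \<lambda>\<rho>. block_mean (M \<rho>) (X \<rho>) k (quartic Q)"
  shows "(m has_real_derivative 0) (at 0)"
    and "(\<lambda>\<rho>. m \<rho> - real (card (adjacent_pairs Q)) * \<rho>\<^sup>2) \<in> O[at 0](\<lambda>\<rho>. \<rho> ^ 3)"
proof -
  define C where "C = real (card (adjacent_pairs Q))"
  define K where "K = 11 * real (card Q * card lag_indices)"
  have bound: "\<bar>m \<rho> - C * \<rho>\<^sup>2\<bar> \<le> K * \<bar>\<rho>\<bar> ^ 3" if "\<bar>\<rho>\<bar> < 1" for \<rho>
    using block_mean_quartic_bound[OF ar1[OF that] that Q] by (simp add: m_def C_def K_def)
  have near: "\<forall>\<^sub>F \<rho> in at (0::real). \<bar>\<rho>\<bar> < 1"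
    unfolding eventually_at by (intro exI[of _ 1]) auto
  show "(\<lambda>\<rho>. m \<rho> - C * \<rho>\<^sup>2) \<in> O[at 0](\<lambda>\<rho>. \<rho> ^ 3)"
    using near by (intro bigoI[of _ K], eventually_elim) (use bound in \<open>simp add: power_abs\<close>)
  \<comment> \<open>The bound at \<rho> = 0 has right-hand side 0, so it also gives the exact value
    of the mean there.\<close>
  have "m 0 = 0" using bound[of 0] by simp
  have "((\<lambda>h. m h / h) \<longlongrightarrow> 0) (at 0)"
  proof (rule Lim_null_comparison)
    show "\<forall>\<^sub>F h in at 0. norm (m h / h) \<le> C * \<bar>h\<bar> + K * \<bar>h\<bar>\<^sup>2"
      using near eventually_neq_at_within[of 0 0 UNIV]
    proof eventually_elim
      case (elim h)
      have "C * h\<^sup>2 \<ge> 0" by (simp add: C_def)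
      then have "\<bar>m h\<bar> \<le> C * h\<^sup>2 + K * \<bar>h\<bar> ^ 3" using bound[OF elim(1)] by linarith
      also have "\<dots> = (C * \<bar>h\<bar> + K * \<bar>h\<bar>\<^sup>2) * \<bar>h\<bar>"
        by (simp add: algebra_simps power2_eq_square power3_eq_cube)
      finally show ?case using elim(2) by (simp add: pos_divide_le_eq abs_divide)
    qed
    have "((\<lambda>h. C * \<bar>h\<bar> + K * \<bar>h\<bar>\<^sup>2) \<longlongrightarrow> C * \<bar>0\<bar> + K * \<bar>0\<bar>\<^sup>2) (at 0)"
      by (intro tendsto_intros)
    then show "((\<lambda>h. C * \<bar>h\<bar> + K * \<bar>h\<bar>\<^sup>2) \<longlongrightarrow> 0) (at 0)" by simp
  qed
  then show "(m has_real_derivative 0) (at 0)"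
    using \<open>m 0 = 0\<close> by (simp add: DERIV_def)
qed

theorem proposition4p8:
  fixes k :: nat
    and M :: "real \<Rightarrow> 'a measure"
    and X :: "real \<Rightarrow> nat \<Rightarrow> 'a \<Rightarrow> real"
  assumes "k \<ge> 4"
    and "\<And>\<rho>. \<bar>\<rho>\<bar> < 1 \<Longrightarrow> gaussian_ar1 (M \<rho>) \<rho> (X \<rho>)"
  defines "g \<equiv> elem_sym4 k"
    and "g1 \<equiv> elem_sym4_incr k"
    and "m \<equiv> \<lambda>f \<rho>. block_mean (M \<rho>) (X \<rho>) k f"
  shows
    "incremental_component k g g1 \<and>
     null_sd k g > 0 \<and> null_sd k g1 > 0 \<and>
     (m g has_real_derivative 0) (at 0) \<and>
     (m g1 has_real_derivative 0) (at 0) \<and>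
     (\<lambda>\<rho>. m g \<rho> - real ((k - 2) choose 2) * \<rho>\<^sup>2) \<in> O[at 0](\<lambda>\<rho>. \<rho> ^ 3) \<and>
     (\<lambda>\<rho>. m g1 \<rho> - \<rho>\<^sup>2) \<in> O[at 0](\<lambda>\<rho>. \<rho> ^ 3) \<and>
     (\<forall>c::real. c \<noteq> 0 \<longrightarrow>
        (let \<rho> = (\<lambda>n::nat. c * real n powr (-1/4)) in
         weak_conv_m
           (\<lambda>n. distr (M (\<rho> n)) borel (normalized_sum k g (X (\<rho> n)) n))
           (density lborel (normal_density (real ((k - 2) choose 2) * c\<^sup>2 / null_sd k g) 1)) \<and>
         weak_conv_m
           (\<lambda>n. distr (M (\<rho> n)) borel (normalized_sum k g1 (X (\<rho> n)) n))
           (density lborel (normal_density (c\<^sup>2 / null_sd k g1) 1))))"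
proof -
  let ?Q = "quads k" and ?R = "{(a, b, c, d) \<in> quads k. a = 1 \<and> d = k}"
  have g: "g = quartic ?Q" and g1: "g1 = quartic ?R"
    by (simp_all only: g_def g1_def elem_sym4_eq_quartic elem_sym4_incr_eq_quartic)
  have "(1, 2, k - 1, k) \<in> ?R" using assms(1) by (auto simp: quads_def)
  then have Q: "?Q \<subseteq> quads k" "?Q \<noteq> {}" and R: "?R \<subseteq> quads k" "?R \<noteq> {}" by blast+
  have cR: "card (adjacent_pairs ?R) = 1" using adjacent_pairs_incr[OF assms(1)] by simp
  note mQ = block_mean_quartic_asymptotics[OF assms(2) Q(1), unfolded card_adjacent_pairs_quads]
  note mR = block_mean_quartic_asymptotics[OF assms(2) R(1), unfolded cR of_nat_1 mult_1]
  note wQ = quartic_second_order_limit[OF assms(2) Q, unfolded card_adjacent_pairs_quads]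
  note wR = quartic_second_order_limit[OF assms(2) R, unfolded cR of_nat_1 mult_1]
  show ?thesis
    unfolding g g1 m_def Let_def
    by (intro conjI allI impI incremental_component_quartic assms(1) null_sd_quartic_pos Q R mQ mR wQ wR)
qed

end
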